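(* Suppose that the algebra $\mathcal{A}=S^{-1}A$ is regular. Then the left $\mathcal{A}$-module $\mathrm{Der}_K(\mathcal{A})$ is generated by the derivations $\partial_{\mathbf{i},\mathbf{j}}$, $\mathbf{i}\in\mathbf{I}_r$, $\mathbf{j}\in\mathbf{J}_{r+1}$, which satisfy the following defining relations (as a left $\mathcal{A}$-module): $$\Delta(\mathbf{i},\mathbf{j})\,\partial_{\mathbf{i}',\mathbf{j}'}=\sum_{l=1}^{s}(-1)^{r+1+\nu_l}\,\Delta(\mathbf{i}';j_1',\ldots,\widehat{j_{\nu_l}'},\ldots,j_{r+1}')\,\partial_{\mathbf{i};\mathbf{j},j_{\nu_l}'}$$ for all $\mathbf{i},\mathbf{i}'\in\mathbf{I}_r$, $\mathbf{j}=(j_1,\ldots,j_r)\in\mathbf{J}_r$ and $\mathbf{j}'=(j_1',\ldots,j_{r+1}')\in\mathbf{J}_{r+1}$, where $\{j_{\nu_1}',\ldots,j_{\nu_s}'\}=\{j_1',\ldots,j_{r+1}'\}\setminus\{j_1,\ldots,j_r\}$.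
   Context: $K$ is a field of characteristic zero, $P_n=K[x_1,\ldots,x_n]$, $I=\sum_{i=1}^m P_nf_i$ is a prime but not maximal ideal of $P_n$ with generators $f_1,\ldots,f_m$, and $A=P_n/I$, a domain with field of fractions $Q$. $S$ is a multiplicatively closed subset of $A$ (with $0\notin S$) and $\mathcal{A}=S^{-1}A\subseteq Q$. $\overline{J}=\left(\overline{\partial f_i/\partial x_j}\right)\in M_{m,n}(A)$ is the Jacobi matrix (entries reduced modulo $I$) and $r$ is its rank over $Q$. For tuples $\mathbf{i}=(i_1,\ldots,i_r)$ of indices in $\{1,\ldots,m\}$ and $\mathbf{j}=(j_1,\ldots,j_r)$ of indices in $\{1,\ldots,n\}$, $\Delta(\mathbf{i},\mathbf{j})=\Delta(\mathbf{i};j_1,\ldots,j_r)=\det(\overline{J}_{i_\nu,j_\mu})_{\nu,\mu=1,\ldots,r}$ (columns in the listed order). A strictly increasing $\mathbf{i}$ (resp. $\mathbf{j}$) is non-singular if $\Delta(\mathbf{i},\mathbf{j}')\ne0$ for some $\mathbf{j}'$ (resp. $\Delta(\mathbf{i}',\mathbf{j})\neq0$ for some $\mathbf{i}'$); $\mathbf{I}_r$ (resp. $\mathbf{J}_r$) is the set of non-singular strictly increasing $r$-tuples $\mathbf{i}$ (resp. $\mathbf{j}$). $\mathbf{J}_{r+1}$ is the set of strictly increasing $(r+1)$-tuples of indices in $\{1,\ldots,n\}$ such that deleting some element leaves an element of $\mathbf{J}_r$. A hat means the symbol is omitted. For $\mathbf{i}=(i_1,\ldots,i_r)$ and $\mathbf{j}=(j_1,\ldots,j_{r+1})$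 (not necessarily increasing), $\partial_{\mathbf{i},\mathbf{j}}=\sum_{k=1}^{r+1}(-1)^{r+1+k}\Delta(\mathbf{i};j_1,\ldots,\widehat{j_k},\ldots,j_{r+1})\,\partial/\partial x_{j_k}$, i.e. the well-defined $K$-derivation of $A$ sending $x_{j_k}$ to $(-1)^{r+1+k}\Delta(\mathbf{i};j_1,\ldots,\widehat{j_k},\ldots,j_{r+1})$ and $x_l$ to $0$ for $l\notin\{j_1,\ldots,j_{r+1}\}$, extended uniquely to $\mathcal{A}$. $\partial_{\mathbf{i};\mathbf{j},k}$ means $\partial_{\mathbf{i};j_1,\ldots,j_r,k}$; permuting the last $r+1$ indices multiplies the derivation by the sign of the permutation, so $\partial_{\mathbf{i};\mathbf{j},k}$ is $\pm$ a generator. "Defining relations" means that $\mathrm{Der}_K(\mathcal{A})$ is the quotient of the free left $\mathcal{A}$-module on the symbols $\partial_{\mathbf{i},\mathbf{j}}$ ($\mathbf{i}\in\mathbf{I}_r,\mathbf{j}\in\mathbf{J}_{r+1}$) by the submodule generated by the relations. *)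

theory Defs
  imports
    "HOL-Library.Poly_Mapping"
    "HOL-Library.Extended_Nat"
    "HOL-Algebra.Ring_Divisibility"
    "Jordan_Normal_Form.DL_Rank"
begin

section \<open>Polynomials in finitely many variables\<close>

text \<open>The keys of a polynomial are its exponent vectors. Variables and generators are
  numbered from 0 throughout: the variables of the ring in \<open>n\<close> variables are \<open>0, \<dots>, n - 1\<close>.\<close>

type_synonym 'k mpoly = "(nat \<Rightarrow>\<^sub>0 nat) \<Rightarrow>\<^sub>0 'k"

abbreviation ring_on :: "'a::{times,plus,one,zero} set \<Rightarrow> 'a ring" where
  "ring_on C \<equiv> class_ring\<lparr>carrier := C\<rparr>"

definition poly_ring :: "nat \<Rightarrow> 'k::comm_ring_1 mpoly ring" where
  "poly_ring n = ring_on {p. \<forall>e \<in> Poly_Mapping.keys p. Poly_Mapping.keys e \<subseteq> {..<n}}"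

definition Const :: "'k::comm_ring_1 \<Rightarrow> 'k mpoly" where
  "Const c = Poly_Mapping.single 0 c"

definition Var :: "nat \<Rightarrow> 'k::comm_ring_1 mpoly" where
  "Var l = Poly_Mapping.single (Poly_Mapping.single l 1) 1"

text \<open>In the next definition the truncated subtraction only matters for exponent vectors
  in which \<open>x\<^sub>l\<close> does not occur, and those get the coefficient 0.\<close>

definition partial_deriv :: "nat \<Rightarrow> 'k::comm_ring_1 mpoly \<Rightarrow> 'k mpoly" where
  "partial_deriv l p =
     (\<Sum>e \<in> Poly_Mapping.keys p.
        Poly_Mapping.single (e - Poly_Mapping.single l 1)
          (of_nat (Poly_Mapping.lookup e l) * Poly_Mapping.lookup p e))"


section \<open>Fractions and regularity\<close>

text \<open>The field type \<open>'q\<close> is the field of fractions of the domain \<open>A\<close>, embedded by \<open>\<iota>\<close>.\<close>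

definition fraction_field :: "('a, 'b) ring_scheme \<Rightarrow> ('a \<Rightarrow> 'q::field) \<Rightarrow> bool" where
  "fraction_field A \<iota> \<longleftrightarrow>
     \<iota> \<in> Ring.ring_hom A class_ring \<and> inj_on \<iota> (carrier A) \<and>
     (\<forall>q. \<exists>a \<in> carrier A. \<exists>b \<in> carrier A. b \<noteq> \<zero>\<^bsub>A\<^esub> \<and> q = \<iota> a / \<iota> b)"

definition fractions :: "'q::field set \<Rightarrow> 'q set \<Rightarrow> 'q set" where
  "fractions C T = {a / s | a s. a \<in> C \<and> s \<in> T}"

definition krull_dim :: "('a, 'b) ring_scheme \<Rightarrow> enat" where
  "krull_dim R =
     Sup {enat k | k. \<exists>p :: nat \<Rightarrow> 'a set.
            (\<forall>i \<le> k. primeideal (p i) R) \<and> (\<forall>i < k. p i \<subset> p (Suc i))}"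

text \<open>A Noetherian local ring whose maximal ideal can be generated by as many elements as
  its Krull dimension.\<close>

definition regular_local_ring :: "('a, 'b) ring_scheme \<Rightarrow> bool" where
  "regular_local_ring R \<longleftrightarrow>
     cring R \<and> noetherian_ring R \<and> (\<exists>!M. maximalideal M R) \<and>
     (\<exists>X \<subseteq> carrier R. finite X \<and> enat (card X) = krull_dim R \<and>
        maximalideal (Idl\<^bsub>R\<^esub> X) R)"

text \<open>Only for subrings \<open>C\<close> of a field, so that all localizations can be formed inside
  that field.\<close>

definition regular_subring :: "'q::field set \<Rightarrow> bool" where
  "regular_subring C \<longleftrightarrow>
     cring (ring_on C) \<and> noetherian_ring (ring_on C) \<and>
     (\<forall>p. primeideal p (ring_on C) \<longrightarrow> regular_local_ring (ring_on (fractions C (C - p))))"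


section \<open>Derivations\<close>

text \<open>\<open>\<kappa>\<close> is the structure map of the algebra. Derivations are extensional functions on \<open>C\<close>,
  so they form a submodule of \<^const>\<open>LinearCombinations.ring.func_space\<close>.\<close>

definition derivations :: "('k \<Rightarrow> 'q::field) \<Rightarrow> 'q set \<Rightarrow> ('q \<Rightarrow> 'q) set" where
  "derivations \<kappa> C =
     {D \<in> C \<rightarrow>\<^sub>E C.
        (\<forall>a \<in> C. \<forall>b \<in> C. D (a + b) = D a + D b) \<and>
        (\<forall>c. \<forall>a \<in> C. D (\<kappa> c * a) = \<kappa> c * D a) \<and>
        (\<forall>a \<in> C. \<forall>b \<in> C. D (a * b) = D a * b + a * D b)}"

definition der_module :: "('k \<Rightarrow> 'q::field) \<Rightarrow> 'q set \<Rightarrow> ('q, 'q \<Rightarrow> 'q) module" where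
  "der_module \<kappa> C = (LinearCombinations.ring.func_space (ring_on C) C)\<lparr>carrier := derivations \<kappa> C\<rparr>"


section \<open>Minors of the Jacobi matrix\<close>

definition minor :: "'q::field mat \<Rightarrow> nat list \<Rightarrow> nat list \<Rightarrow> 'q" where
  "minor J is js = det (mat (length is) (length js) (\<lambda>(a, b). J $$ (is ! a, js ! b)))"

definition tuples :: "nat \<Rightarrow> nat \<Rightarrow> nat list set" where
  "tuples N r = {is. length is = r \<and> set is \<subseteq> {..<N}}"

definition inc_tuples :: "nat \<Rightarrow> nat \<Rightarrow> nat list set" where
  "inc_tuples N r = {is \<in> tuples N r. sorted_wrt (<) is}"

definition omit :: "nat \<Rightarrow> 'a list \<Rightarrow> 'a list" where
  "omit k js = take k js @ drop (Suc k) js"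

definition nonsing_rows :: "'q::field mat \<Rightarrow> nat \<Rightarrow> nat list set" where
  "nonsing_rows J r =
     {is \<in> inc_tuples (dim_row J) r. \<exists>js \<in> tuples (dim_col J) r. minor J is js \<noteq> 0}"

definition nonsing_cols :: "'q::field mat \<Rightarrow> nat \<Rightarrow> nat list set" where
  "nonsing_cols J r =
     {js \<in> inc_tuples (dim_col J) r. \<exists>is \<in> tuples (dim_row J) r. minor J is js \<noteq> 0}"

definition nonsing_cols_ext :: "'q::field mat \<Rightarrow> nat \<Rightarrow> nat list set" where
  "nonsing_cols_ext J r =
     {js \<in> inc_tuples (dim_col J) (r + 1). \<exists>k < r + 1. omit k js \<in> nonsing_cols J r}"

text \<open>The coefficient of \<open>\<partial>/\<partial>x\<close> for the \<open>k\<close>-th entry of \<open>js\<close>, where \<open>js\<close> has length \<open>r + 1\<close>;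
  counting from 0 instead of from 1 turns the sign exponent \<open>r + 1 + k\<close> into \<open>r + 1 + Suc k\<close>.\<close>

definition jac_coeff :: "'q::field mat \<Rightarrow> nat list \<Rightarrow> nat list \<Rightarrow> nat \<Rightarrow> 'q" where
  "jac_coeff J is js k = (-1) ^ (length js + Suc k) * minor J is (omit k js)"

text \<open>\<open>x l\<close> is the image of the \<open>l\<close>-th variable in \<open>C\<close>.\<close>

definition is_jac_der ::
    "('k \<Rightarrow> 'q::field) \<Rightarrow> 'q set \<Rightarrow> (nat \<Rightarrow> 'q) \<Rightarrow> 'q mat \<Rightarrow> nat list \<Rightarrow> nat list \<Rightarrow> ('q \<Rightarrow> 'q) \<Rightarrow> bool"
  where
  "is_jac_der \<kappa> C x J is js D \<longleftrightarrow>
     D \<in> derivations \<kappa> C \<and>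
     (\<forall>l < dim_col J. D (x l) = (\<Sum>k \<in> {k. k < length js \<and> js ! k = l}. jac_coeff J is js k))"

definition jac_der ::
    "('k \<Rightarrow> 'q::field) \<Rightarrow> 'q set \<Rightarrow> (nat \<Rightarrow> 'q) \<Rightarrow> 'q mat \<Rightarrow> nat list \<Rightarrow> nat list \<Rightarrow> 'q \<Rightarrow> 'q" where
  "jac_der \<kappa> C x J is js = (THE D. is_jac_der \<kappa> C x J is js D)"


section \<open>The relations in the free module\<close>

text \<open>The free module on the finite set \<open>G\<close> of symbols is \<^const>\<open>LinearCombinations.ring.func_space\<close> on \<open>G\<close>.
  For a tuple \<open>js\<close> of distinct indices that need not be increasing, \<open>symbol\<close> is the basis
  element of the sorted tuple times the sign of the sorting permutation.\<close>

definition sort_sign :: "nat list \<Rightarrow> 'q::field" where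
  "sort_sign js = (-1) ^ card {(a, b). a < b \<and> b < length js \<and> js ! b < js ! a}"

definition symbol ::
    "(nat list \<times> nat list) set \<Rightarrow> nat list \<Rightarrow> nat list \<Rightarrow> nat list \<times> nat list \<Rightarrow> 'q::field" where
  "symbol G is js = (\<lambda>g \<in> G. if g = (is, sort js) then sort_sign js else 0)"

definition relator ::
    "'q::field mat \<Rightarrow> (nat list \<times> nat list) set \<Rightarrow>
      nat list \<Rightarrow> nat list \<Rightarrow> nat list \<Rightarrow> nat list \<Rightarrow> nat list \<times> nat list \<Rightarrow> 'q" where
  "relator J G is js is' js' =
     (\<lambda>g \<in> G. minor J is js * symbol G is' js' g -
        (\<Sum>k \<in> {k. k < length js' \<and> js' ! k \<notin> set js}.
            jac_coeff J is' js' k * symbol G is (js @ [js' ! k]) g))"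

end

theory Submission
  imports Defs "HOL-Computational_Algebra.Polynomial"
begin

text \<open>A derivation \<open>D\<close> of \<open>C = S\<inverse>A\<close> is given by the vector of the values \<open>D x\<^sub>l\<close>, which lies in
  the kernel of the Jacobi matrix. If \<open>\<Delta>(i, j) \<noteq> 0\<close>, a vector of this kernel is determined by
  its entries outside \<open>j\<close>, and comparing these entries gives
  \<open>\<Delta>(i, j) D = \<Sum> D x\<^sub>l \<partial>\<^bsub>i; j, l\<^esub>\<close>, the sum over \<open>l \<notin> j\<close>. For \<open>D = \<partial>\<^bsub>i', j'\<^esub>\<close> this is the
  relation. Once the \<open>r\<close>-minors generate the unit ideal of \<open>C\<close>, a combination of these identities
  shows that the \<open>\<partial>\<^bsub>i, j\<^esub>\<close> generate, and a combination of the relators expresses every syzygy.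

  That the minors generate the unit ideal is the Jacobian criterion. Otherwise they lie in a prime
  ideal; let \<open>R\<close> be the localization of \<open>C\<close> there, \<open>P\<close> its maximal ideal, \<open>k = R / P\<close>, and \<open>\<rho> < r\<close>
  the largest size of a minor outside \<open>P\<close>. The kernel of the matrix modulo \<open>P\<close> yields \<open>n - \<rho>\<close>
  independent \<open>K\<close>-derivations \<open>R \<rightarrow> k\<close>. By regularity \<open>P\<close> is generated by \<open>d = dim R\<close> elements,
  so in characteristic zero such a derivation is determined by \<open>d + e\<close> values, where \<open>e\<close> is the
  transcendence degree of \<open>k\<close>; hence \<open>n - \<rho> \<le> d + e\<close>. A chain of \<open>d + 1\<close> primes of \<open>R\<close> shows
  \<open>d + e \<le> tr.deg Q\<close>, and \<open>tr.deg Q \<le> n - r\<close> because derivations extend along field extensions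
  of characteristic zero. So \<open>\<rho> \<ge> r\<close>, a contradiction. The residue field \<open>k\<close> depends on the prime
  and is not available as a type, so all computations in \<open>k\<close> are congruences modulo \<open>P\<close>.\<close>

section \<open>Subrings of a field and their ideals\<close>

text \<open>Transcendence degree enters only through towers K[y_1, ..., y_e]: writing one down gives
  a lower bound, and the upper bound n - r in Q comes from counting derivations. A tower of length N
  carries N derivations of Q that are independent over Q, while a K-derivation of Q is fixed by its
  values at the n variables, of which a nonzero r-minor makes r dependent on the others. The linear
  algebra modulo P and the linear algebra in Q are one lemma, \<open>homogeneous_solution\<close>: Q
  is the case \<open>UNIV\<close>, \<open>{0}\<close>.

  Characteristic zero serves the same purpose twice: a polynomial of minimal degree vanishing at an
  element has a derivative that does not vanish there. The d generators of P cost d values only,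
  because D(c x) = D(c) x + c D(x) lies in P as soon as x and D(x) do.

  The syzygies need no further geometry. If the sum of all c_g \<partial>_g is 0, then in the sum of
  the relators of g with weights c_g everything but \<Delta>(i, j) c cancels, since the coefficients
  of the remaining terms are values of the zero derivation at the variables.\<close>

locale field_subring =
  fixes R :: "'q::field set"
  assumes one_in: "1 \<in> R"
    and add_in: "a \<in> R \<Longrightarrow> b \<in> R \<Longrightarrow> a + b \<in> R"
    and mult_in: "a \<in> R \<Longrightarrow> b \<in> R \<Longrightarrow> a * b \<in> R"
    and uminus_in: "a \<in> R \<Longrightarrow> - a \<in> R"
begin

lemma zero_in: "0 \<in> R"
  using add_in[OF one_in uminus_in[OF one_in]] by simp

lemma diff_in: "a \<in> R \<Longrightarrow> b \<in> R \<Longrightarrow> a - b \<in> R"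
  using add_in[of a "- b"] uminus_in[of b] by simp

lemma sum_in: "(\<And>u. u \<in> U \<Longrightarrow> g u \<in> R) \<Longrightarrow> (\<Sum>u\<in>U. g u) \<in> R"
  by (induction U rule: infinite_finite_induct) (auto simp: zero_in add_in)

lemma prod_in: "(\<And>u. u \<in> U \<Longrightarrow> g u \<in> R) \<Longrightarrow> (\<Prod>u\<in>U. g u) \<in> R"
  by (induction U rule: infinite_finite_induct) (auto simp: one_in mult_in)

lemma power_in: "a \<in> R \<Longrightarrow> a ^ k \<in> R"
  by (induction k) (auto simp: one_in mult_in)

lemma of_nat_in: "of_nat k \<in> R"
  by (induction k) (auto simp: zero_in one_in add_in)

lemmas closed_intros = one_in zero_in add_in mult_in uminus_in diff_in sum_in prod_in power_in of_nat_in

lemma poly_in: "(\<And>i. coeff F i \<in> R) \<Longrightarrow> y \<in> R \<Longrightarrow> poly F y \<in> R"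
  by (auto simp: poly_altdef intro!: closed_intros)

end

locale subring_ideal = field_subring +
  fixes P :: "'q::field set"
  assumes ideal_sub: "P \<subseteq> R"
    and ideal_zero: "0 \<in> P"
    and ideal_add: "a \<in> P \<Longrightarrow> b \<in> P \<Longrightarrow> a + b \<in> P"
    and ideal_mult: "a \<in> R \<Longrightarrow> b \<in> P \<Longrightarrow> a * b \<in> P"
begin

lemma ideal_mult2: "b \<in> P \<Longrightarrow> a \<in> R \<Longrightarrow> b * a \<in> P"
  using ideal_mult[of a b] by (simp add: mult.commute)

lemma ideal_uminus: "a \<in> P \<Longrightarrow> - a \<in> P"
  using ideal_mult[of "- 1" a] uminus_in[OF one_in] by simp

lemma ideal_diff: "a \<in> P \<Longrightarrow> b \<in> P \<Longrightarrow> a - b \<in> P"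
  using ideal_add[of a "- b"] ideal_uminus[of b] by simp

lemma ideal_sum: "(\<And>u. u \<in> U \<Longrightarrow> g u \<in> P) \<Longrightarrow> (\<Sum>u\<in>U. g u) \<in> P"
  by (induction U rule: infinite_finite_induct) (auto simp: ideal_zero ideal_add)

lemmas ideal_intros = ideal_zero ideal_add ideal_mult ideal_mult2 ideal_uminus ideal_diff ideal_sum

lemma ideal_cong: "a \<in> P \<Longrightarrow> b - a \<in> P \<Longrightarrow> b \<in> P"
  using ideal_add[of a "b - a"] by simp

end

locale subring_prime = subring_ideal +
  assumes one_notin: "1 \<notin> P"
    and prime: "a \<in> R \<Longrightarrow> b \<in> R \<Longrightarrow> a * b \<in> P \<Longrightarrow> a \<in> P \<or> b \<in> P"

text \<open>\<open>inverse\<close> is taken in the ambient field, so the last axiom makes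
  \<open>P\<close> the unique maximal ideal of \<open>R\<close> and allows division inside
  \<open>R\<close> by everything outside \<open>P\<close>.\<close>

locale local_subring = subring_ideal +
  assumes one_notin: "1 \<notin> P"
    and inverse_in: "a \<in> R \<Longrightarrow> a \<notin> P \<Longrightarrow> inverse a \<in> R"
begin

lemma unit_cancel:
  assumes "a \<in> R" "a \<notin> P" "a * b \<in> P"
  shows "b \<in> P"
proof -
  have "a \<noteq> 0" using assms ideal_zero by auto
  then show ?thesis
    using ideal_mult[OF inverse_in[OF assms(1,2)] assms(3)] by (simp add: mult.assoc[symmetric])
qed

sublocale subring_prime
proof
  show "1 \<notin> P" by (fact one_notin)
  show "a \<in> P \<or> b \<in> P" if "a \<in> R" "b \<in> R" "a * b \<in> P" for a b
    using unit_cancel[of a b] that by blast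
qed

text \<open>Gaussian elimination over \<open>R / P\<close>, by induction on the number of equations.
  A pivot outside \<open>P\<close> has its inverse in \<open>R\<close>; an equation with all
  coefficients in \<open>P\<close> imposes no condition.\<close>

lemma homogeneous_solution:
  assumes "finite U" "M < card U" "\<And>i u. i < M \<Longrightarrow> u \<in> U \<Longrightarrow> a i u \<in> R"
  shows "\<exists>c. (\<forall>u\<in>U. c u \<in> R) \<and> (\<exists>u\<in>U. c u \<notin> P) \<and> (\<forall>i<M. (\<Sum>u\<in>U. a i u * c u) \<in> P)"
  using assms
proof (induction M arbitrary: U a)
  case 0
  then obtain u where "u \<in> U" by (metis card_gt_0_iff ex_in_conv)
  then show ?case by (intro exI[of _ "\<lambda>_. 1"]) (auto simp: one_in one_notin)
next
  case (Suc M)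
  show ?case
  proof (cases "\<forall>u\<in>U. a M u \<in> P")
    case True
    obtain c where c: "\<forall>u\<in>U. c u \<in> R" "\<exists>u\<in>U. c u \<notin> P" "\<forall>i<M. (\<Sum>u\<in>U. a i u * c u) \<in> P"
      using Suc.IH[of U a] Suc.prems by auto
    have "(\<Sum>u\<in>U. a M u * c u) \<in> P" using True c by (auto intro!: ideal_sum ideal_mult2)
    then show ?thesis using c by (intro exI[of _ c]) (auto simp: less_Suc_eq)
  next
    case False
    then obtain w where w: "w \<in> U" "a M w \<notin> P" by auto
    let ?p = "inverse (a M w)"
    have p: "?p \<in> R" "a M w \<noteq> 0" using Suc.prems w inverse_in ideal_zero by auto
    let ?U = "U - {w}"
    let ?a = "\<lambda>i u. a i u - a i w * a M u * ?p"
    have "M < card ?U" using Suc.prems w by simp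
    moreover have "\<And>i u. i < M \<Longrightarrow> u \<in> ?U \<Longrightarrow> ?a i u \<in> R"
      using Suc.prems w p by (auto intro!: closed_intros)
    ultimately obtain c where c: "\<forall>u\<in>?U. c u \<in> R" "\<exists>u\<in>?U. c u \<notin> P"
        "\<forall>i<M. (\<Sum>u\<in>?U. ?a i u * c u) \<in> P"
      using Suc.IH[of ?U ?a] Suc.prems by auto
    define s where "s = (\<Sum>u\<in>?U. a M u * c u)"
    \<comment> \<open>This value at the pivot makes the equation \<open>M\<close> hold exactly and
      turns the others into the reduced equations.\<close>
    define c' where "c' = c(w := - s * ?p)"
    have s: "s \<in> R" unfolding s_def using Suc.prems c by (auto intro!: closed_intros)
    have split: "(\<Sum>u\<in>U. a i u * c' u) = (\<Sum>u\<in>?U. ?a i u * c u)" for i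
    proof -
      have "(\<Sum>u\<in>U. a i u * c' u) = a i w * c' w + (\<Sum>u\<in>?U. a i u * c' u)"
        using Suc.prems w by (simp add: sum.remove)
      also have "(\<Sum>u\<in>?U. a i u * c' u) = (\<Sum>u\<in>?U. a i u * c u)"
        by (rule sum.cong) (auto simp: c'_def)
      also have "a i w * c' w = (\<Sum>u\<in>?U. - (a i w * a M u * ?p) * c u)"
        by (simp add: c'_def s_def sum_distrib_left sum_distrib_right sum_negf algebra_simps)
      finally show ?thesis by (simp add: sum.distrib[symmetric] algebra_simps)
    qed
    have "(\<Sum>u\<in>?U. ?a M u * c u) = 0" using p by simp
    then have "\<forall>i<Suc M. (\<Sum>u\<in>U. a i u * c' u) \<in> P"
      using c split by (auto simp: less_Suc_eq ideal_zero)
    moreover have "\<forall>u\<in>U. c' u \<in> R" using c s p by (auto simp: c'_def intro!: closed_intros)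
    moreover have "\<exists>u\<in>U. c' u \<notin> P" using c by (auto simp: c'_def)
    ultimately show ?thesis by blast
  qed
qed

end

lemma local_subring_UNIV: "local_subring UNIV {0}"
  by unfold_locales auto


section \<open>Towers of transcendental extensions\<close>

abbreviation coeffs_in :: "'q::field poly \<Rightarrow> 'q set \<Rightarrow> bool" where
  "coeffs_in F B \<equiv> \<forall>i. coeff F i \<in> B"

definition adjoin :: "'q::field set \<Rightarrow> 'q \<Rightarrow> 'q set" where
  "adjoin B y = {poly F y | F. coeffs_in F B}"

text \<open>\<open>B\<close> is the ring K[y_1, ..., y_e], not the field it generates. So a tower
  can lie inside \<open>R\<close>, and \<open>B \<inter> P \<subseteq> {0}\<close> says that it
  stays transcendental modulo \<open>P\<close>.\<close>

inductive transc_tower :: "'q::field set \<Rightarrow> nat \<Rightarrow> 'q set \<Rightarrow> bool" for K where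
  base: "transc_tower K 0 K"
| adjoin: "transc_tower K e B \<Longrightarrow> (\<And>F. coeffs_in F B \<Longrightarrow> poly F y = 0 \<Longrightarrow> F = 0) \<Longrightarrow>
    transc_tower K (Suc e) (adjoin B y)"

context field_subring
begin

lemma coeffs_in_add: "coeffs_in F R \<Longrightarrow> coeffs_in H R \<Longrightarrow> coeffs_in (F + H) R"
  by (auto intro: add_in)

lemma coeffs_in_mult: "coeffs_in F R \<Longrightarrow> coeffs_in H R \<Longrightarrow> coeffs_in (F * H) R"
  by (auto simp: coeff_mult intro!: closed_intros)

lemma coeffs_in_pderiv: "coeffs_in F R \<Longrightarrow> coeffs_in (pderiv F) R"
  by (auto simp: coeff_pderiv simp del: of_nat_Suc intro!: closed_intros)

lemma adjoin_subring: "field_subring (adjoin R y)"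
proof
  show "1 \<in> adjoin R y"
    unfolding adjoin_def by (auto intro!: exI[of _ 1] closed_intros simp: coeff_1)
  fix a b assume "a \<in> adjoin R y" "b \<in> adjoin R y"
  then obtain F H where F: "coeffs_in F R" "a = poly F y" and H: "coeffs_in H R" "b = poly H y"
    unfolding adjoin_def by auto
  show "a + b \<in> adjoin R y"
    unfolding adjoin_def using F H coeffs_in_add[of F H] by (auto intro!: exI[of _ "F + H"])
  show "a * b \<in> adjoin R y"
    unfolding adjoin_def using F H coeffs_in_mult[of F H] by (auto intro!: exI[of _ "F * H"])
  show "- a \<in> adjoin R y"
    unfolding adjoin_def using F by (auto intro!: exI[of _ "- F"] uminus_in)
qed

lemma sub_adjoin: "R \<subseteq> adjoin R y"
proof
  fix a assume "a \<in> R"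
  then show "a \<in> adjoin R y" unfolding adjoin_def
    by (auto intro!: exI[of _ "[:a:]"] simp: coeff_pCons zero_in split: nat.split)
qed

lemma self_in_adjoin: "y \<in> adjoin R y"
  unfolding adjoin_def
  by (auto intro!: exI[of _ "[:0, 1:]"] simp: coeff_pCons zero_in one_in split: nat.split)

lemma adjoin_sub: "B \<subseteq> R \<Longrightarrow> y \<in> R \<Longrightarrow> adjoin B y \<subseteq> R"
  unfolding adjoin_def by (auto intro!: poly_in)

lemma transc_tower_subring: "transc_tower R e B \<Longrightarrow> field_subring B"
  by (induction rule: transc_tower.induct) (auto intro: field_subring.adjoin_subring field_subring_axioms)

lemma transc_tower_sub: "transc_tower R e B \<Longrightarrow> R \<subseteq> B"
  by (induction rule: transc_tower.induct)
     (use field_subring.sub_adjoin transc_tower_subring in blast)+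

end

text \<open>Read the equation from the constant term upwards: it lies in \<open>B \<inter> P'\<close>, and the
  factor \<open>u\<close> that is left can be cancelled modulo \<open>P\<close>.\<close>

lemma transcendental_modulo_prime:
  assumes "subring_prime R P" "subring_ideal R P'" "P \<subseteq> P'" "u \<in> P'" "u \<notin> P"
    and "B \<subseteq> R" "B \<inter> P' \<subseteq> {0}" "coeffs_in F B" "poly F u \<in> P"
  shows "F = 0"
  using assms(8,9)
proof (induction F)
  case 0
  show ?case by simp
next
  case (pCons a F)
  interpret P: subring_prime R P by fact
  interpret P': subring_ideal R P' by fact
  have u: "u \<in> R" using assms P'.ideal_sub by auto
  have aB: "a \<in> B" using pCons.prems(1) by (metis coeff_pCons_0)
  have FB: "coeffs_in F B" using pCons.prems(1) by (metis coeff_pCons_Suc)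
  have F: "poly F u \<in> R" using FB u assms by (intro P.poly_in) auto
  have "u * poly F u \<in> P'" using assms F by (auto intro: P'.ideal_mult2)
  moreover have "a + u * poly F u \<in> P'" using pCons.prems assms by auto
  ultimately have "a \<in> P'" using P'.ideal_diff by fastforce
  then have a: "a = 0" using aB assms by auto
  then have "u * poly F u \<in> P" using pCons.prems by simp
  then have "poly F u \<in> P" using P.prime u F assms by blast
  then show ?case using a pCons.IH FB by simp
qed

text \<open>The chain is descended from its top. If the tower injects into \<open>R\<close> modulo
  \<open>p (Suc d)\<close>, then an element of \<open>p (Suc d)\<close> outside \<open>p d\<close>
  is transcendental over it modulo \<open>p d\<close>, so the longer tower injects into
  \<open>R\<close> modulo \<open>p d\<close>.\<close>

lemma transc_tower_prime_chain:
  assumes "\<And>i. i \<le> d \<Longrightarrow> subring_prime R (p i)" "\<And>i. i < d \<Longrightarrow> p i \<subset> p (Suc i)"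
    and "transc_tower K e B" "B \<subseteq> R" "B \<inter> p d \<subseteq> {0}"
  shows "\<exists>B'. transc_tower K (e + d) B'"
  using assms
proof (induction d arbitrary: e B)
  case 0
  then show ?case by auto
next
  case (Suc d)
  interpret P: subring_prime R "p d" using Suc.prems by simp
  interpret P': subring_prime R "p (Suc d)" using Suc.prems by simp
  obtain u where u: "u \<in> p (Suc d)" "u \<notin> p d" using Suc.prems(2)[of d] by auto
  \<comment> \<open>Stronger than transcendence in the field, as \<open>0 \<in> p d\<close>; this
    form keeps the intersection with \<open>p d\<close> trivial for the next step down.\<close>
  have *: "F = 0" if "coeffs_in F B" "poly F u \<in> p d" for F
    using transcendental_modulo_prime[of R "p d" "p (Suc d)" u B F] that u Suc.prems
      P.subring_prime_axioms P'.subring_ideal_axioms by blast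
  have "F = 0" if "coeffs_in F B" "poly F u = 0" for F
    using *[of F] that P.ideal_zero by simp
  then have "transc_tower K (Suc e) (adjoin B u)"
    using Suc.prems by (intro transc_tower.adjoin) auto
  moreover have "adjoin B u \<subseteq> R" using Suc.prems u P'.ideal_sub by (intro P.adjoin_sub) auto
  moreover have "adjoin B u \<inter> p d \<subseteq> {0}" unfolding adjoin_def by (auto dest!: *)
  ultimately show ?case using Suc.IH[of "Suc e" "adjoin B u"] Suc.prems by auto
qed


section \<open>Extending derivations of a field of characteristic zero\<close>

text \<open>A derivation is represented by its graph, which is a subring of the dual numbers.\<close>

locale derivation_graph =
  fixes G :: "('q::field \<times> 'q) set"
  assumes graph_one: "(1, 0) \<in> G"
    and graph_add: "(a, a') \<in> G \<Longrightarrow> (b, b') \<in> G \<Longrightarrow> (a + b, a' + b') \<in> G"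
    and graph_mult: "(a, a') \<in> G \<Longrightarrow> (b, b') \<in> G \<Longrightarrow> (a * b, a' * b + a * b') \<in> G"
    and graph_uminus: "(a, a') \<in> G \<Longrightarrow> (- a, - a') \<in> G"
    and graph_zero: "(0, a') \<in> G \<Longrightarrow> a' = 0"
begin

lemma graph_fun: "(a, a') \<in> G \<Longrightarrow> (a, a'') \<in> G \<Longrightarrow> a' = a''"
  using graph_add[of a a' "- a" "- a''"] graph_uminus[of a a''] graph_zero[of "a' - a''"] by simp

lemma graph_zero_in: "(0, 0) \<in> G"
  using graph_add[OF graph_one graph_uminus[OF graph_one]] by simp

lemma graph_sum: "(\<And>u. u \<in> U \<Longrightarrow> (g u, g' u) \<in> G) \<Longrightarrow> ((\<Sum>u\<in>U. g u), (\<Sum>u\<in>U. g' u)) \<in> G"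
  by (induction U rule: infinite_finite_induct) (auto simp: graph_zero_in graph_add)

text \<open>\<open>F'\<close> is the polynomial obtained by applying the derivation to the
  coefficients of \<open>F\<close>. It is a relation because the derivation is given only by its
  graph.\<close>

definition lift :: "'q poly \<Rightarrow> 'q poly \<Rightarrow> bool" where
  "lift F F' \<longleftrightarrow> (\<forall>i. (coeff F i, coeff F' i) \<in> G)"

lemma lift_add: "lift F F' \<Longrightarrow> lift H H' \<Longrightarrow> lift (F + H) (F' + H')"
  by (auto simp: lift_def graph_add)

lemma lift_uminus: "lift F F' \<Longrightarrow> lift (- F) (- F')"
  by (auto simp: lift_def graph_uminus)

lemma lift_mult: "lift F F' \<Longrightarrow> lift H H' \<Longrightarrow> lift (F * H) (F' * H + F * H')"
  unfolding lift_def coeff_mult coeff_add sum.distrib[symmetric]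
  by (intro allI graph_sum graph_mult) blast+

lemma lift_const: "(a, a') \<in> G \<Longrightarrow> lift [:a:] [:a':]"
  by (auto simp: lift_def coeff_pCons graph_zero_in split: nat.split)

lemma lift_monom: "(a, a') \<in> G \<Longrightarrow> lift (monom a k) (monom a' k)"
  by (auto simp: lift_def graph_zero_in)

lemma lift_0: "lift 0 F' \<Longrightarrow> F' = 0"
  by (auto simp: lift_def poly_eq_iff dest: graph_zero)

lemma lift_exists:
  assumes "\<And>i. coeff F i \<in> Domain G"
  shows "\<exists>F'. lift F F'"
proof -
  define h where "h = (\<lambda>a. THE a'. (a, a') \<in> G)"
  have h: "(a, h a) \<in> G" if "a \<in> Domain G" for a
  proof -
    have "\<exists>!a'. (a, a') \<in> G" using that graph_fun by blast
    then show ?thesis unfolding h_def by (rule theI')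
  qed
  \<comment> \<open>\<open>map_poly\<close> acts on each coefficient only if the function fixes
    0.\<close>
  have [simp]: "h 0 = 0" using h[of 0] graph_zero graph_zero_in by blast
  have "lift F (map_poly h F)" using assms h by (auto simp: lift_def coeff_map_poly)
  then show ?thesis by blast
qed

text \<open>The values that the product rule forces on every extension sending \<open>y\<close> to
  \<open>v\<close>.\<close>

definition adjoin_graph :: "'q \<Rightarrow> 'q \<Rightarrow> ('q \<times> 'q) set" where
  "adjoin_graph y v = {(poly F y, poly F' y + poly (pderiv F) y * v) | F F'. lift F F'}"

lemma adjoin_graphI:
  "lift F F' \<Longrightarrow> a = poly F y \<Longrightarrow> a' = poly F' y + poly (pderiv F) y * v \<Longrightarrow>
    (a, a') \<in> adjoin_graph y v"
  unfolding adjoin_graph_def by blast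

lemma adjoin_graph_extends: "G \<subseteq> adjoin_graph y v"
proof
  fix z assume z: "z \<in> G"
  obtain a a' where "z = (a, a')" by (cases z)
  then show "z \<in> adjoin_graph y v"
    using adjoin_graphI[OF lift_const[of a a']] z by (simp add: pderiv_pCons)
qed

lemma adjoin_graph_self: "(y, v) \<in> adjoin_graph y v"
  by (rule adjoin_graphI[OF lift_monom[OF graph_one, of 1]]) (simp_all add: poly_monom pderiv_monom)

text \<open>The formula respects sums and products for every \<open>v\<close>. The one obstruction
  is that a polynomial vanishing at \<open>y\<close> may receive a nonzero derivative.\<close>

lemma adjoin_derivation_graph:
  assumes "\<And>F F'. lift F F' \<Longrightarrow> poly F y = 0 \<Longrightarrow> poly F' y + poly (pderiv F) y * v = 0"
  shows "derivation_graph (adjoin_graph y v)"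
proof
  show "(1, 0) \<in> adjoin_graph y v" using adjoin_graph_extends graph_one by auto
  show "a' = 0" if "(0, a') \<in> adjoin_graph y v" for a'
    using that assms unfolding adjoin_graph_def by fastforce
  fix a a' assume "(a, a') \<in> adjoin_graph y v"
  then obtain F F' where F: "lift F F'" "a = poly F y" "a' = poly F' y + poly (pderiv F) y * v"
    unfolding adjoin_graph_def by auto
  show "(- a, - a') \<in> adjoin_graph y v"
    by (rule adjoin_graphI[OF lift_uminus[OF F(1)]]) (simp_all add: F pderiv_minus)
  fix b b' assume "(b, b') \<in> adjoin_graph y v"
  then obtain H H' where H: "lift H H'" "b = poly H y" "b' = poly H' y + poly (pderiv H) y * v"
    unfolding adjoin_graph_def by auto
  show "(a + b, a' + b') \<in> adjoin_graph y v"
    by (rule adjoin_graphI[OF lift_add[OF F(1) H(1)]]) (simp_all add: F H pderiv_add algebra_simps)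
  show "(a * b, a' * b + a * b') \<in> adjoin_graph y v"
    by (rule adjoin_graphI[OF lift_mult[OF F(1) H(1)]]) (simp_all add: F H pderiv_mult algebra_simps)
qed

end

lemma nonzero_root_degree:
  fixes F :: "'q::field poly"
  assumes "poly F y = 0" "F \<noteq> 0"
  shows "0 < degree F"
proof (rule ccontr)
  assume "\<not> 0 < degree F"
  then obtain c where "F = [:c:]" using degree_eq_zeroE by blast
  then show False using assms by simp
qed

lemma pderiv_char_0:
  fixes F :: "'q::field poly"
  assumes "\<And>k. 0 < k \<Longrightarrow> of_nat k \<noteq> (0::'q)" "0 < degree F"
  shows "pderiv F \<noteq> 0" "degree (pderiv F) < degree F"
proof -
  have "coeff (pderiv F) (degree F - 1) \<noteq> 0"
    using assms(1)[of "degree F"] assms(2) by (auto simp: coeff_pderiv simp del: of_nat_Suc)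
  then show "pderiv F \<noteq> 0" by auto
  have "coeff (pderiv F) i = 0" if "i \<ge> degree F" for i
    using that by (simp add: coeff_pderiv coeff_eq_0)
  then show "degree (pderiv F) < degree F"
    by (metis \<open>pderiv F \<noteq> 0\<close> leading_coeff_0_iff linorder_not_le)
qed

text \<open>For \<open>y\<close> transcendental over the domain any value \<open>v\<close> works.
  Otherwise a polynomial \<open>g\<close> of minimal degree with root \<open>y\<close> forces
  \<open>v\<close>, and every other polynomial with root \<open>y\<close> is compatible with it by
  division with remainder by \<open>g\<close>.\<close>

lemma (in derivation_graph) extend_one:
  assumes char0: "\<And>k. 0 < k \<Longrightarrow> of_nat k \<noteq> (0::'q)"
  shows "\<exists>H. derivation_graph H \<and> G \<subseteq> H \<and> y \<in> Domain H"
proof -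
  have "\<exists>v. \<forall>F F'. lift F F' \<longrightarrow> poly F y = 0 \<longrightarrow> poly F' y + poly (pderiv F) y * v = 0"
  proof (cases "\<exists>g g'. lift g g' \<and> poly g y = 0 \<and> g \<noteq> 0")
    case False
    then show ?thesis using lift_0 by (metis add_0 mult_zero_left pderiv_0 poly_0)
  next
    case True
    let ?Q = "\<lambda>g. (\<exists>g'. lift g g') \<and> poly g y = 0 \<and> g \<noteq> 0"
    obtain g where "?Q g" and least: "\<And>h. ?Q h \<Longrightarrow> degree g \<le> degree h"
      using True ex_has_least_nat[of ?Q _ degree] by blast
    then obtain g' where g: "lift g g'" "poly g y = 0" "g \<noteq> 0" by blast
    have min: "h = 0" if "lift h h'" "poly h y = 0" "degree h < degree g" for h h'
      using least[of h] that by (meson linorder_not_le)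
    have dg: "0 < degree g" using g by (metis nonzero_root_degree)
    have "\<exists>h'. lift (pderiv g) h'"
    proof (rule lift_exists)
      have "(of_nat (Suc i) * coeff g (Suc i), of_nat (Suc i) * coeff g' (Suc i)) \<in> G" for i
        using graph_sum[of "{..i}" "\<lambda>_. coeff g (Suc i)" "\<lambda>_. coeff g' (Suc i)"] g
        by (simp add: lift_def del: of_nat_Suc)
      then show "coeff (pderiv g) i \<in> Domain G" for i by (auto simp: coeff_pderiv Domain.simps)
    qed
    \<comment> \<open>The derivative is nonzero, has smaller degree than \<open>g\<close>, and its
      coefficients lie in the domain; by minimality \<open>y\<close> is not a root of it.\<close>
    then have g'y: "poly (pderiv g) y \<noteq> 0" using pderiv_char_0[OF char0 dg] min by blast
    \<comment> \<open>The solution of \<open>E g g' = 0\<close>.\<close>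
    define v where "v = - poly g' y / poly (pderiv g) y"
    define E where "E = (\<lambda>F F'. poly F' y + poly (pderiv F) y * v)"
    have Eg: "E g g' = 0" using g'y by (simp add: E_def v_def)
    have E_mult: "E (F * H) (F' * H + F * H') = E F F' * poly H y + poly F y * E H H'" for F F' H H'
      by (simp add: E_def pderiv_mult algebra_simps)
    have E_diff: "E (F - H) (F' - H') = E F F' - E H H'" for F F' H H'
      by (simp add: E_def pderiv_diff algebra_simps)
    have "E F F' = 0" if "lift F F'" "poly F y = 0" for F F'
      using that
    proof (induction "degree F" arbitrary: F F' rule: less_induct)
      case less
      show ?case
      proof (cases "F = 0 \<or> degree F = 0")
        case True
        then have "F = 0" using less.prems by (metis nonzero_root_degree less_irrefl)
        moreover have "F' = 0" using calculation less.prems lift_0 by blast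
        ultimately show ?thesis by (simp add: E_def)
      next
        case False
        have deg: "degree g \<le> degree F" using min[OF less.prems] False by force
        define a a' where "a = lead_coeff g" and "a' = coeff g' (degree g)"
        define b b' k where "b = lead_coeff F" and "b' = coeff F' (degree F)"
          and "k = degree F - degree g"
        have ab: "(a, a') \<in> G" "(b, b') \<in> G"
          using g less.prems by (auto simp: lift_def a_def a'_def b_def b'_def)
        \<comment> \<open>Pseudo-division: the domain is only a ring, so \<open>F\<close> is
          multiplied by the leading coefficient of \<open>g\<close> before its leading term is
          cancelled.\<close>
        define H where "H = [:a:] * F - monom b k * g"
        define H' where "H' = ([:a':] * F + [:a:] * F') - (monom b' k * g + monom b k * g')"
        have H: "lift H H'" unfolding H_def H'_def diff_conv_add_uminus
          using ab g less.prems by (intro lift_add lift_uminus lift_mult lift_const lift_monom)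
        have Hy: "poly H y = 0" using g less.prems by (simp add: H_def)
        have "coeff H i = 0" if "i \<ge> degree F" for i
        proof (cases "i = degree F")
          case True
          then show ?thesis using deg by (simp add: H_def coeff_monom_mult k_def a_def b_def)
        next
          case False
          then have "i > degree F" "i - k > degree g" using that deg by (auto simp: k_def)
          then show ?thesis using deg by (simp add: H_def coeff_monom_mult coeff_eq_0)
        qed
        then have "degree H < degree F" using False
          by (metis degree_0 gr0I leading_coeff_0_iff linorder_not_le)
        then have "E H H' = 0" using less.hyps H Hy by blast
        \<comment> \<open>Nothing else is left of \<open>E H H'\<close>, because \<open>F\<close>
          and \<open>g\<close> vanish at \<open>y\<close> and \<open>E g g' = 0\<close>.\<close>
        then have "a * E F F' = 0"
          unfolding H_def H'_def E_diff E_mult using less.prems g Eg by simp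
        then show ?thesis using g by (simp add: a_def)
      qed
    qed
    then show ?thesis unfolding E_def by blast
  qed
  then show ?thesis
    using adjoin_derivation_graph adjoin_graph_extends adjoin_graph_self by (metis Domain.DomainI)
qed

text \<open>Zorn's lemma for the graphs containing \<open>G\<close>: by \<open>extend_one\<close> a
  maximal one is defined on the whole field.\<close>

lemma derivation_extension:
  fixes G :: "('q::field \<times> 'q) set"
  assumes "derivation_graph G" and char0: "\<And>k. 0 < k \<Longrightarrow> of_nat k \<noteq> (0::'q)"
  shows "\<exists>D. (\<forall>a b. D (a + b) = D a + D b) \<and> (\<forall>a b. D (a * b) = D a * b + a * D b) \<and>
    (\<forall>(a, a') \<in> G. D a = a')"
proof -
  let ?S = "{H. derivation_graph H \<and> G \<subseteq> H}"
  have "\<exists>M\<in>?S. \<forall>X\<in>?S. M \<subseteq> X \<longrightarrow> X = M"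
  proof (rule subset_Zorn_nonempty)
    show "?S \<noteq> {}" using assms by auto
    fix \<C> assume ne: "\<C> \<noteq> {}" and "subset.chain ?S \<C>"
    then have C: "\<And>H. H \<in> \<C> \<Longrightarrow> derivation_graph H \<and> G \<subseteq> H"
      and lin: "\<And>H H'. H \<in> \<C> \<Longrightarrow> H' \<in> \<C> \<Longrightarrow> H \<subseteq> H' \<or> H' \<subseteq> H"
      by (auto simp: subset_chain_def)
    have common: "\<exists>H\<in>\<C>. z \<in> H \<and> w \<in> H" if "z \<in> \<Union>\<C>" "w \<in> \<Union>\<C>" for z w
      using that lin by (meson UnionE subsetD)
    have "derivation_graph (\<Union>\<C>)"
    proof
      show "(1, 0) \<in> \<Union>\<C>" using ne C derivation_graph.graph_one by blast
      show "a' = 0" if "(0, a') \<in> \<Union>\<C>" for a' using that C derivation_graph.graph_zero by blast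
      fix a a' assume a: "(a, a') \<in> \<Union>\<C>"
      show "(- a, - a') \<in> \<Union>\<C>" using a C derivation_graph.graph_uminus by blast
      fix b b' assume b: "(b, b') \<in> \<Union>\<C>"
      obtain H where H: "H \<in> \<C>" "(a, a') \<in> H" "(b, b') \<in> H" using common[OF a b] by auto
      show "(a + b, a' + b') \<in> \<Union>\<C>" "(a * b, a' * b + a * b') \<in> \<Union>\<C>"
        using H C derivation_graph.graph_add derivation_graph.graph_mult by blast+
    qed
    then show "\<Union>\<C> \<in> ?S" using ne C by blast
  qed
  then obtain M where M: "derivation_graph M" "G \<subseteq> M"
    and max: "\<And>X. derivation_graph X \<Longrightarrow> G \<subseteq> X \<Longrightarrow> M \<subseteq> X \<Longrightarrow> X = M" by auto
  interpret M: derivation_graph M by fact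
  have dom: "y \<in> Domain M" for y
    using M.extend_one[OF char0, of y] max M by blast
  define D where "D = (\<lambda>a. THE a'. (a, a') \<in> M)"
  have D: "(a, D a) \<in> M" for a
  proof -
    have "\<exists>!a'. (a, a') \<in> M" using dom[of a] M.graph_fun by blast
    then show ?thesis unfolding D_def by (rule theI')
  qed
  have D': "(a, a') \<in> M \<Longrightarrow> D a = a'" for a a' using D M.graph_fun by blast
  show ?thesis using D' M.graph_add[OF D D] M.graph_mult[OF D D] M by (intro exI[of _ D]) auto
qed

definition field_derivation :: "'q::field set \<Rightarrow> ('q \<Rightarrow> 'q) \<Rightarrow> bool" where
  "field_derivation K D \<longleftrightarrow> (\<forall>a b. D (a + b) = D a + D b) \<and>
     (\<forall>a b. D (a * b) = D a * b + a * D b) \<and> (\<forall>a\<in>K. D a = 0)"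

text \<open>Each step of the tower contributes an extension to the whole field of the derivation
  d/dy, which vanishes on the ring below.\<close>

lemma transc_tower_derivations:
  fixes K :: "'q::field set"
  assumes "transc_tower K N B" "field_subring K" and char0: "\<And>k. 0 < k \<Longrightarrow> of_nat k \<noteq> (0::'q)"
  shows "\<exists>D. (\<forall>i<N. field_derivation K (D i)) \<and>
    (\<forall>c. (\<forall>b\<in>B. (\<Sum>i<N. c i * D i b) = 0) \<longrightarrow> (\<forall>i<N. c i = 0))"
  using assms(1)
proof (induction rule: transc_tower.induct)
  case base
  then show ?case by auto
next
  case (adjoin e B y)
  interpret B: field_subring B
    by (rule field_subring.transc_tower_subring[OF assms(2) adjoin.hyps(1)])
  obtain D where IH: "(\<forall>i<e. field_derivation K (D i)) \<and>
    (\<forall>c. (\<forall>b\<in>B. (\<Sum>i<e. c i * D i b) = 0) \<longrightarrow> (\<forall>i<e. c i = 0))"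
    using adjoin.IH by (elim exE)
  \<comment> \<open>The zero derivation on \<open>B\<close>. Its extension by
    \<open>y \<mapsto> 1\<close> is well defined because \<open>y\<close> is transcendental over
    \<open>B\<close>.\<close>
  interpret Z: derivation_graph "B \<times> {0}"
    by unfold_locales (auto simp: B.one_in B.add_in B.mult_in B.uminus_in)
  have "derivation_graph (Z.adjoin_graph y 1)"
  proof (rule Z.adjoin_derivation_graph)
    fix F F' assume *: "Z.lift F F'" "poly F y = 0"
    then have "F' = 0" "coeffs_in F B" by (auto simp: Z.lift_def poly_eq_iff)
    then show "poly F' y + poly (pderiv F) y * 1 = 0" using adjoin.hyps(2)[of F] * by simp
  qed
  then have "\<exists>D'. (\<forall>a b. D' (a + b) = D' a + D' b) \<and>
      (\<forall>a b. D' (a * b) = D' a * b + a * D' b) \<and> (\<forall>(a, a')\<in>Z.adjoin_graph y 1. D' a = a')"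
    by (rule derivation_extension) (rule char0)
  then obtain D' where D': "(\<forall>a b. D' (a + b) = D' a + D' b) \<and>
      (\<forall>a b. D' (a * b) = D' a * b + a * D' b) \<and> (\<forall>(a, a')\<in>Z.adjoin_graph y 1. D' a = a')"
    by (elim exE)
  have graph: "D' a = a'" if "(a, a') \<in> Z.adjoin_graph y 1" for a a' using D' that by fast
  have D'B: "D' b = 0" if "b \<in> B" for b
    using graph[of b 0] Z.adjoin_graph_extends[of y 1] that by blast
  have D'y: "D' y = 1" using graph Z.adjoin_graph_self[of y 1] by blast
  have "K \<subseteq> B" by (rule field_subring.transc_tower_sub[OF assms(2) adjoin.hyps(1)])
  then have "field_derivation K D'" using D' D'B by (auto simp: field_derivation_def)
  then have "\<forall>i<Suc e. field_derivation K ((D(e := D')) i)"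
    using IH by (simp add: less_Suc_eq)
  moreover have "\<forall>i<Suc e. c i = 0"
    if c: "\<forall>b\<in>adjoin B y. (\<Sum>i<Suc e. c i * (D(e := D')) i b) = 0" for c
  proof -
    have sum: "(\<Sum>i<Suc e. c i * (D(e := D')) i b) = (\<Sum>i<e. c i * D i b) + c e * D' b" for b
      by simp
    \<comment> \<open>The system is triangular: on \<open>B\<close> the new derivation drops out,
      and at \<open>y\<close> it is 1.\<close>
    have "(\<Sum>i<e. c i * D i b) = 0" if "b \<in> B" for b
      using bspec[OF c subsetD[OF B.sub_adjoin that]] sum[of b] D'B[OF that] by simp
    then have 0: "\<forall>i<e. c i = 0" using IH by blast
    moreover have "c e = 0" using bspec[OF c B.self_in_adjoin] sum[of y] 0 D'y by simp
    ultimately show ?thesis by (simp add: less_Suc_eq)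
  qed
  ultimately show ?case by (intro exI[of _ "D(e := D')"] conjI allI impI) blast+
qed

section \<open>Derivations modulo an ideal\<close>

text \<open>A K-derivation from \<open>R\<close> to \<open>R / P\<close>, given by representatives
  of its values in \<open>R\<close>. Linearity over K follows from the product rule and the values
  in \<open>P\<close> on K.\<close>

definition mod_derivation :: "'q::field set \<Rightarrow> 'q set \<Rightarrow> 'q set \<Rightarrow> ('q \<Rightarrow> 'q) \<Rightarrow> bool" where
  "mod_derivation K R P D \<longleftrightarrow> (\<forall>a\<in>R. D a \<in> R) \<and> (\<forall>a\<in>K. D a \<in> P) \<and>
     (\<forall>a\<in>R. \<forall>b\<in>R. D (a + b) - (D a + D b) \<in> P) \<and>
     (\<forall>a\<in>R. \<forall>b\<in>R. D (a * b) - (D a * b + a * D b) \<in> P)"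

context subring_ideal
begin

lemma mod_derivation_linear_combination:
  assumes "\<And>u. u \<in> U \<Longrightarrow> mod_derivation K R P (D u)" "\<And>u. u \<in> U \<Longrightarrow> c u \<in> R"
  shows "mod_derivation K R P (\<lambda>a. \<Sum>u\<in>U. c u * D u a)"
proof -
  have 1: "(\<Sum>u\<in>U. c u * D u (a + b)) - ((\<Sum>u\<in>U. c u * D u a) + (\<Sum>u\<in>U. c u * D u b)) \<in> P"
    if "a \<in> R" "b \<in> R" for a b
  proof -
    have "(\<Sum>u\<in>U. c u * (D u (a + b) - (D u a + D u b))) \<in> P"
      using assms that by (intro ideal_sum ideal_mult) (auto simp: mod_derivation_def)
    then show ?thesis by (simp add: sum.distrib sum_subtractf algebra_simps)
  qed
  have 2: "(\<Sum>u\<in>U. c u * D u (a * b)) - ((\<Sum>u\<in>U. c u * D u a) * b + a * (\<Sum>u\<in>U. c u * D u b)) \<in> P"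
    if "a \<in> R" "b \<in> R" for a b
  proof -
    have "(\<Sum>u\<in>U. c u * (D u (a * b) - (D u a * b + a * D u b))) \<in> P"
      using assms that by (intro ideal_sum ideal_mult) (auto simp: mod_derivation_def)
    then show ?thesis
      by (simp add: sum.distrib sum_subtractf sum_distrib_left sum_distrib_right algebra_simps)
  qed
  have 3: "(\<Sum>u\<in>U. c u * D u a) \<in> R" if "a \<in> R" for a
    using assms that by (intro sum_in mult_in) (auto simp: mod_derivation_def)
  have 4: "(\<Sum>u\<in>U. c u * D u a) \<in> P" if "a \<in> K" for a
    using assms that by (intro ideal_sum ideal_mult) (auto simp: mod_derivation_def)
  show ?thesis using 1 2 3 4 by (simp add: mod_derivation_def)
qed

lemma mod_derivation_sum:
  assumes D: "mod_derivation K R P D" and "0 \<in> K" "\<And>u. u \<in> U \<Longrightarrow> g u \<in> R"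
  shows "D (\<Sum>u\<in>U. g u) - (\<Sum>u\<in>U. D (g u)) \<in> P"
  using assms(3)
proof (induction U rule: infinite_finite_induct)
  case (insert w U)
  have 1: "D (g w + (\<Sum>u\<in>U. g u)) - (D (g w) + D (\<Sum>u\<in>U. g u)) \<in> P"
    using D insert.prems sum_in[of U g] by (simp add: mod_derivation_def)
  have 2: "D (\<Sum>u\<in>U. g u) - (\<Sum>u\<in>U. D (g u)) \<in> P" using insert by simp
  show ?case using ideal_add[OF 1 2] insert.hyps by (simp add: algebra_simps)
\<comment> \<open>In the empty and the infinite case the sum is 0, and \<open>D 0 \<in> P\<close>
  because \<open>0 \<in> K\<close>.\<close>
qed (use D assms(2) in \<open>auto simp: mod_derivation_def\<close>)

lemma mod_derivation_poly:
  assumes D: "mod_derivation K R P D" and "0 \<in> K" "B \<subseteq> R" "\<And>b. b \<in> B \<Longrightarrow> D b \<in> P"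
    and "coeffs_in F B" "y \<in> R"
  shows "D (poly F y) - poly (pderiv F) y * D y \<in> P"
  using assms(5)
proof (induction F)
  case 0
  then show ?case using D assms(2) by (simp add: mod_derivation_def)
next
  case (pCons a F)
  let ?h = "poly F y"
  have aB: "a \<in> B" using pCons.prems by (metis coeff_pCons_0)
  have FB: "coeffs_in F B" using pCons.prems by (metis coeff_pCons_Suc)
  have h: "?h \<in> R" using FB assms by (intro poly_in) auto
  have R: "a \<in> R" "y * ?h \<in> R" using aB assms h mult_in by auto
  have 1: "D (a + y * ?h) - (D a + D (y * ?h)) \<in> P" using D R by (auto simp: mod_derivation_def)
  have 2: "D (y * ?h) - (D y * ?h + y * D ?h) \<in> P" using D h assms by (auto simp: mod_derivation_def)
  have 3: "y * (D ?h - poly (pderiv F) y * D y) \<in> P" using pCons.IH FB assms ideal_mult by blast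
  have 4: "D a \<in> P" using aB assms by blast
  have "D (poly (pCons a F) y) - poly (pderiv (pCons a F)) y * D y =
    (D (a + y * ?h) - (D a + D (y * ?h))) + (D (y * ?h) - (D y * ?h + y * D ?h)) +
    y * (D ?h - poly (pderiv F) y * D y) + D a"
    by (simp add: pderiv_pCons algebra_simps)
  also have "\<dots> \<in> P" using 1 2 3 4 by (intro ideal_add)
  finally show ?case .
qed

text \<open>The elements \<open>t\<close> are the adjoined ones, which \<open>transc_tower\<close>
  does not record; the chain rule for polynomials carries the vanishing of \<open>D\<close> from one
  ring of the tower to the next.\<close>

lemma transc_tower_generators:
  assumes "transc_tower K e B" "field_subring K" "B \<subseteq> R"
  shows "\<exists>t. (\<forall>i<e. t i \<in> R) \<and>
    (\<forall>D. mod_derivation K R P D \<longrightarrow> (\<forall>i<e. D (t i) \<in> P) \<longrightarrow> (\<forall>b\<in>B. D b \<in> P))"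
  using assms(1,3)
proof (induction rule: transc_tower.induct)
  case base
  then show ?case by (auto simp: mod_derivation_def)
next
  case (adjoin e B y)
  interpret B: field_subring B
    by (rule field_subring.transc_tower_subring[OF assms(2) adjoin.hyps(1)])
  have BR: "B \<subseteq> R" and y: "y \<in> R" using adjoin.prems B.sub_adjoin B.self_in_adjoin by blast+
  obtain t where t: "(\<forall>i<e. t i \<in> R) \<and>
    (\<forall>D. mod_derivation K R P D \<longrightarrow> (\<forall>i<e. D (t i) \<in> P) \<longrightarrow> (\<forall>b\<in>B. D b \<in> P))"
    using adjoin.IH[OF BR] by (elim exE)
  have "D b \<in> P" if D: "mod_derivation K R P D" and Dt: "\<forall>i<Suc e. D ((t(e := y)) i) \<in> P"
    and b: "b \<in> adjoin B y" for D b
  proof -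
    have "\<forall>i<e. D (t i) \<in> P" using Dt by (metis fun_upd_apply less_Suc_eq less_irrefl)
    then have DB: "D b \<in> P" if "b \<in> B" for b using t D that by blast
    have Dy: "D y \<in> P" using Dt by (metis fun_upd_apply lessI)
    obtain F where F: "coeffs_in F B" "b = poly F y" using b by (auto simp: adjoin_def)
    have "D b - poly (pderiv F) y * D y \<in> P"
      unfolding F(2) using mod_derivation_poly[OF D _ BR DB F(1) y]
        field_subring.zero_in[OF assms(2)] by blast
    moreover have "poly (pderiv F) y \<in> R" using F B.coeffs_in_pderiv BR y by (intro poly_in) auto
    then have "poly (pderiv F) y * D y \<in> P" using Dy ideal_mult by blast
    ultimately show ?thesis using ideal_cong by blast
  qed
  moreover have "\<forall>i<Suc e. (t(e := y)) i \<in> R" using t y by (simp add: less_Suc_eq)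
  ultimately show ?case by (intro exI[of _ "t(e := y)"] conjI) blast+
qed

end

text \<open>An element \<open>y\<close> is a root modulo \<open>P\<close> of a nonzero polynomial over \<open>B\<close>; for one of
  minimal degree the derivative does not vanish at \<open>y\<close> modulo \<open>P\<close>, because the
  characteristic is zero.\<close>

lemma (in local_subring) mod_derivation_algebraic:
  assumes D: "mod_derivation K R P D"
    and char0: "\<And>k. 0 < k \<Longrightarrow> of_nat k \<noteq> (0::'a)"
    and K: "field_subring K" and B: "transc_tower K e B" "B \<subseteq> R" "B \<inter> P \<subseteq> {0}"
    and max: "\<And>B'. transc_tower K (Suc e) B' \<Longrightarrow> B' \<subseteq> R \<Longrightarrow> \<not> B' \<inter> P \<subseteq> {0}"
    and DB: "\<And>b. b \<in> B \<Longrightarrow> D b \<in> P" and DP: "\<And>a. a \<in> P \<Longrightarrow> D a \<in> P"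
    and y: "y \<in> R"
  shows "D y \<in> P"
proof -
  interpret B: field_subring B by (rule field_subring.transc_tower_subring[OF K B(1)])
  let ?Q = "\<lambda>F. coeffs_in F B \<and> poly F y \<in> P \<and> F \<noteq> 0"
  have "\<exists>F. ?Q F"
  proof (rule ccontr)
    \<comment> \<open>Then \<open>y\<close> could be adjoined to the tower, which would still meet
      \<open>P\<close> only in 0.\<close>
    assume "\<nexists>F. ?Q F"
    then have *: "F = 0" if "coeffs_in F B" "poly F y \<in> P" for F using that by blast
    have "F = 0" if "coeffs_in F B" "poly F y = 0" for F using *[of F] that ideal_zero by simp
    then have "transc_tower K (Suc e) (adjoin B y)" by (rule transc_tower.adjoin[OF B(1)]) auto
    moreover have "adjoin B y \<inter> P \<subseteq> {0}" unfolding adjoin_def by (auto dest!: *)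
    ultimately show False using max adjoin_sub B y by blast
  qed
  then obtain F where F: "?Q F" and least: "\<And>H. ?Q H \<Longrightarrow> degree F \<le> degree H"
    using ex_has_least_nat[of ?Q _ degree] by blast
  \<comment> \<open>A constant \<open>F\<close> would be a nonzero element of
    \<open>B \<inter> P\<close>.\<close>
  have "0 < degree F"
  proof (rule ccontr)
    assume "\<not> 0 < degree F"
    then obtain c where c: "F = [:c:]" using degree_eq_zeroE by blast
    then have "c \<in> B" "c \<in> P" using F by (auto dest: spec[of _ 0])
    then show False using F c B by auto
  qed
  then have "pderiv F \<noteq> 0" "degree (pderiv F) < degree F"
    using pderiv_char_0[OF char0] by blast+
  then have nP: "poly (pderiv F) y \<notin> P"
    using least[of "pderiv F"] B.coeffs_in_pderiv F by (meson linorder_not_le)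
  have "D (poly F y) - poly (pderiv F) y * D y \<in> P"
    using mod_derivation_poly[OF D field_subring.zero_in[OF K] B(2) DB _ y] F by blast
  then have "D (poly F y) - (D (poly F y) - poly (pderiv F) y * D y) \<in> P"
    using DP F ideal_diff by blast
  then have "poly (pderiv F) y * D y \<in> P" by simp
  moreover have "poly (pderiv F) y \<in> R" using F B.coeffs_in_pderiv B y by (intro poly_in) auto
  ultimately show ?thesis using unit_cancel nP by blast
qed

text \<open>A derivation modulo \<open>P\<close> is determined by its values on a tower of transcendental
  elements that stays maximal in the residue field and on generators of \<open>P\<close>. The chain of
  primes prolongs the tower by one step for each generator.\<close>

lemma (in local_subring) derivation_count:
  fixes p :: "nat \<Rightarrow> 'a set"
  assumes char0: "\<And>k. 0 < k \<Longrightarrow> of_nat k \<noteq> (0::'a)"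
    and K: "field_subring K" "K \<subseteq> R" "K \<inter> P \<subseteq> {0}"
    and bound: "\<And>e B. transc_tower K e B \<Longrightarrow> e \<le> N"
    and X: "finite X" "X \<subseteq> P"
    and gen: "\<And>a. a \<in> P \<Longrightarrow> \<exists>c. (\<forall>x\<in>X. c x \<in> R) \<and> a = (\<Sum>x\<in>X. c x * x)"
    and chain: "\<And>i. i \<le> card X \<Longrightarrow> subring_prime R (p i)" "\<And>i. i < card X \<Longrightarrow> p i \<subset> p (Suc i)"
      "p (card X) \<subseteq> P"
    and U: "finite U" and D: "\<And>u. u \<in> U \<Longrightarrow> mod_derivation K R P (D u)"
    and indep: "\<And>c. (\<And>u. u \<in> U \<Longrightarrow> c u \<in> R) \<Longrightarrow> (\<And>a. a \<in> R \<Longrightarrow> (\<Sum>u\<in>U. c u * D u a) \<in> P) \<Longrightarrow>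
      (\<And>u. u \<in> U \<Longrightarrow> c u \<in> P)"
  shows "card U \<le> N"
proof -
  \<comment> \<open>The greatest such length is the transcendence degree of the residue field; it
    exists because \<open>bound\<close> limits all towers.\<close>
  let ?T = "\<lambda>e. \<exists>B. transc_tower K e B \<and> B \<subseteq> R \<and> B \<inter> P \<subseteq> {0}"
  have "?T 0" using K transc_tower.base by blast
  moreover have "\<forall>e. ?T e \<longrightarrow> e \<le> N" using bound by blast
  ultimately obtain e where "?T e" and emax: "\<And>e'. ?T e' \<Longrightarrow> e' \<le> e"
    using GreatestI_ex_nat[of ?T N] Greatest_le_nat[of ?T _ N] by blast
  then obtain B where B: "transc_tower K e B" "B \<subseteq> R" "B \<inter> P \<subseteq> {0}" by blast
  have max: "\<not> B' \<inter> P \<subseteq> {0}" if "transc_tower K (Suc e) B'" "B' \<subseteq> R" for B'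
    using emax[of "Suc e"] that by auto
  have "\<exists>B'. transc_tower K (e + card X) B'"
    using B chain by (intro transc_tower_prime_chain[of "card X" R p]) auto
  then have eN: "e + card X \<le> N" using bound by blast
  obtain t where t: "(\<forall>i<e. t i \<in> R) \<and>
    (\<forall>D. mod_derivation K R P D \<longrightarrow> (\<forall>i<e. D (t i) \<in> P) \<longrightarrow> (\<forall>b\<in>B. D b \<in> P))"
    using transc_tower_generators[OF B(1) K(1) B(2)] by (elim exE)
  obtain xs where xs: "set xs = X" "length xs = card X"
    using X by (metis distinct_card finite_distinct_list)
  \<comment> \<open>Column \<open>u\<close> lists the values of \<open>D u\<close> at the
    \<open>e + card X\<close> test elements: the tower elements, followed by the generators of
    \<open>P\<close> with index shifted by \<open>e\<close>.\<close>
  define a where "a = (\<lambda>i u. D u (if i < e then t i else xs ! (i - e)))"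
  have a: "a i u \<in> R" if "i < e + card X" "u \<in> U" for i u
  proof -
    have "(if i < e then t i else xs ! (i - e)) \<in> R"
    proof (cases "i < e")
      case False
      then have "i - e < length xs" using that xs by linarith
      then show ?thesis using nth_mem[of "i - e" xs] xs X ideal_sub False by auto
    qed (use t in auto)
    then show ?thesis using D[OF that(2)] by (simp add: a_def mod_derivation_def)
  qed
  show ?thesis
  proof (rule ccontr)
    assume "\<not> card U \<le> N"
    then have "e + card X < card U" using eN by simp
    then obtain c where c: "\<forall>u\<in>U. c u \<in> R" "\<exists>u\<in>U. c u \<notin> P"
        "\<forall>i<e + card X. (\<Sum>u\<in>U. a i u * c u) \<in> P"
      using homogeneous_solution[of U "e + card X" a] U a by blast
    \<comment> \<open>A combination that is nontrivial modulo \<open>P\<close> but sends every test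
      element into \<open>P\<close>.\<close>
    define E where "E = (\<lambda>y. \<Sum>u\<in>U. c u * D u y)"
    have E: "mod_derivation K R P E"
      unfolding E_def using D c by (intro mod_derivation_linear_combination) auto
    have Et: "E (t i) \<in> P" if "i < e" for i
      using c(3) that by (auto simp: E_def a_def mult.commute dest!: spec[of _ i])
    have EX: "E x \<in> P" if "x \<in> X" for x
    proof -
      have "x \<in> set xs" using that xs(1) by simp
      then obtain j where j: "j < length xs" "xs ! j = x" unfolding in_set_conv_nth by blast
      have "e + j < e + card X" using j xs(2) by simp
      then have "(\<Sum>u\<in>U. a (e + j) u * c u) \<in> P" using c(3) by blast
      then show ?thesis using j by (simp add: E_def a_def mult.commute)
    qed
    have EB: "E b \<in> P" if "b \<in> B" for b using t E Et that by blast
    have EP: "E y \<in> P" if yP: "y \<in> P" for y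
    proof -
      obtain b where b: "\<forall>x\<in>X. b x \<in> R" "y = (\<Sum>x\<in>X. b x * x)" using gen[OF yP] by (elim exE conjE)
      have XR: "x \<in> R" if "x \<in> X" for x using that X ideal_sub by blast
      have "E y - (\<Sum>x\<in>X. E (b x * x)) \<in> P"
        unfolding b(2) using b XR field_subring.zero_in[OF K(1)]
        by (intro mod_derivation_sum[OF E]) (auto intro: mult_in)
      moreover have "E (b x * x) \<in> P" if "x \<in> X" for x
      proof -
        have "E (b x * x) - (E (b x) * x + b x * E x) \<in> P"
          using E b XR that by (simp add: mod_derivation_def)
        moreover have "E (b x) * x \<in> P" using E b that X by (auto simp: mod_derivation_def intro!: ideal_mult)
        moreover have "b x * E x \<in> P" using b that EX by (auto intro!: ideal_mult)
        ultimately show ?thesis using ideal_add ideal_cong by blast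
      qed
      then have "(\<Sum>x\<in>X. E (b x * x)) \<in> P" by (rule ideal_sum)
      ultimately show ?thesis using ideal_cong by blast
    qed
    have "E y \<in> P" if "y \<in> R" for y
      by (rule mod_derivation_algebraic[OF E char0 K(1) B max EB EP that])
    then show False using indep[of c] c unfolding E_def by blast
  qed
qed

section \<open>Minors, kernels and rank\<close>

lemma omit_nth: "b < length js - 1 \<Longrightarrow> k < length js \<Longrightarrow> omit k js ! b = (if b < k then js ! b else js ! Suc b)"
  by (auto simp: omit_def nth_append min_def)

lemma length_omit: "k < length js \<Longrightarrow> length (omit k js) = length js - 1"
  by (auto simp: omit_def)

lemma set_omit: "set (omit k js) \<subseteq> set js"
  unfolding omit_def by (auto dest: in_set_takeD in_set_dropD)

lemma omit_append_last: "omit (length js) (js @ [l]) = js"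
  by (simp add: omit_def)

lemma tuplesD: "js \<in> tuples N k \<Longrightarrow> length js = k" "js \<in> tuples N k \<Longrightarrow> a < k \<Longrightarrow> js ! a < N"
  by (auto simp: tuples_def dest!: nth_mem)

lemma omit_tuples: "js \<in> tuples N (Suc k) \<Longrightarrow> a < Suc k \<Longrightarrow> omit a js \<in> tuples N k"
  using set_omit[of a js] by (auto simp: tuples_def length_omit)

lemma snoc_tuples: "js \<in> tuples N k \<Longrightarrow> l < N \<Longrightarrow> js @ [l] \<in> tuples N (Suc k)"
  by (auto simp: tuples_def)

text \<open>The vector of values at the variables that \<open>is_jac_der\<close> prescribes. The sum
  covers tuples \<open>js\<close> with repeated entries.\<close>

definition jac_vec :: "'q::field mat \<Rightarrow> nat list \<Rightarrow> nat list \<Rightarrow> nat \<Rightarrow> 'q" where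
  "jac_vec J is js l = (\<Sum>k \<in> {k. k < length js \<and> js ! k = l}. jac_coeff J is js k)"

text \<open>The signs in \<open>jac_coeff\<close> are the cofactor signs of the last row: the
  exponents \<open>length js + Suc k\<close> and \<open>length is + k\<close> differ by 2.\<close>

lemma minor_last_row:
  assumes "length js = Suc (length is)"
  shows "minor J (is @ [i]) js = (\<Sum>k<length js. J $$ (i, js ! k) * jac_coeff J is js k)"
proof -
  let ?r = "length is"
  let ?A = "mat (Suc ?r) (Suc ?r) (\<lambda>(a, b). J $$ ((is @ [i]) ! a, js ! b))"
  have "det ?A = (\<Sum>k<Suc ?r. ?A $$ (?r, k) * cofactor ?A ?r k)"
    by (rule laplace_expansion_row) auto
  also have "\<dots> = (\<Sum>k<length js. J $$ (i, js ! k) * jac_coeff J is js k)"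
  proof (rule sum.cong)
    fix k assume k: "k \<in> {..<length js}"
    have "mat_delete ?A ?r k = mat ?r ?r (\<lambda>(a, b). J $$ (is ! a, omit k js ! b))"
      using k assms by (intro eq_matI) (auto simp: mat_delete_def omit_nth nth_append)
    then show "?A $$ (?r, k) * cofactor ?A ?r k = J $$ (i, js ! k) * jac_coeff J is js k"
      using k assms by (simp add: cofactor_def jac_coeff_def minor_def length_omit)
  qed (simp add: assms)
  finally show ?thesis using assms by (simp add: minor_def)
qed

text \<open>What matters is that \<alpha> does not depend on \<open>l\<close>: cofactors along the
  last column omit the only column in which \<open>l\<close> occurs.\<close>

lemma minor_last_column:
  assumes "length is = length js"
  shows "\<exists>\<alpha>. \<forall>l. minor J (is @ [i]) (js @ [l]) =
    (\<Sum>a<length is. J $$ (is ! a, l) * \<alpha> a) + J $$ (i, l) * minor J is js"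
proof -
  let ?r = "length is"
  let ?A = "\<lambda>l. mat (Suc ?r) (Suc ?r) (\<lambda>(a, b). J $$ ((is @ [i]) ! a, (js @ [l]) ! b))"
  have del: "mat_delete (?A l) a ?r = mat_delete (?A 0) a ?r" if "a < Suc ?r" for a l
    using that assms by (intro eq_matI) (auto simp: mat_delete_def nth_append)
  have last: "mat_delete (?A l) ?r ?r = mat ?r ?r (\<lambda>(a, b). J $$ (is ! a, js ! b))" for l
    using assms by (intro eq_matI) (auto simp: mat_delete_def nth_append)
  have "minor J (is @ [i]) (js @ [l]) =
      (\<Sum>a<?r. J $$ (is ! a, l) * cofactor (?A 0) a ?r) + J $$ (i, l) * minor J is js" for l
  proof -
    have "det (?A l) = (\<Sum>a<Suc ?r. ?A l $$ (a, ?r) * cofactor (?A l) a ?r)"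
      by (rule laplace_expansion_column) auto
    also have "\<dots> = (\<Sum>a<?r. ?A l $$ (a, ?r) * cofactor (?A l) a ?r) +
        ?A l $$ (?r, ?r) * cofactor (?A l) ?r ?r" by simp
    also have "(\<Sum>a<?r. ?A l $$ (a, ?r) * cofactor (?A l) a ?r) =
        (\<Sum>a<?r. J $$ (is ! a, l) * cofactor (?A 0) a ?r)"
    proof (rule sum.cong)
      fix a assume a: "a \<in> {..<?r}"
      then have "cofactor (?A l) a ?r = cofactor (?A 0) a ?r"
        unfolding cofactor_def using del[of a l] by simp
      then show "?A l $$ (a, ?r) * cofactor (?A l) a ?r = J $$ (is ! a, l) * cofactor (?A 0) a ?r"
        using a assms by (simp add: nth_append)
    qed simp
    also have "?A l $$ (?r, ?r) * cofactor (?A l) ?r ?r = J $$ (i, l) * minor J is js"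
      unfolding cofactor_def last using assms by (simp add: nth_append minor_def)
    finally show ?thesis using assms by (simp add: minor_def)
  qed
  then show ?thesis by (intro exI[of _ "\<lambda>a. cofactor (?A 0) a ?r"] allI)
qed

lemma minor_kernel_trivial:
  assumes "length is = length js" "minor J is js \<noteq> 0"
    and "\<And>a. a < length is \<Longrightarrow> (\<Sum>b<length js. J $$ (is ! a, js ! b) * w b) = 0"
    and "b < length js"
  shows "w b = 0"
proof -
  let ?r = "length js"
  let ?A = "mat ?r ?r (\<lambda>(a, b). J $$ (is ! a, js ! b))"
  have "?A *\<^sub>v vec ?r w = 0\<^sub>v ?r"
    using assms by (intro eq_vecI) (auto simp: scalar_prod_def lessThan_atLeast0)
  moreover have "det ?A \<noteq> 0" using assms by (simp add: minor_def)
  ultimately have "vec ?r w = 0\<^sub>v ?r"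
    using det_0_iff_vec_prod_zero_field[of ?A ?r] by (metis mat_carrier vec_carrier)
  then show ?thesis using assms(4) by (metis index_vec index_zero_vec(1))
qed

lemma minor_distinct_columns:
  assumes "length is = length js" "minor J is js \<noteq> 0"
  shows "distinct js"
proof (rule ccontr)
  assume "\<not> distinct js"
  then obtain a b where ab: "a < length js" "b < length js" "a \<noteq> b" "js ! a = js ! b"
    by (auto simp: distinct_conv_nth)
  \<comment> \<open>Two equal columns give this kernel vector.\<close>
  let ?w = "\<lambda>c. if c = a then 1 else if c = b then -1 else 0"
  have "(\<Sum>c<length js. J $$ (is ! k, js ! c) * ?w c) = 0" for k
  proof -
    have "(\<Sum>c<length js. J $$ (is ! k, js ! c) * ?w c) = (\<Sum>c\<in>{a, b}. J $$ (is ! k, js ! c) * ?w c)"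
      using ab by (intro sum.mono_neutral_right) auto
    then show ?thesis using ab by simp
  qed
  then show False using minor_kernel_trivial[OF assms, of ?w a] ab by simp
qed

lemma sum_distinct_list:
  fixes js :: "nat list"
  assumes "distinct js" "set js \<subseteq> {..<n}" "\<And>l. l < n \<Longrightarrow> l \<notin> set js \<Longrightarrow> g l = 0"
  shows "(\<Sum>l<n. g l) = (\<Sum>b<length js. g (js ! b))"
proof -
  have "(\<Sum>l<n. g l) = (\<Sum>l\<in>set js. g l)"
    using assms by (intro sum.mono_neutral_right) auto
  also have "\<dots> = (\<Sum>b<length js. g (js ! b))"
    using assms(1) by (intro sum.reindex_bij_betw[symmetric] bij_betw_nth) auto
  finally show ?thesis .
qed

lemma minor_zero_vector:
  assumes "is \<in> tuples m k" "js \<in> tuples n k" "minor J is js \<noteq> 0"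
    and "\<And>a. a < k \<Longrightarrow> (\<Sum>l<n. J $$ (is ! a, l) * v l) = 0"
    and "\<And>l. l < n \<Longrightarrow> l \<notin> set js \<Longrightarrow> v l = 0" and "l < n"
  shows "v l = 0"
proof (cases "l \<in> set js")
  case True
  have len: "length is = length js" "length js = k" using assms by (auto simp: tuples_def)
  have dist: "distinct js" using minor_distinct_columns[OF len(1) assms(3)] .
  have "(\<Sum>b<length js. J $$ (is ! a, js ! b) * v (js ! b)) = 0" if "a < length is" for a
    using sum_distinct_list[OF dist, of n "\<lambda>l. J $$ (is ! a, l) * v l"] assms that len
    by (auto simp: tuples_def)
  then have "v (js ! b) = 0" if "b < length js" for b
    using minor_kernel_trivial[OF len(1) assms(3), of "\<lambda>b. v (js ! b)" b] that by blast
  then show ?thesis using True by (auto simp: in_set_conv_nth)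
qed (use assms in auto)

lemma jac_vec_notin: "l \<notin> set js \<Longrightarrow> jac_vec J is js l = 0"
  unfolding jac_vec_def by (rule sum.neutral) auto

lemma jac_vec_nth: "distinct js \<Longrightarrow> k < length js \<Longrightarrow> jac_vec J is js (js ! k) = jac_coeff J is js k"
proof -
  assume "distinct js" "k < length js"
  then have "{a. a < length js \<and> js ! a = js ! k} = {k}" by (auto simp: nth_eq_iff_index_eq)
  then show ?thesis by (simp add: jac_vec_def)
qed

lemma jac_coeff_last:
  "length is = length js \<Longrightarrow> jac_coeff J is (js @ [l]) (length js) = minor J is js"
  by (simp add: jac_coeff_def omit_append_last power_add power2_eq_square[symmetric] flip: mult_2)

text \<open>At the indices outside \<open>js\<close> the vectors for \<open>js @ [l]\<close> form a
  diagonal matrix with the minor on the diagonal. Both the independence modulo \<open>P\<close> and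
  the expansion of a derivation rest on this.\<close>

lemma jac_vec_snoc:
  assumes "length is = length js" "l \<notin> set js" "l' \<notin> set js"
  shows "jac_vec J is (js @ [l]) l' = (if l' = l then minor J is js else 0)"
proof -
  have "{a. a < length (js @ [l]) \<and> (js @ [l]) ! a = l} = {length js}"
    using assms by (auto simp: nth_append in_set_conv_nth split: if_splits)
  then show ?thesis
    using jac_vec_notin[of l' "js @ [l]"] assms by (auto simp: jac_vec_def jac_coeff_last)
qed

text \<open>Membership in the kernel of row \<open>i\<close> becomes the vanishing of a minor that
  is larger by one, in the field as well as modulo an ideal.\<close>

lemma jac_vec_row:
  assumes "length js = Suc (length is)" "set js \<subseteq> {..<n}"
  shows "(\<Sum>l<n. J $$ (i, l) * jac_vec J is js l) = minor J (is @ [i]) js"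
proof -
  have "(\<Sum>l<n. J $$ (i, l) * jac_vec J is js l) =
      (\<Sum>l<n. \<Sum>k | k \<in> {..<length js} \<and> js ! k = l. J $$ (i, js ! k) * jac_coeff J is js k)"
    by (intro sum.cong refl) (auto simp: jac_vec_def sum_distrib_left intro!: sum.cong)
  also have "\<dots> = (\<Sum>k<length js. J $$ (i, js ! k) * jac_coeff J is js k)"
    using assms(2) by (intro sum.group) (auto simp: image_subset_iff dest!: nth_mem)
  finally show ?thesis by (simp add: minor_last_row[OF assms(1)])
qed

text \<open>The rows \<open>is\<close> alone force every linear relation between the columns
  \<open>js\<close> to be trivial, so these columns are independent.\<close>

lemma minor_le_rank:
  fixes J :: "'q::field mat"
  assumes "J \<in> carrier_mat m n" "is \<in> tuples m k" "js \<in> tuples n k" "minor J is js \<noteq> 0"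
  shows "k \<le> vec_space.rank m J"
proof -
  interpret vec_space "TYPE('q)" m .
  have len: "length is = length js" "length js = k" using assms by (auto simp: tuples_def)
  let ?A = "mat_of_cols m (map (col J) js)"
  have A: "?A \<in> carrier_mat m k" using mat_of_cols_carrier(1)[of m "map (col J) js"] len by simp
  have Aij: "?A $$ (i, b) = J $$ (i, js ! b)" if "i < m" "b < k" for i b
    using that assms len tuplesD(2)[OF assms(3), of b] by (simp add: mat_of_cols_index)
  have cols_A: "cols ?A = map (col J) js"
    using assms(1) by (intro cols_mat_of_cols) auto
  have ker: "v = 0\<^sub>v k" if v: "v \<in> carrier_vec k" "?A *\<^sub>v v = 0\<^sub>v m" for v
  proof (rule eq_vecI)
    have "(\<Sum>b<length js. J $$ (is ! a, js ! b) * v $ b) = 0" if a: "a < length is" for a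
    proof -
      have i: "is ! a < m" using tuplesD(2)[OF assms(2)] a len by simp
      have "(\<Sum>b<length js. J $$ (is ! a, js ! b) * v $ b) = (?A *\<^sub>v v) $ (is ! a)"
        using i v(1) len A by (auto simp: scalar_prod_def lessThan_atLeast0 Aij intro!: sum.cong)
      also have "\<dots> = 0" unfolding v(2) using i by simp
      finally show ?thesis .
    qed
    then show "v $ b = 0\<^sub>v k $ b" if "b < dim_vec (0\<^sub>v k)" for b
      using minor_kernel_trivial[OF len(1) assms(4), of "\<lambda>b. v $ b" b] that len by simp
  qed (use v in auto)
  \<comment> \<open>Linear independence is a property of the set of columns, so a repeated column
    has to be excluded separately.\<close>
  have dist: "distinct (cols ?A)"
  proof (rule ccontr)
    assume "\<not> distinct (cols ?A)"
    then obtain a b where ab: "a < k" "b < k" "a \<noteq> b" "col J (js ! a) = col J (js ! b)"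
      using len by (auto simp: cols_A distinct_conv_nth)
    have "J $$ (i, js ! a) = J $$ (i, js ! b)" if "i < m" for i
      using that ab assms tuplesD(2)[OF assms(3)] by (metis carrier_matD index_col)
    then have "?A *\<^sub>v (unit_vec k a - unit_vec k b) = 0\<^sub>v m"
      using ab A by (intro eq_vecI) (auto simp: scalar_prod_minus_distrib[of _ k] Aij)
    then have "unit_vec k a - unit_vec k b = (0\<^sub>v k :: 'q vec)" by (intro ker) auto
    then have "(unit_vec k a - unit_vec k b) $ a = (0\<^sub>v k :: 'q vec) $ a" by simp
    then show False using ab by simp
  qed
  have "lin_indpt (set (cols ?A))" using lin_depE[OF A _ dist] ker by metis
  moreover have "set (cols ?A) \<subseteq> set (cols J)"
    unfolding cols_A using assms(1,3) by (auto simp: cols_def tuples_def)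
  ultimately have "card (set (cols ?A)) \<le> rank J" using rank_ge_card_indpt[OF assms(1)] by blast
  then show ?thesis using distinct_card[OF dist] cols_A len by simp
qed

lemma minor_vanishes:
  fixes J :: "'q::field mat"
  assumes "J \<in> carrier_mat m n" "is \<in> tuples m k" "js \<in> tuples n k" "vec_space.rank m J < k"
  shows "minor J is js = 0"
  using minor_le_rank[OF assms(1-3)] assms(4) by linarith

text \<open>Take a nonzero minor of largest size with columns in a maximal independent set
  \<open>cs\<close> of columns. Were it smaller than the rank, one more column from
  \<open>cs\<close> would give, through \<open>jac_vec\<close>, a nontrivial relation between the
  columns \<open>cs\<close>.\<close>

lemma rank_minor_exists:
  fixes J :: "'q::field mat"
  assumes J: "J \<in> carrier_mat m n"
  shows "\<exists>is js. is \<in> tuples m (vec_space.rank m J) \<and> js \<in> tuples n (vec_space.rank m J) \<and>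
    minor J is js \<noteq> 0"
proof -
  interpret vec_space "TYPE('q)" m .
  let ?Q = "\<lambda>T. T \<subseteq> set (cols J) \<and> lin_indpt T"
  have "?Q {}" using finite_lin_indpt2[of "{}"] by auto
  then obtain S where S: "maximal S ?Q"
    using maximal_exists_superset[of "set (cols J)" ?Q "{}"] by blast
  then have SJ: "S \<subseteq> set (cols J)" "lin_indpt S" by (auto simp: maximal_def)
  have rS: "rank J = card S" by (rule rank_card_indpt[OF J S])
  have "\<exists>xs. set xs = S \<and> distinct xs" using SJ finite_subset finite_distinct_list by blast
  then obtain us where us: "set us = S" "distinct us" by blast
  have "\<forall>u\<in>set us. \<exists>j<n. col J j = u" using SJ us J by (fastforce simp: cols_def)
  then obtain h where h: "\<And>u. u \<in> set us \<Longrightarrow> h u < n \<and> col J (h u) = u" by metis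
  define cs where "cs = map h us"
  have map_cs: "map (col J) cs = us" using h by (auto simp: cs_def intro!: map_idI)
  have "distinct (map (col J) cs)" using map_cs us by simp
  then have cs: "set cs \<subseteq> {..<n}" "length cs = rank J" "distinct cs"
    using h us rS distinct_card[OF us(2)] by (auto simp: cs_def distinct_map intro: inj_on_imageI2)
  let ?r = "rank J"
  let ?A = "mat_of_cols m us"
  have A: "?A \<in> carrier_mat m ?r" using cs by (auto simp: cs_def)
  have "set us \<subseteq> carrier_vec m" using h J by (metis col_carrier_vec carrier_matD subsetI)
  then have cols_A: "cols ?A = us" by (intro cols_mat_of_cols) auto
  have Aij: "?A $$ (i, b) = J $$ (i, cs ! b)" if "i < m" "b < ?r" for i b
    using that cs J h by (auto simp: cs_def mat_of_cols_index) (metis carrier_matD index_col nth_mem)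
  have ker: "v = 0\<^sub>v ?r" if "v \<in> carrier_vec ?r" "?A *\<^sub>v v = 0\<^sub>v m" for v
  proof (rule ccontr)
    assume "v \<noteq> 0\<^sub>v ?r"
    moreover have "distinct (cols ?A)" unfolding cols_A by (fact us(2))
    ultimately have "lin_dep (set (cols ?A))" by (rule lin_depI[OF A that(1) _ that(2)])
    then show False using SJ(2) unfolding cols_A us(1) by simp
  qed
  define Q where "Q = (\<lambda>k. \<exists>is js. is \<in> tuples m k \<and> js \<in> tuples n k \<and> set js \<subseteq> set cs \<and> minor J is js \<noteq> 0)"
  \<comment> \<open>The empty determinant is 1.\<close>
  have "Q 0" by (auto simp: Q_def tuples_def minor_def)
  moreover have bound: "\<forall>k. Q k \<longrightarrow> k \<le> ?r"
    unfolding Q_def using minor_le_rank[OF J] by blast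
  ultimately obtain k where k: "Q k" "\<And>k'. Q k' \<Longrightarrow> k' \<le> k"
    using GreatestI_ex_nat[of Q ?r] Greatest_le_nat[of Q _ ?r] by blast
  then obtain "is" js where ij: "is \<in> tuples m k" "js \<in> tuples n k" "set js \<subseteq> set cs" "minor J is js \<noteq> 0"
    unfolding Q_def by blast
  have len: "length is = length js" "length js = k" using ij by (auto simp: tuples_def)
  have "k = ?r"
  proof (rule ccontr)
    assume "k \<noteq> ?r"
    then have "k < ?r" using bound k by (simp add: le_neq_implies_less)
    then have "card (set js) < card (set cs)"
      using cs len card_length[of js] by (simp add: distinct_card)
    then obtain l where l: "l \<in> set cs" "l \<notin> set js" by (metis card_mono List.finite_set not_less subsetI)
    have jl: "js @ [l] \<in> tuples n (Suc k)" using ij l cs by (intro snoc_tuples) auto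
    have row: "(\<Sum>j<n. J $$ (i, j) * jac_vec J is (js @ [l]) j) = 0" if "i < m" for i
    proof -
      have "\<not> Q (Suc k)" using k(2) by fastforce
      moreover have "is @ [i] \<in> tuples m (Suc k)" using snoc_tuples ij that by blast
      ultimately have "minor J (is @ [i]) (js @ [l]) = 0" unfolding Q_def using jl ij l by fastforce
      then show ?thesis using jl len by (simp add: jac_vec_row tuples_def)
    qed
    let ?v = "vec ?r (\<lambda>b. jac_vec J is (js @ [l]) (cs ! b))"
    have "?A *\<^sub>v ?v = 0\<^sub>v m"
    proof (rule eq_vecI)
      fix i assume "i < dim_vec (0\<^sub>v m :: 'q vec)"
      then have i: "i < m" by simp
      have "(?A *\<^sub>v ?v) $ i = (\<Sum>b<length cs. J $$ (i, cs ! b) * jac_vec J is (js @ [l]) (cs ! b))"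
        using i A cs by (auto simp: scalar_prod_def lessThan_atLeast0 Aij intro!: sum.cong)
      also have "\<dots> = (\<Sum>j<n. J $$ (i, j) * jac_vec J is (js @ [l]) j)"
        using cs ij l by (intro sum_distinct_list[symmetric]) (auto intro!: jac_vec_notin)
      finally show "(?A *\<^sub>v ?v) $ i = 0\<^sub>v m $ i" using row i by simp
    qed (use A in auto)
    then have v0: "?v = 0\<^sub>v ?r" by (intro ker) auto
    obtain b where b: "b < ?r" "cs ! b = l" using l cs by (metis in_set_conv_nth)
    have "?v $ b = 0" using b by (subst v0) simp
    then have "jac_vec J is (js @ [l]) l = 0" using b by simp
    then show False using ij(4) by (simp add: jac_vec_snoc[OF len(1) l(2) l(2)])
  qed
  then show ?thesis using ij by blast
qed

text \<open>Row \<open>i\<close> is a combination of the rows \<open>is\<close>: expand the vanishing minors with rows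
  \<open>is @ [i]\<close> and columns \<open>js @ [l]\<close> along the last column.\<close>

lemma kernel_of_rows:
  fixes J :: "'q::field mat"
  assumes J: "J \<in> carrier_mat m n" and r: "r = vec_space.rank m J"
    and ij: "is \<in> tuples m r" "js \<in> tuples n r" "minor J is js \<noteq> 0"
    and v: "\<And>a. a < r \<Longrightarrow> (\<Sum>l<n. J $$ (is ! a, l) * v l) = 0" and i: "i < m"
  shows "(\<Sum>l<n. J $$ (i, l) * v l) = 0"
proof -
  have len: "length is = length js" "length js = r" using ij by (auto simp: tuples_def)
  obtain \<alpha> where \<alpha>: "\<And>l. minor J (is @ [i]) (js @ [l]) =
      (\<Sum>a<length is. J $$ (is ! a, l) * \<alpha> a) + J $$ (i, l) * minor J is js"
    using minor_last_column[OF len(1)] by blast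
  have "minor J (is @ [i]) (js @ [l]) = 0" if "l < n" for l
    using r by (intro minor_vanishes[OF J, where k = "Suc r"] snoc_tuples ij i that) auto
  then have row: "J $$ (i, l) * minor J is js = - (\<Sum>a<r. J $$ (is ! a, l) * \<alpha> a)" if "l < n" for l
    using \<alpha>[of l] that len by (simp add: eq_neg_iff_add_eq_0 add.commute)
  have "(\<Sum>l<n. J $$ (i, l) * v l) * minor J is js = (\<Sum>l<n. (J $$ (i, l) * minor J is js) * v l)"
    by (simp add: sum_distrib_left mult_ac)
  also have "\<dots> = - (\<Sum>l<n. \<Sum>a<r. J $$ (is ! a, l) * v l * \<alpha> a)"
  proof -
    have "(\<Sum>l<n. (J $$ (i, l) * minor J is js) * v l) =
        (\<Sum>l<n. - (\<Sum>a<r. J $$ (is ! a, l) * \<alpha> a) * v l)"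
      by (intro sum.cong refl) (simp add: row)
    then show ?thesis by (simp add: sum_negf sum_distrib_left mult_ac)
  qed
  also have "(\<Sum>l<n. \<Sum>a<r. J $$ (is ! a, l) * v l * \<alpha> a) = (\<Sum>a<r. (\<Sum>l<n. J $$ (is ! a, l) * v l) * \<alpha> a)"
    by (subst sum.swap) (simp add: sum_distrib_right)
  also have "\<dots> = 0" using v by simp
  finally show ?thesis using ij by simp
qed

text \<open>Rows and columns may be tested separately. A relation between the columns
  \<open>js\<close> on the rows \<open>is\<close> holds on all rows, since the rows
  \<open>is\<close> generate the others; on the rows \<open>is'\<close>, which have a nonzero minor
  with \<open>js\<close>, it must be trivial.\<close>

lemma nonsing_minor:
  fixes J :: "'q::field mat"
  assumes J: "J \<in> carrier_mat m n" and r: "r = vec_space.rank m J"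
    and "is": "is \<in> nonsing_rows J r" and js: "js \<in> nonsing_cols J r"
  shows "minor J is js \<noteq> 0"
proof
  assume 0: "minor J is js = 0"
  obtain js' where i: "is \<in> tuples m r" and js': "js' \<in> tuples n r" "minor J is js' \<noteq> 0"
    using "is" J by (auto simp: nonsing_rows_def inc_tuples_def)
  obtain is' where j: "js \<in> tuples n r" and is': "is' \<in> tuples m r" "minor J is' js \<noteq> 0"
    using js J by (auto simp: nonsing_cols_def inc_tuples_def)
  have len: "length is = r" "length js = r" "length is' = r" using i j is' by (auto simp: tuples_def)
  have dist: "distinct js" using minor_distinct_columns[OF _ is'(2)] len by simp
  let ?A = "mat r r (\<lambda>(a, b). J $$ (is ! a, js ! b))"
  have "det ?A = 0" using 0 len by (simp add: minor_def)
  then obtain w where w: "w \<in> carrier_vec r" "w \<noteq> 0\<^sub>v r" "?A *\<^sub>v w = 0\<^sub>v r"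
    using det_0_iff_vec_prod_zero_field[of ?A r] by auto
  define v where "v = (\<lambda>l. \<Sum>b\<in>{b. b < r \<and> js ! b = l}. w $ b)"
  have v_nth: "v (js ! b) = w $ b" if "b < r" for b
  proof -
    have "{a. a < r \<and> js ! a = js ! b} = {b}" using that dist len by (auto simp: nth_eq_iff_index_eq)
    then show ?thesis by (simp add: v_def)
  qed
  have v_out: "v l = 0" if "l \<notin> set js" for l
    unfolding v_def using that len by (intro sum.neutral) auto
  have sum: "(\<Sum>l<n. J $$ (i, l) * v l) = (\<Sum>b<r. J $$ (i, js ! b) * w $ b)" for i
    using sum_distinct_list[OF dist, of n "\<lambda>l. J $$ (i, l) * v l"] j v_out len v_nth
    by (auto simp: tuples_def)
  have "(\<Sum>l<n. J $$ (is ! a, l) * v l) = 0" if "a < r" for a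
  proof -
    have "(\<Sum>b<r. J $$ (is ! a, js ! b) * w $ b) = (?A *\<^sub>v w) $ a"
      using that w(1) by (auto simp: scalar_prod_def lessThan_atLeast0 intro!: sum.cong)
    also have "\<dots> = 0" unfolding w(3) using that by simp
    finally show ?thesis using sum by simp
  qed
  then have "(\<Sum>l<n. J $$ (i, l) * v l) = 0" if "i < m" for i
    using kernel_of_rows[OF J r i js', of v] that by blast
  then have "(\<Sum>l<n. J $$ (is' ! a, l) * v l) = 0" if "a < r" for a
    using tuplesD(2)[OF is'(1) that] by blast
  then have "v l = 0" if "l < n" for l
    using minor_zero_vector[OF is'(1) j is'(2), of v l] v_out that by blast
  then have "w $ b = 0" if "b < r" for b using v_nth tuplesD(2)[OF j] that by metis
  then have "w = 0\<^sub>v r" using w by (intro eq_vecI) auto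
  then show False using w by blast
qed

section \<open>Partial derivatives\<close>

lemma partial_deriv_superset:
  assumes "finite E" "Poly_Mapping.keys p \<subseteq> E"
  shows "partial_deriv l p = (\<Sum>e \<in> E. Poly_Mapping.single (e - Poly_Mapping.single l 1)
    (of_nat (Poly_Mapping.lookup e l) * Poly_Mapping.lookup p e))"
  unfolding partial_deriv_def using assms
  by (intro sum.mono_neutral_left) (auto simp: in_keys_iff)

lemma partial_deriv_add: "partial_deriv l (p + q) = partial_deriv l p + partial_deriv l q"
proof -
  let ?E = "Poly_Mapping.keys p \<union> Poly_Mapping.keys q"
  have "finite ?E" "Poly_Mapping.keys (p + q) \<subseteq> ?E" by (auto simp: Poly_Mapping.keys_add)
  then show ?thesis
    using partial_deriv_superset[of ?E "p + q" l] partial_deriv_superset[of ?E p l]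
      partial_deriv_superset[of ?E q l]
    by (simp add: sum.distrib lookup_add single_add distrib_left)
qed

lemma partial_deriv_0: "partial_deriv l 0 = 0"
  by (simp add: partial_deriv_def)

lemma partial_deriv_sum: "partial_deriv l (\<Sum>u\<in>U. g u) = (\<Sum>u\<in>U. partial_deriv l (g u))"
  by (induction U rule: infinite_finite_induct) (auto simp: partial_deriv_0 partial_deriv_add)

lemma partial_deriv_single:
  "partial_deriv l (Poly_Mapping.single e c) =
    Poly_Mapping.single (e - Poly_Mapping.single l 1) (of_nat (Poly_Mapping.lookup e l) * c)"
  by (simp add: partial_deriv_superset[of "{e}"])

lemma monomial_expansion: "p = (\<Sum>e\<in>Poly_Mapping.keys p. Poly_Mapping.single e (Poly_Mapping.lookup p e))"
proof (rule poly_mapping_eqI)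
  fix e
  have "Poly_Mapping.lookup (\<Sum>e\<in>Poly_Mapping.keys p. Poly_Mapping.single e (Poly_Mapping.lookup p e)) e =
    (\<Sum>e'\<in>Poly_Mapping.keys p. if e' = e then Poly_Mapping.lookup p e' else 0)"
    by (auto simp: lookup_sum lookup_single when_def intro!: sum.cong)
  then show "Poly_Mapping.lookup p e =
      Poly_Mapping.lookup (\<Sum>e\<in>Poly_Mapping.keys p. Poly_Mapping.single e (Poly_Mapping.lookup p e)) e"
    by (simp add: in_keys_iff)
qed

lemma partial_deriv_mult_single:
  "partial_deriv l (Poly_Mapping.single e c * Poly_Mapping.single e' c') =
    partial_deriv l (Poly_Mapping.single e c) * Poly_Mapping.single e' c' +
    Poly_Mapping.single e c * partial_deriv l (Poly_Mapping.single e' c')"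
proof -
  let ?s = "Poly_Mapping.single l (1::nat)"
  \<comment> \<open>Truncated subtraction commutes with addition only if the variable occurs; if it
    does not, the coefficient \<open>of_nat 0\<close> removes the term.\<close>
  have shift: "a - ?s + b = a + b - ?s" if "0 < Poly_Mapping.lookup a l" for a b :: "nat \<Rightarrow>\<^sub>0 nat"
    using that by (intro poly_mapping_eqI) (auto simp: lookup_add lookup_minus lookup_single when_def)
  have 1: "Poly_Mapping.single (e - ?s + e') (of_nat (Poly_Mapping.lookup e l) * c * c') =
      Poly_Mapping.single (e + e' - ?s) (of_nat (Poly_Mapping.lookup e l) * c * c')"
    using shift[of e e'] by (cases "Poly_Mapping.lookup e l") (auto simp del: of_nat_Suc)
  have 2: "Poly_Mapping.single (e + (e' - ?s)) (c * (of_nat (Poly_Mapping.lookup e' l) * c')) =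
      Poly_Mapping.single (e + e' - ?s) (of_nat (Poly_Mapping.lookup e' l) * c * c')"
    using shift[of e' e] by (cases "Poly_Mapping.lookup e' l") (auto simp: add.commute mult_ac simp del: of_nat_Suc)
  show ?thesis
    by (simp only: mult_single partial_deriv_single 1 2)
      (simp add: lookup_add single_add[symmetric] algebra_simps)
qed

lemma partial_deriv_mult:
  "partial_deriv l (p * q) = partial_deriv l p * q + p * partial_deriv l q"
proof -
  let ?m = "\<lambda>p e. Poly_Mapping.single e (Poly_Mapping.lookup p e)"
  let ?E = "Poly_Mapping.keys p" and ?E' = "Poly_Mapping.keys q"
  have "partial_deriv l ((\<Sum>e\<in>?E. ?m p e) * (\<Sum>e'\<in>?E'. ?m q e')) =
    partial_deriv l (\<Sum>e\<in>?E. ?m p e) * (\<Sum>e'\<in>?E'. ?m q e') +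
    (\<Sum>e\<in>?E. ?m p e) * partial_deriv l (\<Sum>e'\<in>?E'. ?m q e')"
    by (simp only: sum_product partial_deriv_sum partial_deriv_mult_single sum.distrib)
  then show ?thesis by (simp only: monomial_expansion[symmetric])
qed

lemma partial_deriv_Const: "partial_deriv l (Const c) = 0"
  by (simp add: Const_def partial_deriv_single)

lemma partial_deriv_Var: "partial_deriv l (Var j) = (if j = l then 1 else 0)"
  by (simp add: Var_def partial_deriv_single lookup_single when_def)

lemma cring_ring_on:
  fixes C :: "'a::comm_ring_1 set"
  assumes "1 \<in> C" "\<And>a b. a \<in> C \<Longrightarrow> b \<in> C \<Longrightarrow> a + b \<in> C" "\<And>a b. a \<in> C \<Longrightarrow> b \<in> C \<Longrightarrow> a * b \<in> C"
    "\<And>a. a \<in> C \<Longrightarrow> - a \<in> C"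
  shows "cring (ring_on C)"
proof (rule cringI)
  have 0: "0 \<in> C" using assms(2)[OF assms(1) assms(4)[OF assms(1)]] by simp
  show "abelian_group (ring_on C)"
    by (rule abelian_groupI)
      (use assms 0 in \<open>auto simp: class_ring_simps intro: bexI[of _ "- x" for x]\<close>)
  show "Group.comm_monoid (ring_on C)"
    by (rule comm_monoidI) (use assms in \<open>auto simp: class_ring_simps\<close>)
qed (auto simp: class_ring_simps distrib_right)

section \<open>Polynomials in n variables: closure properties and induction\<close>

abbreviation polys :: "nat \<Rightarrow> 'k::comm_ring_1 mpoly set" where
  "polys n \<equiv> carrier (poly_ring n)"

lemma polys_def: "polys n = {p. \<forall>e \<in> Poly_Mapping.keys p. Poly_Mapping.keys e \<subseteq> {..<n}}"
  by (simp add: poly_ring_def)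

lemma polys_add: "p \<in> polys n \<Longrightarrow> q \<in> polys n \<Longrightarrow> p + q \<in> polys n"
  unfolding polys_def using Poly_Mapping.keys_add[of p q] by blast

lemma polys_mult:
  assumes "p \<in> polys n" "q \<in> polys n"
  shows "p * q \<in> polys n"
  unfolding polys_def
proof (intro CollectI ballI)
  fix e assume "e \<in> Poly_Mapping.keys (p * q)"
  then obtain a b where e: "e = a + b" "a \<in> Poly_Mapping.keys p" "b \<in> Poly_Mapping.keys q"
    using keys_mult[of p q] by blast
  have "Poly_Mapping.keys a \<subseteq> {..<n}" "Poly_Mapping.keys b \<subseteq> {..<n}"
    using e assms by (auto simp: polys_def)
  then show "Poly_Mapping.keys e \<subseteq> {..<n}"
    unfolding e(1) using Poly_Mapping.keys_add[of a b] by blast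
qed

lemma polys_uminus: "p \<in> polys n \<Longrightarrow> - p \<in> polys n"
  unfolding polys_def by (simp add: in_keys_iff)

lemma polys_Const: "Const c \<in> polys n"
  by (auto simp: polys_def Const_def split: if_splits)

lemma polys_Var: "l < n \<Longrightarrow> Var l \<in> polys n"
  by (auto simp: polys_def Var_def split: if_splits)

lemma Const_0: "Const 0 = 0" and Const_1: "Const 1 = 1"
  by (simp_all add: Const_def)

lemma Const_add: "Const (a + b) = Const a + Const b"
  and Const_mult: "Const (a * b) = Const a * Const b"
  and Const_uminus: "Const (- a) = - Const a"
  by (simp_all add: Const_def single_add mult_single single_uminus)

lemma polys_0: "0 \<in> polys n" and polys_1: "1 \<in> polys n"
  using polys_Const[of 0 n] polys_Const[of 1 n] by (simp_all add: Const_0 Const_1)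

lemma polys_sum: "(\<And>u. u \<in> U \<Longrightarrow> g u \<in> polys n) \<Longrightarrow> (\<Sum>u\<in>U. g u) \<in> polys n"
  by (induction U rule: infinite_finite_induct) (auto simp: polys_0 polys_add)

lemma polys_partial_deriv:
  assumes "p \<in> polys n"
  shows "partial_deriv l p \<in> polys n"
  unfolding partial_deriv_def
proof (rule polys_sum)
  fix e assume "e \<in> Poly_Mapping.keys p"
  then have "Poly_Mapping.keys e \<subseteq> {..<n}" using assms by (auto simp: polys_def)
  moreover have "Poly_Mapping.keys (e - Poly_Mapping.single l 1) \<subseteq> Poly_Mapping.keys e"
    by (auto simp: in_keys_iff lookup_minus)
  ultimately show "Poly_Mapping.single (e - Poly_Mapping.single l 1)
      (of_nat (Poly_Mapping.lookup e l) * Poly_Mapping.lookup p e) \<in> polys n"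
    by (auto simp: polys_def split: if_splits)
qed

lemma cring_poly_ring: "cring (poly_ring n :: 'k::comm_ring_1 mpoly ring)"
proof -
  have "cring (ring_on (polys n :: 'k mpoly set))"
    by (rule cring_ring_on) (simp_all add: polys_1 polys_add polys_mult polys_uminus)
  then show ?thesis by (simp add: poly_ring_def)
qed

lemma poly_ring_simps [simp]:
  "add (poly_ring n) = (+)" "monoid.mult (poly_ring n) = (*)" "one (poly_ring n) = 1" "zero (poly_ring n) = 0"
  by (simp_all add: poly_ring_def class_ring_simps)

text \<open>Rules that hold for sums and products need to be checked on constants and variables
  only; this gives the chain rule.\<close>

lemma polys_induct [consumes 1, case_names Const Var add mult]:
  assumes p: "p \<in> polys n"
    and Const: "\<And>c. Q (Const c)" and Var: "\<And>l. l < n \<Longrightarrow> Q (Var l)"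
    and add: "\<And>p q. p \<in> polys n \<Longrightarrow> q \<in> polys n \<Longrightarrow> Q p \<Longrightarrow> Q q \<Longrightarrow> Q (p + q)"
    and mult: "\<And>p q. p \<in> polys n \<Longrightarrow> q \<in> polys n \<Longrightarrow> Q p \<Longrightarrow> Q q \<Longrightarrow> Q (p * q)"
  shows "Q p"
proof -
  let ?Q = "\<lambda>p. p \<in> polys n \<and> Q p"
  have one: "?Q 1" using Const[of 1] by (simp add: Const_1 polys_1)
  have zero: "?Q 0" using Const[of 0] by (simp add: Const_0 polys_0)
  have qmult: "?Q (p * q)" if "?Q p" "?Q q" for p q using that mult polys_mult by blast
  have qadd: "?Q (p + q)" if "?Q p" "?Q q" for p q using that add polys_add by blast
  have pow: "?Q (Poly_Mapping.single (Poly_Mapping.single l k) 1)" if l: "l < n" for l k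
  proof (induction k)
    case (Suc k)
    have *: "Poly_Mapping.single (Poly_Mapping.single l (Suc k)) 1 =
        Var l * Poly_Mapping.single (Poly_Mapping.single l k) (1::'a)"
      by (simp add: Var_def mult_single flip: single_add)
    show ?case unfolding * using polys_Var[OF l] Var[OF l] Suc by (intro qmult) blast+
  qed (use one in simp)
  have mon: "?Q (Poly_Mapping.single (\<Sum>l\<in>L. Poly_Mapping.single l (k l)) 1)" if "L \<subseteq> {..<n}" for L k
    using that
  proof (induction L rule: infinite_finite_induct)
    case (insert l L)
    have *: "Poly_Mapping.single (\<Sum>l\<in>insert l L. Poly_Mapping.single l (k l)) 1 =
        Poly_Mapping.single (Poly_Mapping.single l (k l)) 1 *
        Poly_Mapping.single (\<Sum>l\<in>L. Poly_Mapping.single l (k l)) (1::'a)"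
      using insert.hyps by (simp add: mult_single)
    have "l < n" "L \<subseteq> {..<n}" using insert.prems by auto
    then show ?case unfolding * by (intro qmult pow insert.IH)
  qed (use one in simp_all)
  have single: "?Q (Poly_Mapping.single e c)" if "Poly_Mapping.keys e \<subseteq> {..<n}" for e c
  proof -
    have *: "Poly_Mapping.single e c =
        Const c * Poly_Mapping.single (\<Sum>l\<in>Poly_Mapping.keys e. Poly_Mapping.single l (Poly_Mapping.lookup e l)) 1"
      by (simp add: Const_def mult_single flip: monomial_expansion)
    show ?thesis unfolding * using Const polys_Const mon[OF that] by (intro qmult) blast+
  qed
  have "?Q (\<Sum>e\<in>E. Poly_Mapping.single e (Poly_Mapping.lookup p e))"
    if "E \<subseteq> Poly_Mapping.keys p" for E
    using that p
  proof (induction E rule: infinite_finite_induct)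
    case (insert e E)
    have "?Q (Poly_Mapping.single e (Poly_Mapping.lookup p e))"
      using insert.prems by (intro single) (auto simp: polys_def)
    then show ?case using qadd insert by simp
  qed (use zero in simp_all)
  from this[OF order_refl] show ?thesis by (simp flip: monomial_expansion)
qed

section \<open>Affine algebras inside their field of fractions\<close>

text \<open>The affine domain \<open>P\<^sub>n / I\<close> is represented by its image under \<open>\<pi>\<close> in the field of fractions.\<close>

locale affine_image =
  fixes n m :: nat and f :: "nat \<Rightarrow> 'k::field_char_0 mpoly" and \<pi> :: "'k mpoly \<Rightarrow> 'q::field"
  assumes f_polys: "i < m \<Longrightarrow> f i \<in> polys n"
    and pi_add: "p \<in> polys n \<Longrightarrow> q \<in> polys n \<Longrightarrow> \<pi> (p + q) = \<pi> p + \<pi> q"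
    and pi_mult: "p \<in> polys n \<Longrightarrow> q \<in> polys n \<Longrightarrow> \<pi> (p * q) = \<pi> p * \<pi> q"
    and pi_1: "\<pi> 1 = 1"
    and pi_kernel: "p \<in> polys n \<Longrightarrow> \<pi> p = 0 \<longleftrightarrow> p \<in> Idl\<^bsub>poly_ring n\<^esub> (f ` {..<m})"
    and fraction: "\<exists>a\<in>polys n. \<exists>b\<in>polys n. \<pi> b \<noteq> 0 \<and> y = \<pi> a / \<pi> b"
begin

abbreviation "A0 \<equiv> \<pi> ` polys n"
abbreviation "\<kappa> \<equiv> \<lambda>c. \<pi> (Const c)"
abbreviation "K \<equiv> range \<kappa>"
abbreviation "x \<equiv> \<lambda>l. \<pi> (Var l)"
abbreviation "J \<equiv> mat m n (\<lambda>(i, j). \<pi> (partial_deriv j (f i)))"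
abbreviation "r \<equiv> vec_space.rank m J"

lemma J_carrier: "J \<in> carrier_mat m n"
  by simp

lemma pi_0: "\<pi> 0 = 0"
  using pi_add[OF polys_0 polys_0] by (metis add.right_neutral add_left_cancel)

lemma pi_uminus: "p \<in> polys n \<Longrightarrow> \<pi> (- p) = - \<pi> p"
  using pi_add[of p "- p"] polys_uminus[of p n] pi_0 by (simp add: eq_neg_iff_add_eq_0 add.commute)

lemma pi_diff: "p \<in> polys n \<Longrightarrow> q \<in> polys n \<Longrightarrow> \<pi> (p - q) = \<pi> p - \<pi> q"
  using pi_add[of p "- q"] polys_uminus[of q n] pi_uminus[of q] by simp

lemma polys_diff: "p \<in> polys n \<Longrightarrow> q \<in> polys n \<Longrightarrow> p - q \<in> (polys n :: 'k mpoly set)"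
  using polys_add[of p n "- q"] polys_uminus[of q n] by simp

lemma A0_subring: "field_subring A0"
proof
  show "1 \<in> A0" using pi_1 polys_1 by force
  fix a b assume "a \<in> A0" "b \<in> A0"
  then obtain p q where "p \<in> polys n" "q \<in> polys n" "a = \<pi> p" "b = \<pi> q" by blast
  then show "a + b \<in> A0" "a * b \<in> A0" "- a \<in> A0"
    using pi_add[of p q] pi_mult[of p q] pi_uminus[of p] polys_add[of p n q] polys_mult[of p n q]
      polys_uminus[of p n] by (metis imageI)+
qed

lemma kappa_add: "\<kappa> (a + b) = \<kappa> a + \<kappa> b" and kappa_mult: "\<kappa> (a * b) = \<kappa> a * \<kappa> b"
  and kappa_uminus: "\<kappa> (- a) = - \<kappa> a" and kappa_1: "\<kappa> 1 = 1" and kappa_0: "\<kappa> 0 = 0"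
  by (simp_all add: Const_add Const_mult Const_uminus Const_1 Const_0 pi_add pi_mult pi_uminus pi_1 pi_0
      polys_Const)

lemma kappa_inverse: "c \<noteq> 0 \<Longrightarrow> \<kappa> (inverse c) * \<kappa> c = 1"
  by (simp flip: kappa_mult add: kappa_1)

lemma K_subring: "field_subring K"
proof
  show "1 \<in> K" using kappa_1 by (metis rangeI)
qed (auto simp flip: kappa_add kappa_mult kappa_uminus)

lemma K_sub: "K \<subseteq> A0"
  by (auto intro: polys_Const)

lemma x_in: "l < n \<Longrightarrow> x l \<in> A0"
  by (auto intro: polys_Var)

text \<open>The type \<open>'q\<close> is merely a field; it inherits characteristic zero from the
  constants, where positive integers are invertible.\<close>

lemma char_0: "0 < k \<Longrightarrow> of_nat k \<noteq> (0::'q)"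
proof -
  assume "0 < k"
  have of_nat: "of_nat k = \<kappa> (of_nat k)" for k
    by (induction k) (simp_all add: kappa_0 kappa_add kappa_1)
  have "\<kappa> (inverse (of_nat k)) * \<kappa> (of_nat k) = 1" using \<open>0 < k\<close> by (intro kappa_inverse) simp
  then show "of_nat k \<noteq> (0::'q)" unfolding of_nat by auto
qed

lemma J_entry: "i < m \<Longrightarrow> j < n \<Longrightarrow> J $$ (i, j) \<in> A0"
  using polys_partial_deriv[OF f_polys] by simp

lemma minor_in:
  assumes "is \<in> tuples m k" "js \<in> tuples n k"
  shows "minor J is js \<in> A0"
proof -
  interpret A0: field_subring A0 by (rule A0_subring)
  let ?A = "mat k k (\<lambda>(a, b). J $$ (is ! a, js ! b))"
  have len: "length is = k" "length js = k" using assms by (auto simp: tuples_def)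
  have "det ?A = (\<Sum>p | p permutes {0..<k}. signof p * (\<Prod>i = 0..<k. ?A $$ (i, p i)))"
    by (rule det_def') simp
  also have "\<dots> \<in> A0"
  proof (intro A0.sum_in A0.mult_in A0.prod_in)
    fix p i assume p: "p \<in> {p. p permutes {0..<k}}" and i: "i \<in> {0..<k}"
    then have "p i < k" using permutes_in_image[of p "{0..<k}" i] by auto
    then show "?A $$ (i, p i) \<in> A0"
      using i tuplesD(2)[OF assms(1)] tuplesD(2)[OF assms(2)] J_entry by simp
  next
    fix p :: "nat \<Rightarrow> nat"
    show "signof p \<in> A0" by (auto simp: sign_def A0.one_in intro!: A0.uminus_in)
  qed
  finally show ?thesis using len by (simp add: minor_def)
qed

lemma jac_vec_in:
  assumes "is \<in> tuples m k" "js \<in> tuples n (Suc k)"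
  shows "jac_vec J is js l \<in> A0"
proof -
  interpret A0: field_subring A0 by (rule A0_subring)
  show ?thesis unfolding jac_vec_def jac_coeff_def
    using minor_in[OF assms(1) omit_tuples[OF assms(2)]] tuplesD(1)[OF assms(2)]
    by (intro A0.sum_in A0.mult_in A0.power_in A0.uminus_in A0.one_in) simp
qed

text \<open>The derivation along \<pi> from the polynomial ring to the field that takes the value
  \<open>v l\<close> at the variable \<open>l\<close>.\<close>

definition dir_deriv :: "(nat \<Rightarrow> 'q) \<Rightarrow> 'k mpoly \<Rightarrow> 'q" where
  "dir_deriv v p = (\<Sum>l<n. \<pi> (partial_deriv l p) * v l)"

lemma dir_deriv_add:
  "p \<in> polys n \<Longrightarrow> q \<in> polys n \<Longrightarrow> dir_deriv v (p + q) = dir_deriv v p + dir_deriv v q"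
  by (simp add: dir_deriv_def partial_deriv_add polys_partial_deriv pi_add distrib_right sum.distrib)

lemma dir_deriv_mult:
  assumes "p \<in> polys n" "q \<in> polys n"
  shows "dir_deriv v (p * q) = dir_deriv v p * \<pi> q + \<pi> p * dir_deriv v q"
proof -
  have "\<pi> (partial_deriv l (p * q)) * v l =
      (\<pi> (partial_deriv l p) * v l) * \<pi> q + \<pi> p * (\<pi> (partial_deriv l q) * v l)" for l
    using assms by (simp add: partial_deriv_mult pi_add pi_mult polys_partial_deriv polys_mult algebra_simps)
  then show ?thesis by (simp add: dir_deriv_def sum.distrib sum_distrib_left sum_distrib_right)
qed

lemma dir_deriv_Const: "dir_deriv v (Const c) = 0"
  by (simp add: dir_deriv_def partial_deriv_Const pi_0)

lemma dir_deriv_0: "dir_deriv v 0 = 0"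
  using dir_deriv_Const[of v 0] by (simp add: Const_0)

lemma dir_deriv_Var: "l < n \<Longrightarrow> dir_deriv v (Var l) = v l"
proof -
  assume l: "l < n"
  have "dir_deriv v (Var l) = (\<Sum>j<n. if j = l then v l else 0)"
    unfolding dir_deriv_def by (intro sum.cong) (auto simp: partial_deriv_Var pi_0 pi_1)
  then show ?thesis using l by simp
qed

lemma dir_deriv_in:
  assumes "field_subring R" "A0 \<subseteq> R" "\<And>l. l < n \<Longrightarrow> v l \<in> R" "p \<in> polys n"
  shows "dir_deriv v p \<in> R"
  unfolding dir_deriv_def
proof (intro field_subring.sum_in[OF assms(1)] field_subring.mult_in[OF assms(1)])
  fix l assume "l \<in> {..<n}"
  then show "v l \<in> R" "\<pi> (partial_deriv l p) \<in> R"
    using assms polys_partial_deriv[OF assms(4)] by blast+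
qed

lemma derivation_chain_rule:
  assumes add: "\<And>a b. a \<in> A0 \<Longrightarrow> b \<in> A0 \<Longrightarrow> D (a + b) = D a + D b"
    and mult: "\<And>a b. a \<in> A0 \<Longrightarrow> b \<in> A0 \<Longrightarrow> D (a * b) = D a * b + a * D b"
    and const: "\<And>c. D (\<kappa> c) = 0" and p: "p \<in> polys n"
  shows "D (\<pi> p) = dir_deriv (\<lambda>l. D (x l)) p"
  using p
proof (induction rule: polys_induct)
  case (add p q)
  then show ?case using assms(1)[of "\<pi> p" "\<pi> q"] by (simp add: pi_add dir_deriv_add)
next
  case (mult p q)
  then show ?case using assms(2)[of "\<pi> p" "\<pi> q"] by (simp add: pi_mult dir_deriv_mult)
qed (simp_all add: const dir_deriv_Const dir_deriv_Var)

lemma f_kernel: "i < m \<Longrightarrow> \<pi> (f i) = 0"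
proof -
  assume "i < m"
  interpret P: cring "poly_ring n :: 'k mpoly ring" by (rule cring_poly_ring)
  have "f i \<in> Idl\<^bsub>poly_ring n\<^esub> (f ` {..<m})"
    using P.genideal_self[of "f ` {..<m}"] f_polys \<open>i < m\<close> by blast
  then show ?thesis using pi_kernel f_polys \<open>i < m\<close> by blast
qed

lemma derivation_kernel:
  assumes "\<And>a b. a \<in> A0 \<Longrightarrow> b \<in> A0 \<Longrightarrow> D (a + b) = D a + D b"
    and "\<And>a b. a \<in> A0 \<Longrightarrow> b \<in> A0 \<Longrightarrow> D (a * b) = D a * b + a * D b"
    and const: "\<And>c. D (\<kappa> c) = 0" and i: "i < m"
  shows "(\<Sum>l<n. J $$ (i, l) * D (x l)) = 0"
proof -
  have "D (\<pi> (f i)) = dir_deriv (\<lambda>l. D (x l)) (f i)"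
    by (rule derivation_chain_rule) (use assms f_polys in auto)
  moreover have "D (\<pi> (f i)) = 0" using f_kernel[OF i] const[of 0] kappa_0 by simp
  ultimately show ?thesis using i by (simp add: dir_deriv_def)
qed

text \<open>This lets the derivative descend to the image of \<pi> modulo \<open>P\<close>. The
  polynomials with \<open>\<pi> p = 0\<close> and derivative in \<open>P\<close> form an ideal,
  because in the product rule for \<open>q * a\<close> the term with \<open>\<pi> a\<close>
  vanishes, and this ideal contains the generators \<open>f i\<close>.\<close>

lemma directional_derivative_kernel:
  assumes "subring_ideal R P" "A0 \<subseteq> R" "\<And>l. l < n \<Longrightarrow> v l \<in> R"
    and Jv: "\<And>i. i < m \<Longrightarrow> (\<Sum>l<n. J $$ (i, l) * v l) \<in> P"
    and p: "p \<in> polys n" "\<pi> p = 0"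
  shows "dir_deriv v p \<in> P"
proof -
  interpret subring_ideal R P by fact
  interpret P: cring "poly_ring n :: 'k mpoly ring" by (rule cring_poly_ring)
  let ?d = "dir_deriv v"
  have d_in: "?d p \<in> R" if "p \<in> polys n" for p
    by (rule dir_deriv_in[OF field_subring_axioms assms(2,3) that])
  let ?I = "{p \<in> polys n. \<pi> p = 0 \<and> ?d p \<in> P}"
  have "ideal ?I (poly_ring n)"
  proof (rule idealI)
    show "ring (poly_ring n :: 'k mpoly ring)" by (rule P.ring_axioms)
    show "subgroup ?I (add_monoid (poly_ring n))"
    proof (rule P.add.subgroupI)
      show "?I \<subseteq> carrier (poly_ring n)" by auto
      have "0 \<in> ?I" by (simp add: polys_0 pi_0 dir_deriv_0 ideal_zero)
      then show "?I \<noteq> {}" by blast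
      show "a \<oplus>\<^bsub>poly_ring n\<^esub> b \<in> ?I" if "a \<in> ?I" "b \<in> ?I" for a b
        using that dir_deriv_add[of a b v] by (simp add: polys_add pi_add ideal_add)
      show "\<ominus>\<^bsub>poly_ring n\<^esub> a \<in> ?I" if a: "a \<in> ?I" for a
      proof -
        have "- a \<in> polys n" "?d a + ?d (- a) = 0"
          using a dir_deriv_add[of a "- a" v] polys_uminus[of a n] by (auto simp: dir_deriv_0)
        then have "- a \<in> ?I" using a ideal_uminus[of "?d a"]
          by (auto simp: pi_uminus add_eq_0_iff)
        moreover have "\<ominus>\<^bsub>poly_ring n\<^esub> a = - a"
          using a \<open>- a \<in> polys n\<close> by (intro P.minus_equality) auto
        ultimately show ?thesis by simp
      qed
    qed
    fix a q :: "'k mpoly" assume a: "a \<in> ?I" and q: "q \<in> polys n"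
    have "\<pi> q \<in> R" using q assms(2) by blast
    then have "?d (q * a) \<in> P"
      using a dir_deriv_mult[OF q, of a v] by (auto intro: ideal_mult)
    then show "q \<otimes>\<^bsub>poly_ring n\<^esub> a \<in> ?I" "a \<otimes>\<^bsub>poly_ring n\<^esub> q \<in> ?I"
      using a q by (auto simp: polys_mult pi_mult mult.commute[of a q])
  qed
  moreover have "f ` {..<m} \<subseteq> ?I" using f_polys f_kernel Jv by (auto simp: dir_deriv_def)
  ultimately have "Idl\<^bsub>poly_ring n\<^esub> (f ` {..<m}) \<subseteq> ?I" by (rule P.genideal_minimal)
  then show ?thesis using p pi_kernel by blast
qed

text \<open>The quotient rule is used on a chosen representation of each element as a fraction.\<close>

lemma derivation_exists:
  assumes "subring_ideal R P" "A0 \<subseteq> R"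
    and frac: "\<And>a. a \<in> R \<Longrightarrow> \<exists>p\<in>polys n. \<exists>s\<in>polys n. \<pi> s \<noteq> 0 \<and> inverse (\<pi> s) \<in> R \<and> a = \<pi> p / \<pi> s"
    and v: "\<And>l. l < n \<Longrightarrow> v l \<in> R"
    and Jv: "\<And>i. i < m \<Longrightarrow> (\<Sum>l<n. J $$ (i, l) * v l) \<in> P"
  shows "\<exists>D. mod_derivation K R P D \<and> (\<forall>l<n. D (x l) - v l \<in> P)"
proof -
  interpret subring_ideal R P by fact
  define d where "d = dir_deriv v"
  have d_in: "d p \<in> R" if "p \<in> polys n" for p
    unfolding d_def by (rule dir_deriv_in[OF field_subring_axioms assms(2) v that])
  note d_add = dir_deriv_add[of _ _ v, folded d_def] and d_mult = dir_deriv_mult[of _ _ v, folded d_def]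
    and d_const = dir_deriv_Const[of v, folded d_def] and d_var = dir_deriv_Var[of _ v, folded d_def]
  define rep where "rep = (\<lambda>a p s. p \<in> polys n \<and> s \<in> polys n \<and> \<pi> s \<noteq> 0 \<and> inverse (\<pi> s) \<in> R \<and> a * \<pi> s = \<pi> p)"
  \<comment> \<open>From \<open>a * \<pi> s = \<pi> p\<close> the product rule gives this
    value.\<close>
  define E where "E = (\<lambda>a p s. (d p - a * d s) * inverse (\<pi> s))"
  have rep_ex: "\<exists>p s. rep a p s" if a: "a \<in> R" for a
    using frac[OF a] unfolding rep_def by force
  \<comment> \<open>For two representations, \<open>p * t - q * s\<close> lies in the kernel of
    \<pi>, so its derivative is in \<open>P\<close>; the inverses of the denominators lie in
    \<open>R\<close>.\<close>
  have E_unique: "E a p s - E a q t \<in> P" if a: "a \<in> R" and p: "rep a p s" and q: "rep a q t" for a p s q t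
  proof -
    have "\<pi> (p * t - q * s) = 0"
    proof -
      have "\<pi> (p * t - q * s) = \<pi> p * \<pi> t - \<pi> q * \<pi> s"
        using p q by (simp add: rep_def pi_diff pi_mult polys_mult)
      also have "\<dots> = a * \<pi> s * \<pi> t - a * \<pi> t * \<pi> s" using p q by (simp add: rep_def)
      finally show ?thesis by simp
    qed
    then have "d (p * t - q * s) \<in> P"
      unfolding d_def using p q
      by (intro directional_derivative_kernel[OF assms(1,2) v Jv]) (auto simp: rep_def polys_diff polys_mult)
    moreover have "d (p * t - q * s) = d (p * t) - d (q * s)"
      using p q d_add[of "p * t - q * s" "q * s"] by (simp add: rep_def polys_diff polys_mult)
    ultimately have "inverse (\<pi> s) * inverse (\<pi> t) * (d (p * t) - d (q * s)) \<in> P"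
      using p q by (auto simp: rep_def intro!: ideal_mult mult_in)
    moreover have "inverse (\<pi> s) * inverse (\<pi> t) * (d (p * t) - d (q * s)) = E a p s - E a q t"
    proof -
      have "d (p * t) - d (q * s) = d p * \<pi> t + (a * \<pi> s) * d t - d q * \<pi> s - (a * \<pi> t) * d s"
        using p q by (simp add: rep_def d_mult)
      then show ?thesis using p q by (simp add: rep_def E_def field_simps)
    qed
    ultimately show ?thesis by simp
  qed
  have rep_add: "rep (a + b) (p * t + q * s) (s * t)" "E (a + b) (p * t + q * s) (s * t) = E a p s + E b q t"
    and rep_mult: "rep (a * b) (p * q) (s * t)" "E (a * b) (p * q) (s * t) = E a p s * b + a * E b q t"
    if p: "rep a p s" and q: "rep b q t" for a b p s q t
  proof -
    have *: "p \<in> polys n" "s \<in> polys n" "q \<in> polys n" "t \<in> polys n" "\<pi> s \<noteq> 0" "\<pi> t \<noteq> 0"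
      "\<pi> p = a * \<pi> s" "\<pi> q = b * \<pi> t" using p q by (auto simp: rep_def)
    have inv: "inverse (\<pi> (s * t)) \<in> R" using p q by (auto simp: rep_def pi_mult intro!: mult_in)
    show "rep (a + b) (p * t + q * s) (s * t)" "rep (a * b) (p * q) (s * t)"
      using * inv by (simp_all add: rep_def polys_add polys_mult pi_add pi_mult algebra_simps)
    show "E (a + b) (p * t + q * s) (s * t) = E a p s + E b q t"
      using * by (simp add: E_def d_add d_mult polys_mult pi_mult) (simp add: field_simps)
    show "E (a * b) (p * q) (s * t) = E a p s * b + a * E b q t"
      using * by (simp add: E_def d_mult pi_mult) (simp add: field_simps)
  qed
  define P1 where "P1 = (\<lambda>a. SOME p. \<exists>s. rep a p s)"
  define S1 where "S1 = (\<lambda>a. SOME s. rep a (P1 a) s)"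
  have rep1: "rep a (P1 a) (S1 a)" if "a \<in> R" for a
    using rep_ex[OF that] unfolding S1_def P1_def by (metis (mono_tags, lifting) someI_ex)
  define D where "D = (\<lambda>a. E a (P1 a) (S1 a))"
  \<comment> \<open>\<open>P1\<close> and \<open>S1\<close> choose arbitrarily, so the exact rules
    for representations hold for \<open>D\<close> only modulo \<open>P\<close>.\<close>
  have D_eq: "D a - E a p s \<in> P" if "rep a p s" "a \<in> R" for a p s
    unfolding D_def using E_unique[OF that(2) rep1[OF that(2)] that(1)] .
  have "mod_derivation K R P D"
    unfolding mod_derivation_def
  proof (intro conjI ballI)
    show "D a \<in> R" if "a \<in> R" for a
      using rep1[OF that] that d_in by (auto simp: D_def E_def rep_def intro!: mult_in diff_in)
    show "D a \<in> P" if a: "a \<in> K" for a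
    proof -
      obtain c where c: "a = \<kappa> c" using a by blast
      have "rep a (Const c) 1" by (simp add: rep_def c polys_Const polys_1 pi_1 one_in)
      then have "D a - E a (Const c) 1 \<in> P" using D_eq a K_sub assms(2) by blast
      moreover have "E a (Const c) 1 = 0" using d_const[of c] d_const[of 1] by (simp add: E_def Const_1)
      ultimately show ?thesis by simp
    qed
    fix a b assume ab: "a \<in> R" "b \<in> R"
    show "D (a + b) - (D a + D b) \<in> P"
      using D_eq[OF rep_add(1)[OF rep1 rep1], OF ab(1) ab(2) add_in[OF ab]]
        rep_add(2)[OF rep1[OF ab(1)] rep1[OF ab(2)]] by (simp add: D_def)
    show "D (a * b) - (D a * b + a * D b) \<in> P"
      using D_eq[OF rep_mult(1)[OF rep1 rep1], OF ab(1) ab(2) mult_in[OF ab]]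
        rep_mult(2)[OF rep1[OF ab(1)] rep1[OF ab(2)]] by (simp add: D_def)
  qed
  moreover have "D (x l) - v l \<in> P" if l: "l < n" for l
  proof -
    have "rep (x l) (Var l) 1" using l by (simp add: rep_def polys_Var polys_1 pi_1 one_in)
    moreover have "x l \<in> R" using x_in[OF l] assms(2) by blast
    ultimately have "D (x l) - E (x l) (Var l) 1 \<in> P" using D_eq by blast
    moreover have "E (x l) (Var l) 1 = v l"
      using d_var[OF l] d_const[of 1] by (simp add: E_def Const_1 pi_1)
    ultimately show ?thesis by simp
  qed
  ultimately show ?thesis by blast
qed

section \<open>The bound for transcendental towers and the Jacobian criterion\<close>

lemma r_le: "r \<le> n"
  by (rule vec_space.rank_le_nc[OF J_carrier])

text \<open>More than n - r derivations have a nontrivial combination that vanishes at the n - r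
  variables outside the columns of a nonzero r-minor. Its values at the variables form a kernel
  vector of \<open>J\<close>, hence vanish, and the combination is zero on the whole field.\<close>

lemma transc_tower_bound:
  assumes "transc_tower K N B"
  shows "N \<le> n - r"
proof (rule ccontr)
  assume N: "\<not> N \<le> n - r"
  interpret U: local_subring UNIV "{0::'q}" by (rule local_subring_UNIV)
  obtain D where D: "\<forall>i<N. field_derivation K (D i)"
    and indep: "\<And>c. (\<forall>b\<in>B. (\<Sum>i<N. c i * D i b) = 0) \<Longrightarrow> (\<forall>i<N. c i = 0)"
    using transc_tower_derivations[OF assms K_subring char_0] by blast
  obtain "is" js where ij: "is \<in> tuples m r" "js \<in> tuples n r" "minor J is js \<noteq> 0"
    using rank_minor_exists[OF J_carrier] by blast
  have dist: "distinct js" using minor_distinct_columns[of "is" js] ij by (simp add: tuples_def)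
  have "card ({..<n} - set js) = n - r"
    using ij dist by (simp add: card_Diff_subset tuples_def distinct_card)
  then obtain ls where ls: "set ls = {..<n} - set js" "length ls = n - r"
    by (metis distinct_card finite_Diff finite_distinct_list finite_lessThan)
  obtain c where c: "\<exists>i<N. c i \<noteq> 0" "\<forall>b<n - r. (\<Sum>i<N. D i (x (ls ! b)) * c i) = 0"
    using U.homogeneous_solution[of "{..<N}" "n - r" "\<lambda>b i. D i (x (ls ! b))"] N by auto
  define E where "E = (\<lambda>y. \<Sum>i<N. c i * D i y)"
  have E_add: "E (a + b) = E a + E b" and E_mult: "E (a * b) = E a * b + a * E b" and E_K: "E (\<kappa> k) = 0"
    for a b k
    using D by (auto simp: E_def field_derivation_def sum.distrib sum_distrib_left sum_distrib_right algebra_simps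
        intro!: sum.neutral)
  have "E (x l) = 0" if l: "l < n" for l
  proof (rule minor_zero_vector[OF ij, of "\<lambda>l. E (x l)"])
    show "(\<Sum>l<n. J $$ (is ! a, l) * E (x l)) = 0" if "a < r" for a
      using derivation_kernel[of E, OF E_add E_mult E_K] tuplesD(2)[OF ij(1) that] by blast
    show "E (x l) = 0" if "l < n" "l \<notin> set js" for l
    proof -
      have "l \<in> set ls" using that ls by simp
      then obtain b where "b < n - r" "ls ! b = l" using ls(2) by (metis in_set_conv_nth)
      then show ?thesis using c(2) by (auto simp: E_def mult.commute)
    qed
  qed (rule l)
  then have E0: "E (\<pi> p) = 0" if "p \<in> polys n" for p
    using derivation_chain_rule[of E, OF E_add E_mult E_K that] by (simp add: dir_deriv_def)
  have "E y = 0" for y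
  proof -
    obtain a b where ab: "a \<in> polys n" "b \<in> polys n" "\<pi> b \<noteq> 0" "y = \<pi> a / \<pi> b" using fraction by blast
    then have "E (\<pi> a) = E y * \<pi> b + y * E (\<pi> b)" using E_mult[of y "\<pi> b"] by simp
    then show ?thesis using E0 ab by simp
  qed
  then show False using indep[of c] c(1) unfolding E_def by blast
qed

text \<open>\<open>X\<close> and \<open>p\<close> carry the regularity: as many generators of
  \<open>P\<close> as strict inclusions in a chain of primes. A minor outside \<open>P\<close> of
  maximal size \<open>k\<close> provides the derivations: all minors of size \<open>Suc k\<close>
  lie in \<open>P\<close>, so the vectors \<open>jac_vec J is (js @ [u])\<close> with
  \<open>u\<close> outside \<open>js\<close> are in the kernel modulo \<open>P\<close>.\<close>

lemma jacobian_criterion: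
  assumes "local_subring R P" "A0 \<subseteq> R"
    and frac: "\<And>a. a \<in> R \<Longrightarrow> \<exists>p\<in>polys n. \<exists>s\<in>polys n. \<pi> s \<noteq> 0 \<and> inverse (\<pi> s) \<in> R \<and> a = \<pi> p / \<pi> s"
    and X: "finite X" "X \<subseteq> P"
    and gen: "\<And>a. a \<in> P \<Longrightarrow> \<exists>c. (\<forall>x\<in>X. c x \<in> R) \<and> a = (\<Sum>x\<in>X. c x * x)"
    and chain: "\<And>i. i \<le> card X \<Longrightarrow> subring_prime R (p i)" "\<And>i. i < card X \<Longrightarrow> p i \<subset> p (Suc i)"
      "p (card X) \<subseteq> P"
  shows "\<exists>is\<in>tuples m r. \<exists>js\<in>tuples n r. minor J is js \<notin> P"
proof -
  interpret local_subring R P by fact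
  define Q where "Q = (\<lambda>k. \<exists>is\<in>tuples m k. \<exists>js\<in>tuples n k. minor J is js \<notin> P)"
  have "Q 0" using one_notin by (auto simp: Q_def tuples_def minor_def)
  moreover have bound: "\<forall>k. Q k \<longrightarrow> k \<le> r"
    unfolding Q_def using minor_le_rank[OF J_carrier] ideal_zero by metis
  ultimately obtain k where k: "Q k" "\<And>k'. Q k' \<Longrightarrow> k' \<le> k"
    using GreatestI_ex_nat[of Q r] Greatest_le_nat[of Q _ r] by blast
  then obtain "is" js where ij: "is \<in> tuples m k" "js \<in> tuples n k" "minor J is js \<notin> P"
    unfolding Q_def by blast
  have len: "length is = length js" "length js = k" using ij by (auto simp: tuples_def)
  have dist: "distinct js" using minor_distinct_columns[OF len(1)] ij(3) ideal_zero by metis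
  let ?U = "{..<n} - set js"
  let ?v = "\<lambda>u. jac_vec J is (js @ [u])"
  have ju: "js @ [u] \<in> tuples n (Suc k)" if "u \<in> ?U" for u using snoc_tuples[OF ij(2)] that by auto
  have "\<exists>D. mod_derivation K R P D \<and> (\<forall>l<n. D (x l) - ?v u l \<in> P)" if u: "u \<in> ?U" for u
  proof (rule derivation_exists[OF subring_ideal_axioms assms(2) frac])
    show "?v u l \<in> R" for l using jac_vec_in[OF ij(1) ju[OF u]] assms(2) by blast
    show "(\<Sum>l<n. J $$ (i, l) * ?v u l) \<in> P" if i: "i < m" for i
    proof -
      have "\<not> Q (Suc k)" using k(2) by fastforce
      then have "minor J (is @ [i]) (js @ [u]) \<in> P"
        unfolding Q_def using ju[OF u] snoc_tuples[OF ij(1) i] by blast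
      moreover have "(\<Sum>l<n. J $$ (i, l) * ?v u l) = minor J (is @ [i]) (js @ [u])"
        using ju[OF u] len by (intro jac_vec_row) (auto simp: tuples_def)
      ultimately show ?thesis by simp
    qed
  qed
  then have "\<forall>u\<in>?U. \<exists>D. mod_derivation K R P D \<and> (\<forall>l<n. D (x l) - ?v u l \<in> P)" by blast
  then obtain D where D: "\<forall>u\<in>?U. mod_derivation K R P (D u) \<and> (\<forall>l<n. D u (x l) - ?v u l \<in> P)"
    by (rule bchoice[THEN exE])
  have "card ?U \<le> n - r"
  proof (rule derivation_count[where D = D and K = K and X = X and p = p])
    show "K \<subseteq> R" using K_sub assms(2) by blast
    show "K \<inter> P \<subseteq> {0}"
    proof
      fix a assume a: "a \<in> K \<inter> P"
      then obtain c where c: "a = \<kappa> c" by blast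
      have "\<kappa> (inverse c) \<in> R" using K_sub assms(2) by blast
      moreover have "\<kappa> c \<in> P" using a c by simp
      ultimately have "\<kappa> (inverse c) * \<kappa> c \<in> P" by (rule ideal_mult)
      then have "c = 0" using kappa_inverse[of c] one_notin by metis
      then show "a \<in> {0}" using c kappa_0 by simp
    qed
    show "mod_derivation K R P (D u)" if "u \<in> ?U" for u using D that by blast
    fix c w assume c: "\<And>u. u \<in> ?U \<Longrightarrow> c u \<in> R" "\<And>a. a \<in> R \<Longrightarrow> (\<Sum>u\<in>?U. c u * D u a) \<in> P"
      and w: "w \<in> ?U"
    \<comment> \<open>Evaluation at \<open>x w\<close> isolates \<open>c w\<close>, multiplied by a
      minor that is a unit of \<open>R\<close>.\<close>
    have "(\<Sum>u\<in>?U. c u * (D u (x w) - ?v u w)) \<in> P"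
      using D c w by (intro ideal_sum ideal_mult) auto
    moreover have "(\<Sum>u\<in>?U. c u * D u (x w)) \<in> P" using c(2) x_in w assms(2) by blast
    ultimately have "(\<Sum>u\<in>?U. c u * D u (x w)) - (\<Sum>u\<in>?U. c u * (D u (x w) - ?v u w)) \<in> P"
      using ideal_diff by blast
    then have "(\<Sum>u\<in>?U. c u * ?v u w) \<in> P" by (simp add: sum_subtractf algebra_simps)
    moreover have "(\<Sum>u\<in>?U. c u * ?v u w) = (\<Sum>u\<in>?U. if u = w then c u * minor J is js else 0)"
      using w by (intro sum.cong refl) (auto simp: jac_vec_snoc[OF len(1)])
    ultimately have "minor J is js * c w \<in> P" using w by (simp add: mult.commute)
    then show "c w \<in> P" using unit_cancel ij minor_in[OF ij(1,2)] assms(2) by blast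
  qed (use char_0 K_subring transc_tower_bound X gen chain in \<open>auto simp: transc_tower_bound\<close>)
  moreover have "card ?U = n - k"
    using ij dist by (simp add: card_Diff_subset tuples_def distinct_card)
  ultimately have "r \<le> k" using r_le by linarith
  then have "k = r" using bound k by (meson le_antisym)
  then show ?thesis using ij by blast
qed

end

section \<open>Ideals, localizations and regularity\<close>

lemma (in field_subring) ring_on_cring: "cring (ring_on R)"
  by (rule cring_ring_on) (auto intro: closed_intros)

lemma ring_on_simps [simp]:
  "add (ring_on R) = (+)" "monoid.mult (ring_on R) = (*)" "one (ring_on R) = 1" "zero (ring_on R) = 0"
  "carrier (ring_on R) = R"
  by (simp_all add: class_ring_simps)

lemma (in field_subring) ideal_iff: "ideal P (ring_on R) \<longleftrightarrow> subring_ideal R P"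
proof
  assume "ideal P (ring_on R)"
  then interpret ideal P "ring_on R" .
  show "subring_ideal R P"
  proof
    show "P \<subseteq> R" using a_subset by simp
    show "0 \<in> P" using additive_subgroup.zero_closed[OF is_additive_subgroup] by simp
    show "a + b \<in> P" if "a \<in> P" "b \<in> P" for a b
      using additive_subgroup.a_closed[OF is_additive_subgroup that] by simp
    show "a * b \<in> P" if "a \<in> R" "b \<in> P" for a b using I_l_closed[of b a] that by simp
  qed
next
  assume "subring_ideal R P"
  then interpret P: subring_ideal R P .
  interpret cring "ring_on R" by (rule ring_on_cring)
  show "ideal P (ring_on R)"
  proof (rule idealI)
    show "subgroup P (add_monoid (ring_on R))"
    proof (rule add.subgroupI)
      show "P \<noteq> {}" using P.ideal_zero by blast
      show "\<ominus>\<^bsub>ring_on R\<^esub> a \<in> P" if a: "a \<in> P" for a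
      proof -
        have "\<ominus>\<^bsub>ring_on R\<^esub> a = - a"
          using a P.ideal_sub uminus_in by (intro minus_equality) auto
        then show ?thesis using P.ideal_uminus a by simp
      qed
    qed (use P.ideal_sub P.ideal_add in auto)
  qed (use P.ideal_mult P.ideal_mult2 ring_axioms in auto)
qed

lemma (in field_subring) primeideal_iff: "primeideal P (ring_on R) \<longleftrightarrow> subring_prime R P"
proof
  assume "primeideal P (ring_on R)"
  then interpret primeideal P "ring_on R" .
  interpret P: subring_ideal R P using ideal_iff is_ideal by blast
  show "subring_prime R P"
  proof
    show "1 \<notin> P"
    proof
      assume "1 \<in> P"
      then have "R \<subseteq> P" using P.ideal_mult[of _ 1] by force
      then show False using I_notcarr P.ideal_sub by auto
    qed
    show "a \<in> P \<or> b \<in> P" if "a \<in> R" "b \<in> R" "a * b \<in> P" for a b using I_prime[of a b] that by simp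
  qed
next
  assume "subring_prime R P"
  then interpret P: subring_prime R P .
  show "primeideal P (ring_on R)"
  proof (rule primeidealI)
    show "ideal P (ring_on R)" using ideal_iff P.subring_ideal_axioms by blast
    show "cring (ring_on R)" by (rule ring_on_cring)
    show "carrier (ring_on R) \<noteq> P" using one_in P.one_notin by auto
  qed (use P.prime in auto)
qed

section \<open>Localizations inside the field, generated ideals and prime ideals\<close>

lemma fractionsI: "a \<in> C \<Longrightarrow> s \<in> T \<Longrightarrow> a / s \<in> fractions C T"
  unfolding fractions_def by blast

lemma fractionsE:
  assumes "y \<in> fractions C T"
  obtains a s where "a \<in> C" "s \<in> T" "y = a / s"
  using assms unfolding fractions_def by blast

lemma fractions_subring:
  assumes "field_subring C" "T \<subseteq> C" "1 \<in> T" "0 \<notin> T" "\<And>s t. s \<in> T \<Longrightarrow> t \<in> T \<Longrightarrow> s * t \<in> T"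
  shows "field_subring (fractions C T)"
proof -
  interpret C: field_subring C by fact
  show ?thesis
  proof
    have "1 / 1 \<in> fractions C T" unfolding fractions_def using assms C.one_in by blast
    then show "1 \<in> fractions C T" by simp
    fix y z assume "y \<in> fractions C T" "z \<in> fractions C T"
    then obtain a s b t where *: "a \<in> C" "s \<in> T" "y = a / s" "b \<in> C" "t \<in> T" "z = b / t"
      unfolding fractions_def by blast
    have st: "s * t \<in> T" "s \<noteq> 0" "t \<noteq> 0" "s \<in> C" "t \<in> C" using * assms by auto
    have "y + z = (a * t + b * s) / (s * t)" "y * z = (a * b) / (s * t)" "- y = (- a) / s"
      using * st by (simp_all add: field_simps)
    moreover have "a * t + b * s \<in> C" "a * b \<in> C" "- a \<in> C" using * st by (auto intro: C.closed_intros)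
    ultimately show "y + z \<in> fractions C T" "y * z \<in> fractions C T" "- y \<in> fractions C T"
      unfolding fractions_def using st * by blast+
  qed
qed

lemma fractions_superset:
  assumes "1 \<in> T"
  shows "C \<subseteq> fractions C T"
proof
  fix a assume "a \<in> C"
  then have "a / 1 \<in> fractions C T" unfolding fractions_def using assms by blast
  then show "a \<in> fractions C T" by simp
qed

lemma (in subring_prime) local_subring_fractions:
  "local_subring (fractions R (R - P)) {a / s | a s. a \<in> P \<and> s \<in> R - P}"
proof -
  let ?L = "fractions R (R - P)" and ?M = "{a / s | a s. a \<in> P \<and> s \<in> R - P}"
  have st: "s * t \<in> R - P" if "s \<in> R - P" "t \<in> R - P" for s t using that prime mult_in by auto
  have L: "field_subring ?L"
    using st one_in one_notin ideal_zero by (intro fractions_subring field_subring_axioms) auto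
  interpret L: field_subring ?L by (rule L)
  show ?thesis
  proof
    show "?M \<subseteq> ?L" unfolding fractions_def using ideal_sub by blast
    have "0 / 1 \<in> ?M" using ideal_zero one_in one_notin by blast
    then show "0 \<in> ?M" by simp
    show "y + z \<in> ?M" if yz: "y \<in> ?M" "z \<in> ?M" for y z
    proof -
      obtain a s b t where *: "a \<in> P" "s \<in> R - P" "y = a / s" "b \<in> P" "t \<in> R - P" "z = b / t"
        using yz by blast
      then have "s \<noteq> 0" "t \<noteq> 0" using ideal_zero by auto
      then have "y + z = (a * t + b * s) / (s * t)" using * by (simp add: field_simps)
      moreover have "a * t + b * s \<in> P" using * by (auto intro!: ideal_intros)
      ultimately show ?thesis using st * by blast
    qed
    show "y * z \<in> ?M" if yz: "y \<in> ?L" "z \<in> ?M" for y z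
    proof -
      obtain a s where *: "a \<in> R" "s \<in> R - P" "y = a / s" using yz unfolding fractions_def by blast
      obtain b t where **: "b \<in> P" "t \<in> R - P" "z = b / t" using yz by blast
      have "y * z = (a * b) / (s * t)" using * ** by simp
      moreover have "a * b \<in> P" using * ** ideal_mult by blast
      ultimately show ?thesis using st * ** by blast
    qed
    show "1 \<notin> ?M"
    proof
      assume "1 \<in> ?M"
      then obtain a s where "a \<in> P" "s \<in> R - P" "1 = a / s" by blast
      then show False by (metis DiffD2 div_by_0 eq_divide_eq_1 divide_eq_1_iff)
    qed
    show "inverse y \<in> ?L" if y: "y \<in> ?L" "y \<notin> ?M" for y
    proof -
      obtain a s where *: "a \<in> R" "s \<in> R - P" "y = a / s" using y unfolding fractions_def by blast
      then have "a \<in> R - P" using y by blast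
      moreover have "inverse y = s / a" using * by simp
      ultimately show ?thesis unfolding fractions_def using * by blast
    qed
  qed
qed

text \<open>An explicit form of a finitely generated ideal, for the Jacobian ideal and for the
  maximal ideal of a regular local ring.\<close>

lemma (in field_subring) combinations_ideal:
  assumes "finite U" "\<And>u. u \<in> U \<Longrightarrow> h u \<in> R"
  shows "subring_ideal R {\<Sum>u\<in>U. c u * h u | c. \<forall>u\<in>U. c u \<in> R}"
    and "h ` U \<subseteq> {\<Sum>u\<in>U. c u * h u | c. \<forall>u\<in>U. c u \<in> R}"
proof -
  let ?G = "{\<Sum>u\<in>U. c u * h u | c. \<forall>u\<in>U. c u \<in> R}"
  show "subring_ideal R ?G"
  proof
    show "?G \<subseteq> R" using assms by (auto intro!: sum_in mult_in)
    show "0 \<in> ?G" by (auto intro!: exI[of _ "\<lambda>_. 0"] simp: zero_in)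
    show "a + b \<in> ?G" if ab: "a \<in> ?G" "b \<in> ?G" for a b
    proof -
      obtain c d where "\<forall>u\<in>U. c u \<in> R" "a = (\<Sum>u\<in>U. c u * h u)" "\<forall>u\<in>U. d u \<in> R" "b = (\<Sum>u\<in>U. d u * h u)"
        using ab by blast
      then have "a + b = (\<Sum>u\<in>U. (c u + d u) * h u) \<and> (\<forall>u\<in>U. c u + d u \<in> R)"
        by (simp add: sum.distrib distrib_right add_in)
      then show ?thesis by (intro CollectI exI[of _ "\<lambda>u. c u + d u"])
    qed
    show "a * b \<in> ?G" if ab: "a \<in> R" "b \<in> ?G" for a b
    proof -
      obtain c where "\<forall>u\<in>U. c u \<in> R" "b = (\<Sum>u\<in>U. c u * h u)" using ab by blast
      then have "a * b = (\<Sum>u\<in>U. (a * c u) * h u) \<and> (\<forall>u\<in>U. a * c u \<in> R)"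
        using ab by (simp add: sum_distrib_left mult_ac mult_in)
      then show ?thesis by (intro CollectI exI[of _ "\<lambda>u. a * c u"])
    qed
  qed
  show "h ` U \<subseteq> ?G"
  proof
    fix y assume "y \<in> h ` U"
    then obtain w where w: "w \<in> U" "y = h w" by blast
    have "(\<Sum>u\<in>U. (if u = w then 1 else 0) * h u) = (\<Sum>u\<in>U. if u = w then y else 0)"
      using w by (intro sum.cong) auto
    then have "y = (\<Sum>u\<in>U. (if u = w then 1 else 0) * h u) \<and> (\<forall>u\<in>U. (if u = w then 1 else 0) \<in> R)"
      using w assms(1) zero_in one_in by simp
    then show "y \<in> ?G" by (intro CollectI exI[of _ "\<lambda>u. if u = w then 1 else 0"])
  qed
qed

text \<open>Zorn's lemma yields an ideal maximal among those that contain \<open>P\<close> and avoid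
  1; adjoining \<open>a\<close> to it shows that it is prime.\<close>

lemma (in subring_ideal) exists_prime_superset:
  assumes "1 \<notin> P"
  shows "\<exists>M. subring_prime R M \<and> P \<subseteq> M"
proof -
  let ?S = "{I. subring_ideal R I \<and> P \<subseteq> I \<and> 1 \<notin> I}"
  have "\<exists>M\<in>?S. \<forall>X\<in>?S. M \<subseteq> X \<longrightarrow> X = M"
  proof (rule subset_Zorn_nonempty)
    show "?S \<noteq> {}" using assms subring_ideal_axioms by auto
    fix \<C> assume ne: "\<C> \<noteq> {}" and "subset.chain ?S \<C>"
    then have C: "\<And>H. H \<in> \<C> \<Longrightarrow> subring_ideal R H \<and> P \<subseteq> H \<and> 1 \<notin> H"
      and lin: "\<And>H H'. H \<in> \<C> \<Longrightarrow> H' \<in> \<C> \<Longrightarrow> H \<subseteq> H' \<or> H' \<subseteq> H"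
      by (auto simp: subset_chain_def)
    have "subring_ideal R (\<Union>\<C>)"
    proof
      show "\<Union>\<C> \<subseteq> R" using C subring_ideal.ideal_sub by blast
      show "0 \<in> \<Union>\<C>" using C ne subring_ideal.ideal_zero by blast
      show "a + b \<in> \<Union>\<C>" if ab: "a \<in> \<Union>\<C>" "b \<in> \<Union>\<C>" for a b
      proof -
        obtain H where "H \<in> \<C>" "a \<in> H" "b \<in> H" using ab lin by (meson UnionE subsetD)
        then show ?thesis using C subring_ideal.ideal_add by blast
      qed
      show "a * b \<in> \<Union>\<C>" if "a \<in> R" "b \<in> \<Union>\<C>" for a b
        using that C subring_ideal.ideal_mult by blast
    qed
    then show "\<Union>\<C> \<in> ?S" using ne C by blast
  qed
  then obtain M where M0: "M \<in> ?S" and maxM: "\<forall>X\<in>?S. M \<subseteq> X \<longrightarrow> X = M" by (rule bexE)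
  then have M: "subring_ideal R M" "P \<subseteq> M" "1 \<notin> M" by simp_all
  have max: "X = M" if "subring_ideal R X" "M \<subseteq> X" "1 \<notin> X" for X
    using maxM that M(2) by (metis (mono_tags, lifting) mem_Collect_eq order_trans)
  interpret M: subring_ideal R M by fact
  have "subring_prime R M"
  proof
    show "1 \<notin> M" by fact
    show "a \<in> M \<or> b \<in> M" if ab: "a \<in> R" "b \<in> R" "a * b \<in> M" for a b
    proof (rule ccontr)
      assume nin: "\<not> (a \<in> M \<or> b \<in> M)"
      let ?X = "{u + a * c | u c. u \<in> M \<and> c \<in> R}"
      have mem: "u + a * c \<in> ?X" if "u \<in> M" "c \<in> R" for u c using that by blast
      have "subring_ideal R ?X"
      proof
        show "?X \<subseteq> R" using M.ideal_sub ab by (auto intro!: closed_intros)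
        show "0 \<in> ?X" using mem[OF M.ideal_zero zero_in] by simp
        show "y + z \<in> ?X" if yz: "y \<in> ?X" "z \<in> ?X" for y z
        proof -
          obtain u c w d where *: "u \<in> M" "c \<in> R" "y = u + a * c" "w \<in> M" "d \<in> R" "z = w + a * d"
            using yz by blast
          have eq: "y + z = (u + w) + a * (c + d)" using * by (simp add: algebra_simps)
          show ?thesis unfolding eq by (rule mem) (use * M.ideal_add add_in in blast)+
        qed
        show "y * z \<in> ?X" if yz: "y \<in> R" "z \<in> ?X" for y z
        proof -
          obtain u c where *: "u \<in> M" "c \<in> R" "z = u + a * c" using yz by blast
          have eq: "y * z = y * u + a * (y * c)" using * by (simp add: algebra_simps)
          show ?thesis unfolding eq by (rule mem) (use * yz M.ideal_mult mult_in in blast)+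
        qed
      qed
      moreover have "M \<subseteq> ?X"
      proof
        fix u assume "u \<in> M"
        then show "u \<in> ?X" using mem[of u 0] zero_in by simp
      qed
      moreover have "a \<in> ?X" using mem[of 0 1] M.ideal_zero one_in by simp
      ultimately have "1 \<in> ?X" using max nin by blast
      then obtain u c where uc: "u \<in> M" "c \<in> R" "1 = u + a * c" by blast
      \<comment> \<open>The equation \<open>1 = u + a * c\<close> multiplied by
        \<open>b\<close>.\<close>
      have "b = u * b + c * (a * b)" using uc(3) by (metis mult.assoc mult.commute mult_1 distrib_right)
      moreover have "u * b + c * (a * b) \<in> M" using uc ab M.ideal_mult M.ideal_mult2 M.ideal_add by blast
      ultimately show False using nin by simp
    qed
  qed
  then show ?thesis using M by blast
qed

text \<open>The chain of primes exists because the supremum defining a finite dimension is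
  attained.\<close>

lemma krull_dim_chain:
  assumes "enat d = krull_dim A" "primeideal P A"
  shows "\<exists>p :: nat \<Rightarrow> 'a set. (\<forall>i \<le> d. primeideal (p i) A) \<and> (\<forall>i < d. p i \<subset> p (Suc i))"
proof -
  define S where "S = {enat k | k. \<exists>p :: nat \<Rightarrow> 'a set.
            (\<forall>i \<le> k. primeideal (p i) A) \<and> (\<forall>i < k. p i \<subset> p (Suc i))}"
  have Sup: "Sup S = enat d" using assms(1) by (simp add: krull_dim_def S_def)
  \<comment> \<open>The supremum of the empty set is 0 too, so the given prime is needed for a chain
    of length 0.\<close>
  have "enat 0 \<in> S" unfolding S_def using assms(2) by (auto intro!: exI[of _ 0] exI[of _ "\<lambda>_. P"])
  then have ne: "S \<noteq> {}" by blast
  \<comment> \<open>An infinite set of extended naturals has supremum \<infinity>, and a nonempty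
    finite set attains its supremum.\<close>
  have fin: "finite S" using Sup ne by (simp add: Sup_enat_def split: if_splits)
  then have "Sup S \<in> S" using Max_in[OF fin ne] ne by (simp add: Sup_enat_def)
  then show ?thesis unfolding Sup by (auto simp: S_def)
qed

text \<open>Elements outside \<open>P\<close> are units, so every proper ideal lies in
  \<open>P\<close>. Hence the maximal ideal generated by \<open>X\<close> is \<open>P\<close>, and
  the chain, which has one strict inclusion for each element of \<open>X\<close>, ends inside
  \<open>P\<close>.\<close>

lemma (in local_subring) regular_local_generators:
  assumes "regular_local_ring (ring_on R)"
  shows "\<exists>X p. finite X \<and> X \<subseteq> P \<and> (\<forall>a\<in>P. \<exists>c. (\<forall>x\<in>X. c x \<in> R) \<and> a = (\<Sum>x\<in>X. c x * x)) \<and>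
    (\<forall>i \<le> card X. subring_prime R (p i)) \<and> (\<forall>i < card X. p i \<subset> p (Suc i)) \<and> p (card X) \<subseteq> P"
proof -
  interpret ring: cring "ring_on R" by (rule ring_on_cring)
  obtain X where X: "X \<subseteq> R" "finite X" "enat (card X) = krull_dim (ring_on R)"
      "maximalideal (Idl\<^bsub>ring_on R\<^esub> X) (ring_on R)"
    using assms unfolding regular_local_ring_def by auto
  have proper: "I \<subseteq> P" if I: "subring_ideal R I" "1 \<notin> I" for I
  proof
    interpret I: subring_ideal R I by fact
    fix a assume a: "a \<in> I"
    show "a \<in> P"
    proof (rule ccontr)
      assume "a \<notin> P"
      moreover have "a \<in> R" using a I.ideal_sub by blast
      ultimately have "inverse a * a \<in> I" "a \<noteq> 0" using inverse_in I.ideal_mult a ideal_zero by auto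
      then show False using I by simp
    qed
  qed
  have X_Idl: "X \<subseteq> Idl\<^bsub>ring_on R\<^esub> X" using ring.genideal_self[of X] X by simp
  interpret M: maximalideal "Idl\<^bsub>ring_on R\<^esub> X" "ring_on R" by fact
  have "ideal (Idl\<^bsub>ring_on R\<^esub> X) (ring_on R)" by (rule M.is_ideal)
  then have Idl: "subring_ideal R (Idl\<^bsub>ring_on R\<^esub> X)" using ideal_iff by blast
  have "1 \<notin> Idl\<^bsub>ring_on R\<^esub> X"
  proof
    assume "1 \<in> Idl\<^bsub>ring_on R\<^esub> X"
    then have "R \<subseteq> Idl\<^bsub>ring_on R\<^esub> X" using subring_ideal.ideal_mult[OF Idl, of _ 1] by force
    then show False using M.I_notcarr subring_ideal.ideal_sub[OF Idl] by auto
  qed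
  then have sub: "Idl\<^bsub>ring_on R\<^esub> X \<subseteq> P" using proper Idl by blast
  have "P = Idl\<^bsub>ring_on R\<^esub> X \<or> P = carrier (ring_on R)"
    using sub ideal_sub ideal_iff subring_ideal_axioms by (intro M.I_maximal) auto
  then have P: "P = Idl\<^bsub>ring_on R\<^esub> X" using one_in one_notin by auto
  have "Idl\<^bsub>ring_on R\<^esub> X \<subseteq> {\<Sum>x\<in>X. c x * x | c. \<forall>x\<in>X. c x \<in> R}"
    using combinations_ideal[of X "\<lambda>x. x"] X ideal_iff by (intro ring.genideal_minimal) auto
  then have gen: "\<forall>a\<in>P. \<exists>c. (\<forall>x\<in>X. c x \<in> R) \<and> a = (\<Sum>x\<in>X. c x * x)" using P by blast
  have "primeideal P (ring_on R)" using primeideal_iff subring_prime_axioms by blast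
  from krull_dim_chain[OF X(3) this] obtain p where
    p: "\<forall>i \<le> card X. primeideal (p i) (ring_on R)" "\<forall>i < card X. p i \<subset> p (Suc i)" by blast
  then have prime: "\<forall>i \<le> card X. subring_prime R (p i)" using primeideal_iff by blast
  then have "p (card X) \<subseteq> P"
    using proper subring_prime.axioms(1) subring_prime.one_notin by blast
  then show ?thesis using X(2) X_Idl P gen prime p(2) by blast
qed

section \<open>The Jacobian ideal of a regular localization\<close>

lemma minor_permute_rows:
  assumes "p permutes {..<length is}" "length is = length js"
  shows "minor J (permute_list p is) js = signof p * minor J is js"
proof -
  let ?k = "length js"
  let ?A = "mat ?k ?k (\<lambda>(a, b). J $$ (is ! a, js ! b))"
  have p: "p permutes {0..<?k}" using assms by (simp add: lessThan_atLeast0)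
  have "det (mat ?k ?k (\<lambda>(a, b). ?A $$ (p a, b))) = signof p * det ?A"
    by (rule det_permute_rows[OF _ p]) simp
  moreover have "mat ?k ?k (\<lambda>(a, b). ?A $$ (p a, b)) =
      mat ?k ?k (\<lambda>(a, b). J $$ (permute_list p is ! a, js ! b))"
    using permutes_in_image[OF p] assms by (intro eq_matI) (auto simp: permute_list_nth)
  ultimately show ?thesis using assms by (simp add: minor_def)
qed

lemma minor_transpose:
  assumes "length is = length js" "set is \<subseteq> {..<dim_row J}" "set js \<subseteq> {..<dim_col J}"
  shows "minor (transpose_mat J) js is = minor J is js"
proof -
  let ?k = "length js"
  let ?A = "mat ?k ?k (\<lambda>(a, b). J $$ (is ! a, js ! b))"
  have "is ! a < dim_row J" "js ! a < dim_col J" if "a < ?k" for a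
  proof -
    have "is ! a \<in> set is" "js ! a \<in> set js" using that assms(1) by auto
    then show "is ! a < dim_row J" "js ! a < dim_col J" using assms by auto
  qed
  then have "mat ?k ?k (\<lambda>(a, b). transpose_mat J $$ (js ! a, is ! b)) = transpose_mat ?A"
    by (intro eq_matI) auto
  then show ?thesis using assms det_transpose[of ?A ?k] by (simp add: minor_def)
qed

lemma minor_sort_rows:
  assumes "length is = length js"
  shows "minor J (sort is) js = minor J is js \<or> minor J (sort is) js = - minor J is js"
proof -
  obtain p where p: "p permutes {..<length is}" "permute_list p is = sort is"
    using mset_eq_permutation[of "sort is" "is"] by auto
  then have "minor J (sort is) js = signof p * minor J is js" using minor_permute_rows assms by metis
  then show ?thesis by (auto simp: sign_def)
qed

lemma minor_sort:
  assumes "is \<in> tuples (dim_row J) k" "js \<in> tuples (dim_col J) k"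
  shows "minor J (sort is) (sort js) = minor J is js \<or> minor J (sort is) (sort js) = - minor J is js"
proof -
  have len: "length is = length js" using assms by (auto simp: tuples_def)
  have "minor J (sort is) (sort js) = minor (transpose_mat J) (sort js) (sort is)"
    using assms by (intro minor_transpose[symmetric]) (auto simp: tuples_def)
  moreover have "minor J (sort is) js = minor (transpose_mat J) js (sort is)"
    using assms by (intro minor_transpose[symmetric]) (auto simp: tuples_def)
  ultimately show ?thesis
    using minor_sort_rows[OF len, of J] minor_sort_rows[of js "sort is" "transpose_mat J"] len
    by auto
qed

text \<open>The sign from sorting does not affect nonvanishing, and a nonzero minor has no repeated
  row or column, so the sorted tuples are strictly increasing.\<close>

lemma minor_sort_inc:
  fixes J :: "'q::field mat"
  assumes ij: "is \<in> tuples (dim_row J) k" "js \<in> tuples (dim_col J) k" "minor J is js \<noteq> 0"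
  shows "sort is \<in> nonsing_rows J k" "sort js \<in> nonsing_cols J k"
proof -
  have len: "length is = length js" using assms by (auto simp: tuples_def)
  have "distinct js" using minor_distinct_columns[OF len ij(3)] .
  have "minor (transpose_mat J) js is \<noteq> 0"
    using minor_transpose[OF len, of J] ij by (auto simp: tuples_def)
  then have "distinct is" using minor_distinct_columns[of js "is"] len by simp
  have m: "minor J (sort is) (sort js) \<noteq> 0" using minor_sort[OF ij(1,2)] ij(3) by auto
  have "sort is \<in> inc_tuples (dim_row J) k" "sort js \<in> inc_tuples (dim_col J) k"
    using ij \<open>distinct js\<close> \<open>distinct is\<close> by (auto simp: inc_tuples_def tuples_def strict_sorted_iff)
  then show "sort is \<in> nonsing_rows J k" "sort js \<in> nonsing_cols J k"
    using m by (auto simp: nonsing_rows_def nonsing_cols_def inc_tuples_def)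
qed

lemma finite_tuples: "finite (tuples N k)"
  using finite_lists_length_eq[of "{..<N}" k] by (simp add: tuples_def conj_commute)

section \<open>The localization of the affine domain and its Jacobian ideal\<close>

locale affine_localization = affine_image +
  fixes T
  assumes T_sub: "T \<subseteq> A0" and T_1: "1 \<in> T" and T_0: "0 \<notin> T"
    and T_mult: "s \<in> T \<Longrightarrow> t \<in> T \<Longrightarrow> s * t \<in> T"
begin

abbreviation "C \<equiv> fractions A0 T"
abbreviation "II \<equiv> nonsing_rows J r"
abbreviation "JJ \<equiv> nonsing_cols J r"

lemma C_subring: "field_subring C"
  by (rule fractions_subring[OF A0_subring T_sub T_1 T_0 T_mult])

lemma A0_sub_C: "A0 \<subseteq> C"
  by (rule fractions_superset[OF T_1])

lemma C_fraction:
  assumes "a \<in> C"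
  obtains p s where "p \<in> polys n" "s \<in> polys n" "\<pi> s \<in> T" "\<pi> s \<noteq> 0" "inverse (\<pi> s) \<in> C" "a = \<pi> p / \<pi> s"
proof -
  obtain p s where *: "p \<in> polys n" "s \<in> polys n" "\<pi> s \<in> T" "a = \<pi> p / \<pi> s"
    using assms T_sub unfolding fractions_def by blast
  have "1 / \<pi> s \<in> C" unfolding fractions_def using * field_subring.one_in[OF A0_subring] by blast
  then show ?thesis using that[of p s] * T_0 by (metis inverse_eq_divide)
qed

lemma II_D: "is \<in> II \<Longrightarrow> is \<in> tuples m r" and JJ_D: "js \<in> JJ \<Longrightarrow> js \<in> tuples n r"
  by (auto simp: nonsing_rows_def nonsing_cols_def inc_tuples_def)

lemma minor_in_C: "is \<in> tuples m k \<Longrightarrow> js \<in> tuples n k \<Longrightarrow> minor J is js \<in> C"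
  using minor_in A0_sub_C by blast

text \<open>The criterion returns arbitrary tuples, whereas the ideal is spanned by minors of
  increasing ones; sorting changes a minor by a sign only, so the contradiction survives.\<close>

lemma jacobian_ideal_unit:
  assumes "regular_subring C"
  shows "\<exists>c. (\<forall>z\<in>II \<times> JJ. c z \<in> C) \<and> (\<Sum>z\<in>II \<times> JJ. c z * minor J (fst z) (snd z)) = 1"
proof (rule ccontr)
  assume neg: "\<not> ?thesis"
  interpret C: field_subring C by (rule C_subring)
  have "finite II" by (rule finite_subset[OF _ finite_tuples[of m r]]) (use II_D in blast)
  moreover have "finite JJ" by (rule finite_subset[OF _ finite_tuples[of n r]]) (use JJ_D in blast)
  ultimately have fin: "finite (II \<times> JJ)" by blast
  let ?mn = "\<lambda>z. minor J (fst z) (snd z)"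
  have mC: "?mn z \<in> C" if "z \<in> II \<times> JJ" for z using that minor_in_C[OF II_D JJ_D] by auto
  let ?I = "{\<Sum>z\<in>II \<times> JJ. c z * ?mn z | c. \<forall>z\<in>II \<times> JJ. c z \<in> C}"
  interpret I: subring_ideal C ?I by (rule C.combinations_ideal(1)[OF fin mC])
  have I_sub: "?mn ` (II \<times> JJ) \<subseteq> ?I"
    by (rule C.combinations_ideal(2)[of "II \<times> JJ" ?mn]) (use fin mC in blast)+
  have "1 \<notin> ?I" using neg by force
  then obtain P where P: "subring_prime C P" "?I \<subseteq> P" using I.exists_prime_superset by blast
  interpret P: subring_prime C P by fact
  have P0: "0 \<in> P" by (rule P.ideal_zero)
  let ?R = "fractions C (C - P)" and ?M = "{a / s | a s. a \<in> P \<and> s \<in> C - P}"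
  have "primeideal P (ring_on C)" using C.primeideal_iff P by blast
  then have reg: "regular_local_ring (ring_on ?R)" using assms unfolding regular_subring_def by blast
  interpret L: local_subring ?R ?M by (rule P.local_subring_fractions)
  have CR: "C \<subseteq> ?R" using C.one_in P.one_notin by (intro fractions_superset) auto
  obtain X p where Xp: "finite X \<and> X \<subseteq> ?M \<and>
    (\<forall>a\<in>?M. \<exists>c. (\<forall>x\<in>X. c x \<in> ?R) \<and> a = (\<Sum>x\<in>X. c x * x)) \<and>
    (\<forall>i \<le> card X. subring_prime ?R (p i)) \<and> (\<forall>i < card X. p i \<subset> p (Suc i)) \<and> p (card X) \<subseteq> ?M"
    using L.regular_local_generators[OF reg] by (elim exE)
  then have X: "finite X" "X \<subseteq> ?M" and gen: "\<forall>a\<in>?M. \<exists>c. (\<forall>x\<in>X. c x \<in> ?R) \<and> a = (\<Sum>x\<in>X. c x * x)"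
    and p: "\<forall>i \<le> card X. subring_prime ?R (p i)" "\<forall>i < card X. p i \<subset> p (Suc i)" "p (card X) \<subseteq> ?M"
    by - (elim conjE, assumption)+
  have frac: "\<exists>p\<in>polys n. \<exists>s\<in>polys n. \<pi> s \<noteq> 0 \<and> inverse (\<pi> s) \<in> ?R \<and> a = \<pi> p / \<pi> s"
    if a: "a \<in> ?R" for a
  proof -
    obtain y z where "y \<in> C" "z \<in> C - P" "a = y / z" using fractionsE[OF a] .
    then have yz: "y \<in> C" "z \<in> C" "z \<notin> P" "a = y / z" by blast+
    obtain b s where b: "b \<in> polys n" "s \<in> polys n" "\<pi> s \<in> T" "\<pi> s \<noteq> 0" "inverse (\<pi> s) \<in> C" "y = \<pi> b / \<pi> s"
      using C_fraction[OF yz(1)] .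
    obtain d t where d: "d \<in> polys n" "t \<in> polys n" "\<pi> t \<in> T" "\<pi> t \<noteq> 0" "inverse (\<pi> t) \<in> C" "z = \<pi> d / \<pi> t"
      using C_fraction[OF yz(2)] .
    have "\<pi> d \<noteq> 0" using d yz P0 by auto
    \<comment> \<open>As \<open>z = \<pi> d / \<pi> t\<close>, the inverse of
      \<open>\<pi> (s * d)\<close> is this product divided by \<open>z\<close>.\<close>
    have "inverse (\<pi> s) * inverse (\<pi> t) \<in> C" using b(5) d(5) by (rule C.mult_in)
    then have "(inverse (\<pi> s) * inverse (\<pi> t)) / z \<in> ?R"
      using yz(2,3) by (intro fractionsI) auto
    then have "inverse (\<pi> (s * d)) \<in> ?R"
      using b d \<open>\<pi> d \<noteq> 0\<close> by (simp add: pi_mult field_simps)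
    moreover have "a = \<pi> (b * t) / \<pi> (s * d)" "\<pi> (s * d) \<noteq> 0"
      unfolding yz(4) b(6) d(6) using b(1-4) d(1-4) \<open>\<pi> d \<noteq> 0\<close>
      by (simp_all add: pi_mult)
    ultimately show ?thesis using b d polys_mult by blast
  qed
  have "\<exists>is\<in>tuples m r. \<exists>js\<in>tuples n r. minor J is js \<notin> ?M"
    by (rule jacobian_criterion[OF L.local_subring_axioms subset_trans[OF A0_sub_C CR] frac X
        gen[rule_format] p(1)[rule_format] p(2)[rule_format] p(3)])
  then obtain "is" js where ij: "is \<in> tuples m r" "js \<in> tuples n r" "minor J is js \<notin> ?M" by blast
  have PM: "P \<subseteq> ?M"
  proof
    fix a assume "a \<in> P"
    moreover have "1 \<in> C - P" using C.one_in P.one_notin by blast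
    ultimately have "a / 1 \<in> ?M" by blast
    then show "a \<in> ?M" by simp
  qed
  have "minor J is js \<noteq> 0" using ij L.ideal_zero by metis
  then have "sort is \<in> II" "sort js \<in> JJ" using minor_sort_inc[of "is" J r js] ij by auto
  then have "minor J (sort is) (sort js) \<in> ?mn ` (II \<times> JJ)" by force
  then have "minor J (sort is) (sort js) \<in> ?I"  using I_sub by (rule rev_subsetD)
  then have "minor J (sort is) (sort js) \<in> ?M" using P(2) PM by blast
  then have sorted_in: "minor J (sort is) (sort js) \<in> ?M" "- minor J (sort is) (sort js) \<in> ?M"
    by (simp_all only: L.ideal_uminus)
  have "minor J is js = minor J (sort is) (sort js) \<or> minor J is js = - minor J (sort is) (sort js)"
    using minor_sort[of "is" J r js] ij(1,2) by auto
  then have "minor J is js \<in> ?M" by (elim disjE) (simp_all only: sorted_in)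
  with ij(3) show False by (rule notE)
qed

end

section \<open>Sorting by inserting one index\<close>

lemma sort_snoc:
  fixes js :: "nat list"
  assumes "sorted_wrt (<) js" "l \<notin> set js"
  obtains u v where "js = u @ v" "sort (js @ [l]) = u @ l # v" "\<forall>a\<in>set u. a < l" "\<forall>b\<in>set v. l < b"
proof -
  let ?u = "takeWhile (\<lambda>a. a < l) js" and ?v = "dropWhile (\<lambda>a. a < l) js"
  have js: "js = ?u @ ?v" by simp
  have u: "\<forall>a\<in>set ?u. a < l" by (auto dest: set_takeWhileD)
  have v: "\<forall>b\<in>set ?v. l < b"
  proof
    fix b assume b: "b \<in> set ?v"
    then obtain c w where cw: "?v = c # w" by (cases ?v) auto
    have "\<not> c < l" using hd_dropWhile[of "\<lambda>a. a < l" js] cw by auto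
    moreover have "c \<noteq> l" using assms(2) cw by (metis list.set_intros(1) set_dropWhileD)
    moreover have "sorted_wrt (<) ?v" using assms(1) js by (metis sorted_wrt_append)
    ultimately show "l < b" using b cw by auto
  qed
  have "sorted_wrt (<) (?u @ ?v)" using assms(1) by simp
  then have "sorted_wrt (<) (?u @ l # ?v)"
    using u v unfolding sorted_wrt_append sorted_wrt.simps by (metis list.set_intros(1) set_ConsD)
  then have "sorted (?u @ l # ?v)" by (simp only: strict_sorted_iff)
  moreover have "mset (?u @ l # ?v) = mset (js @ [l])" by (subst (3) js) (simp del: takeWhile_dropWhile_id)
  ultimately have "sort (js @ [l]) = ?u @ l # ?v" by (rule properties_for_sort[rotated])
  then show ?thesis using that[of ?u ?v] js u v by blast
qed

lemma sort_sign_increasing: "sorted_wrt (<) js \<Longrightarrow> sort_sign js = 1"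
proof -
  assume "sorted_wrt (<) js"
  then have "{(a, b). a < b \<and> b < length js \<and> js ! b < js ! a} = {}"
    by (auto simp: sorted_wrt_iff_nth_less dest: less_asym)
  then show ?thesis unfolding sort_sign_def by (simp only: card.empty power_0)
qed

text \<open>Since \<open>js\<close> is increasing, the inversions are exactly the pairs of an entry
  of \<open>v\<close> with the appended \<open>l\<close>.\<close>

lemma sort_sign_snoc:
  assumes js: "js = u @ v" and "sorted_wrt (<) js" "\<forall>a\<in>set u. a < l" "\<forall>b\<in>set v. l < b"
  shows "sort_sign (js @ [l]) = (-1) ^ length v"
proof -
  have less: "js ! a < js ! b" if "a < b" "b < length js" for a b
    using assms(2) that by (simp add: sorted_wrt_iff_nth_less)
  have last: "l < js ! a \<longleftrightarrow> length u \<le> a" if "a < length js" for a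
  proof (cases "a < length u")
    case True
    then have "js ! a < l" using assms(3) by (simp add: js nth_append)
    then show ?thesis using True by auto
  next
    case False
    then have "v ! (a - length u) \<in> set v" using that js by auto
    then show ?thesis using False assms(4) by (simp add: js nth_append)
  qed
  have "{(a, b). a < b \<and> b < length (js @ [l]) \<and> (js @ [l]) ! b < (js @ [l]) ! a} =
      (\<lambda>a. (a, length js)) ` {length u..<length js}" (is "?L = ?R")
  proof
    show "?L \<subseteq> ?R"
    proof clarify
      fix a b assume ab: "a < b" "b < length (js @ [l])" "(js @ [l]) ! b < (js @ [l]) ! a"
      show "(a, b) \<in> ?R"
      proof (cases "b < length js")
        case True
        then show ?thesis using ab less[of a b] by (simp add: nth_append[of js])
      next
        case False
        then have "b = length js" using ab by simp
        then show ?thesis using ab last[of a] by (auto simp: nth_append[of js])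
      qed
    qed
    show "?R \<subseteq> ?L"
    proof clarify
      fix a assume "a \<in> {length u..<length js}"
      then show "a < length js \<and> length js < length (js @ [l]) \<and>
          (js @ [l]) ! length js < (js @ [l]) ! a"
        using last[of a] by (simp add: nth_append[of js])
    qed
  qed
  moreover have "card ?R = length v" by (subst card_image) (auto simp: js intro: inj_onI)
  ultimately show ?thesis unfolding sort_sign_def by simp
qed

lemma sort_sign_square: "sort_sign js * sort_sign js = (1::'q::field)"
  by (simp add: sort_sign_def flip: power_add mult_2)

text \<open>The Laplace sign at the place of insertion is the sign of the sorting permutation in
  \<open>sort_sign_snoc\<close>.\<close>

lemma jac_coeff_inserted:
  assumes "length is = length u + length v"
  shows "jac_coeff J is (u @ l # v) (length u) = (-1) ^ length v * minor J is (u @ v)"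
proof -
  have "omit (length u) (u @ l # v) = u @ v" by (simp add: omit_def)
  moreover have "length (u @ l # v) + Suc (length u) = 2 * Suc (length u) + length v" by simp
  then have "(-1::'a) ^ (length (u @ l # v) + Suc (length u)) = (-1) ^ length v"
    by (simp only: power_add power_mult) simp
  ultimately show ?thesis by (simp only: jac_coeff_def)
qed

text \<open>Passes from positions in \<open>js'\<close>, which index the relations, to variables,
  which index the expansion of a derivation.\<close>

lemma jac_vec_sum:
  fixes h :: "nat \<Rightarrow> 'q::field"
  assumes "set js' \<subseteq> {..<n}"
  shows "(\<Sum>k \<in> {k. k < length js' \<and> js' ! k \<notin> U}. jac_coeff J is js' k * h (js' ! k)) =
    (\<Sum>l\<in>{..<n} - U. jac_vec J is js' l * h l)"
proof -
  let ?S = "{k. k < length js' \<and> js' ! k \<notin> U}"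
  have "(\<Sum>l\<in>{..<n} - U. jac_vec J is js' l * h l) =
      (\<Sum>l\<in>{..<n} - U. \<Sum>k | k \<in> ?S \<and> js' ! k = l. jac_coeff J is js' k * h (js' ! k))"
    unfolding jac_vec_def sum_distrib_right
    by (intro sum.cong refl) auto
  also have "\<dots> = (\<Sum>k\<in>?S. jac_coeff J is js' k * h (js' ! k))"
    using assms by (intro sum.group) (auto dest!: nth_mem)
  finally show ?thesis by simp
qed

section \<open>Jacobian derivations\<close>

lemma derivationsD:
  assumes "D \<in> derivations \<kappa> C"
  shows "a \<in> C \<Longrightarrow> D a \<in> C" "a \<notin> C \<Longrightarrow> D a = undefined"
    "a \<in> C \<Longrightarrow> b \<in> C \<Longrightarrow> D (a + b) = D a + D b"
    "a \<in> C \<Longrightarrow> D (\<kappa> c * a) = \<kappa> c * D a"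
    "a \<in> C \<Longrightarrow> b \<in> C \<Longrightarrow> D (a * b) = D a * b + a * D b"
  using assms by (auto simp: derivations_def PiE_def extensional_def)

lemma derivations_combination:
  assumes "field_subring C" "\<And>u. u \<in> U \<Longrightarrow> c u \<in> C" "\<And>u. u \<in> U \<Longrightarrow> D u \<in> derivations \<kappa> C"
    "range \<kappa> \<subseteq> C"
  shows "(\<lambda>y\<in>C. \<Sum>u\<in>U. c u * D u y) \<in> derivations \<kappa> C"
proof -
  interpret field_subring C by fact
  have "(\<Sum>u\<in>U. c u * D u y) \<in> C" if "y \<in> C" for y
    using assms(2) derivationsD(1)[OF assms(3)] that by (intro sum_in mult_in)
  moreover have "(\<Sum>u\<in>U. c u * D u (a + b)) = (\<Sum>u\<in>U. c u * D u a) + (\<Sum>u\<in>U. c u * D u b)"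
    if "a \<in> C" "b \<in> C" for a b
    unfolding sum.distrib[symmetric]
    using that derivationsD(3)[OF assms(3)] by (intro sum.cong) (auto simp: distrib_left)
  moreover have "(\<Sum>u\<in>U. c u * D u (\<kappa> k * a)) = \<kappa> k * (\<Sum>u\<in>U. c u * D u a)" if "a \<in> C" for a k
    unfolding sum_distrib_left using that derivationsD(4)[OF assms(3)] by (intro sum.cong) (auto simp: mult_ac)
  moreover have "(\<Sum>u\<in>U. c u * D u (a * b)) = (\<Sum>u\<in>U. c u * D u a) * b + a * (\<Sum>u\<in>U. c u * D u b)"
    if "a \<in> C" "b \<in> C" for a b
    unfolding sum_distrib_left sum_distrib_right sum.distrib[symmetric]
    using that derivationsD(5)[OF assms(3)] by (intro sum.cong) (auto simp: algebra_simps)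
  moreover have "\<kappa> k * a \<in> C" if "a \<in> C" for a k using that assms(4) mult_in by blast
  ultimately show ?thesis unfolding derivations_def by (simp add: add_in mult_in)
qed

context affine_localization
begin

abbreviation "\<delta> \<equiv> jac_der \<kappa> C x J"
abbreviation "JJ' \<equiv> nonsing_cols_ext J r"
abbreviation "G \<equiv> II \<times> JJ'"

lemma kappa_in_C: "range \<kappa> \<subseteq> C"
  using K_sub A0_sub_C by blast

lemma derivation_const:
  assumes "D \<in> derivations \<kappa> C"
  shows "D (\<kappa> c) = 0"
proof -
  have 1: "1 \<in> C" using C_subring by (rule field_subring.one_in)
  have "D (1 * 1) = D 1 * 1 + 1 * D 1" by (rule derivationsD(5)[OF assms 1 1])
  then have "D 1 + D 1 = D 1 + 0" by simp
  then have "D 1 = 0" by (simp only: add_left_cancel)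
  then show ?thesis using derivationsD(4)[OF assms 1, of c] by simp
qed

lemma derivation_A0:
  assumes "D \<in> derivations \<kappa> C" "a \<in> A0" "b \<in> A0"
  shows "D (a + b) = D a + D b" "D (a * b) = D a * b + a * D b"
  using derivationsD(3,5)[OF assms(1)] assms(2,3) A0_sub_C by (simp_all add: subset_iff)

lemma derivation_on_A0:
  assumes "D \<in> derivations \<kappa> C" "p \<in> polys n"
  shows "D (\<pi> p) = dir_deriv (\<lambda>l. D (x l)) p"

  by (rule derivation_chain_rule[OF derivation_A0[OF assms(1)] derivation_const[OF assms(1)] assms(2)])

lemma derivation_J_kernel:
  assumes "D \<in> derivations \<kappa> C" "i < m"
  shows "(\<Sum>l<n. J $$ (i, l) * D (x l)) = 0"

  by (rule derivation_kernel[OF derivation_A0[OF assms(1)] derivation_const[OF assms(1)] assms(2)])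

text \<open>The product rule for \<open>a * \<pi> s = \<pi> p\<close> determines the value at a
  fraction; outside \<open>C\<close> both functions are \<open>undefined\<close>.\<close>

lemma derivations_eqI:
  assumes D: "D \<in> derivations \<kappa> C" and E: "E \<in> derivations \<kappa> C" and eq: "\<And>l. l < n \<Longrightarrow> D (x l) = E (x l)"
  shows "D = E"
proof
  fix a
  show "D a = E a"
  proof (cases "a \<in> C")
    case True
    have A0: "D (\<pi> p) = E (\<pi> p)" if "p \<in> polys n" for p
      unfolding derivation_on_A0[OF D that] derivation_on_A0[OF E that] dir_deriv_def
      using eq by (intro sum.cong) auto
    obtain p s where ps: "p \<in> polys n" "s \<in> polys n" "\<pi> s \<noteq> 0" "a = \<pi> p / \<pi> s"
      using C_fraction[OF True] by metis
    have sC: "\<pi> s \<in> C" using ps A0_sub_C by blast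
    have as: "a * \<pi> s = \<pi> p" using ps by simp
    have "D a * \<pi> s + a * D (\<pi> s) = E a * \<pi> s + a * E (\<pi> s)"
      using derivationsD(5)[OF D True sC] derivationsD(5)[OF E True sC] A0[OF ps(1)] as by simp
    then show ?thesis using A0[OF ps(2)] ps(3) by simp
  qed (simp add: derivationsD(2)[OF D] derivationsD(2)[OF E])
qed

text \<open>Justifies the \<open>THE\<close> in \<open>jac_der\<close>. The prescribed vector is in
  the kernel of \<open>J\<close> because the minors of size r + 1 vanish, so
  \<open>derivation_exists\<close> applies with the zero ideal, where congruences are
  equations.\<close>

lemma jac_der:
  assumes "is": "is \<in> tuples m r" and js: "js \<in> tuples n (Suc r)"
  shows "is_jac_der \<kappa> C x J is js (\<delta> is js)"
proof -
  interpret C: field_subring C by (rule C_subring)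
  let ?v = "jac_vec J is js"
  have len: "length js = Suc (length is)" "set js \<subseteq> {..<n}" using assms by (auto simp: tuples_def)
  have "\<exists>D. mod_derivation K C {0} D \<and> (\<forall>l<n. D (x l) - ?v l \<in> {0})"
  proof (rule derivation_exists)
    show "subring_ideal C {0}" by unfold_locales (auto simp: C.zero_in)
    show "\<exists>p\<in>polys n. \<exists>s\<in>polys n. \<pi> s \<noteq> 0 \<and> inverse (\<pi> s) \<in> C \<and> a = \<pi> p / \<pi> s" if "a \<in> C" for a
      using C_fraction[OF that] by metis
    show "?v l \<in> C" for l using jac_vec_in[OF assms] A0_sub_C by blast
    show "(\<Sum>l<n. J $$ (i, l) * ?v l) \<in> {0}" if "i < m" for i
      using minor_vanishes[OF J_carrier snoc_tuples[OF "is" that] js]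
      by (simp add: jac_vec_row[OF len])
  qed (rule A0_sub_C)
  then obtain D where D: "mod_derivation K C {0} D" "\<And>l. l < n \<Longrightarrow> D (x l) = ?v l" by auto
  have xC: "x l \<in> C" if "l < n" for l using x_in[OF that] A0_sub_C by blast
  have kC: "\<kappa> c \<in> C" for c using kappa_in_C by blast
  have "restrict D C \<in> derivations \<kappa> C"
    using D(1) kC by (simp add: derivations_def mod_derivation_def C.add_in C.mult_in)
  then have ex: "is_jac_der \<kappa> C x J is js (restrict D C)"
    using D(2) xC by (simp add: is_jac_der_def jac_vec_def)
  have "E = E'" if "is_jac_der \<kappa> C x J is js E" "is_jac_der \<kappa> C x J is js E'" for E E'
    using that by (intro derivations_eqI) (auto simp: is_jac_der_def)
  then have "\<exists>!D. is_jac_der \<kappa> C x J is js D" using ex by blast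
  then show ?thesis unfolding jac_der_def by (rule theI')
qed

lemma jac_der_in: "is \<in> tuples m r \<Longrightarrow> js \<in> tuples n (Suc r) \<Longrightarrow> \<delta> is js \<in> derivations \<kappa> C"
  using jac_der by (simp add: is_jac_der_def)

lemma jac_der_x: "is \<in> tuples m r \<Longrightarrow> js \<in> tuples n (Suc r) \<Longrightarrow> l < n \<Longrightarrow> \<delta> is js (x l) = jac_vec J is js l"
  using jac_der[of "is" js] by (simp add: is_jac_der_def jac_vec_def)

text \<open>Both sides lie in the kernel of \<open>J\<close> and agree at the variables outside \<open>js\<close>.\<close>

lemma derivation_expansion:
  assumes D: "D \<in> derivations \<kappa> C" and "is": "is \<in> tuples m r" and js: "js \<in> tuples n r"
    and minor: "minor J is js \<noteq> 0" and y: "y \<in> C"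
  shows "minor J is js * D y = (\<Sum>l\<in>{..<n} - set js. D (x l) * \<delta> is (js @ [l]) y)"
proof -
  let ?U = "{..<n} - set js"
  have len: "length is = length js" using "is" js by (simp add: tuples_def)
  have xC: "x l \<in> C" if "l < n" for l using x_in[OF that] A0_sub_C by blast
  have jl: "js @ [l] \<in> tuples n (Suc r)" if "l \<in> ?U" for l using snoc_tuples[OF js] that by auto
  \<comment> \<open>The sum over a single element makes this an instance of
    \<open>derivations_combination\<close>.\<close>
  let ?E = "\<lambda>y\<in>C. \<Sum>u\<in>{()}. minor J is js * D y"
  let ?E' = "\<lambda>y\<in>C. \<Sum>l\<in>?U. D (x l) * \<delta> is (js @ [l]) y"
  have E: "?E \<in> derivations \<kappa> C"
    using D minor_in_C[OF "is" js] by (intro derivations_combination C_subring kappa_in_C)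
  have E': "?E' \<in> derivations \<kappa> C"
    using D xC jac_der_in[OF "is" jl] derivationsD(1)[OF D]
    by (intro derivations_combination C_subring kappa_in_C) auto
  have "?E = ?E'"
  proof (rule derivations_eqI[OF E E'])
    fix w assume w: "w < n"
    have "?E (x w) - ?E' (x w) = 0"
    proof (rule minor_zero_vector[OF "is" js minor _ _ w])
      fix a assume "a < r"
      then have "is ! a < m" using tuplesD(2)[OF "is"] by blast
      from derivation_J_kernel[OF E this] derivation_J_kernel[OF E' this]
      show "(\<Sum>l<n. J $$ (is ! a, l) * (?E (x l) - ?E' (x l))) = 0"
        by (simp only: right_diff_distrib sum_subtractf) simp
    next
      fix w assume w: "w < n" "w \<notin> set js"
      have summand: "D (x l) * \<delta> is (js @ [l]) (x w) = (if l = w then D (x w) * minor J is js else 0)"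
        if l: "l \<in> ?U" for l
      proof -
        have "l \<notin> set js" using l by simp
        then show ?thesis using jac_der_x[OF "is" jl[OF l] w(1)] jac_vec_snoc[OF len _ w(2), of l J] by simp
      qed
      have "?E' (x w) = (\<Sum>l\<in>?U. D (x l) * \<delta> is (js @ [l]) (x w))" using xC[OF w(1)] by simp
      also have "\<dots> = (\<Sum>l\<in>?U. if l = w then D (x w) * minor J is js else 0)"
        by (rule sum.cong[OF refl summand])
      also have "\<dots> = minor J is js * D (x w)" using w by (simp add: mult.commute)
      also have "\<dots> = ?E (x w)" using xC[OF w(1)] by simp
      finally show "?E (x w) - ?E' (x w) = 0" by (simp only: diff_self)
    qed
    then show "?E (x w) = ?E' (x w)" by simp
  qed
  from fun_cong[OF this, of y] show ?thesis using y by simp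
qed

lemma JJ'_D: "js \<in> JJ' \<Longrightarrow> js \<in> tuples n (Suc r)" "js \<in> JJ' \<Longrightarrow> sorted_wrt (<) js"
  by (auto simp: nonsing_cols_ext_def inc_tuples_def)

lemma JJ_sorted: "js \<in> JJ \<Longrightarrow> sorted_wrt (<) js"
  by (auto simp: nonsing_cols_def inc_tuples_def)

lemma nonsing_minor': "is \<in> II \<Longrightarrow> js \<in> JJ \<Longrightarrow> minor J is js \<noteq> 0"
  by (rule nonsing_minor[OF J_carrier refl])

text \<open>Omitting \<open>l\<close> again gives back \<open>js\<close>, as
  \<open>nonsing_cols_ext\<close> requires.\<close>

lemma sort_snoc_in_G:
  assumes "is \<in> II" "js \<in> JJ" "l < n" "l \<notin> set js"
  shows "(is, sort (js @ [l])) \<in> G"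
proof -
  obtain u v where uv: "js = u @ v" "sort (js @ [l]) = u @ l # v" "\<forall>a\<in>set u. a < l" "\<forall>b\<in>set v. l < b"
    using sort_snoc[OF JJ_sorted[OF assms(2)] assms(4)] .
  have "omit (length u) (u @ l # v) = js" by (simp add: omit_def uv(1))
  moreover have "u @ l # v \<in> inc_tuples n (r + 1)"
    using JJ_D[OF assms(2)] JJ_sorted[OF assms(2)] uv assms(3)
    by (auto simp: inc_tuples_def tuples_def sorted_wrt_append)
  moreover have "length u < r + 1" using JJ_D[OF assms(2)] uv(1) by (simp add: tuples_def)
  ultimately have "u @ l # v \<in> JJ'" using assms(2) by (auto simp: nonsing_cols_ext_def)
  then show ?thesis using assms(1) uv(2) by simp
qed

text \<open>Expand the derivation of the sorted tuple by \<open>derivation_expansion\<close>: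
  outside \<open>js\<close> it is nonzero at the variable \<open>l\<close> only, so one term
  remains, and the sign is its own inverse.\<close>

lemma jac_der_sort:
  assumes "is": "is \<in> II" and js: "js \<in> JJ" and l: "l < n" "l \<notin> set js" and y: "y \<in> C"
  shows "\<delta> is (js @ [l]) y = sort_sign (js @ [l]) * \<delta> is (sort (js @ [l])) y"
proof -
  obtain u v where uv: "js = u @ v" "sort (js @ [l]) = u @ l # v" "\<forall>a\<in>set u. a < l" "\<forall>b\<in>set v. l < b"
    using sort_snoc[OF JJ_sorted[OF js] l(2)] .
  let ?js = "u @ l # v" and ?s = "sort_sign (js @ [l]) :: 'b"
  have it: "is \<in> tuples m r" and jt: "js \<in> tuples n r" using II_D JJ_D "is" js by auto
  have jt': "?js \<in> tuples n (Suc r)" using JJ'_D(1) sort_snoc_in_G[OF "is" js l] uv(2) by auto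
  have minor: "minor J is js \<noteq> 0" by (rule nonsing_minor'[OF "is" js])
  have s: "?s = (-1) ^ length v" unfolding uv(1)
    by (rule sort_sign_snoc[OF refl]) (use JJ_sorted[OF js] uv in auto)
  have "distinct ?js" using JJ_sorted[OF js] l uv(1) by (auto simp: strict_sorted_iff)
  then have "jac_vec J is ?js (?js ! length u) = jac_coeff J is ?js (length u)"
    by (intro jac_vec_nth) auto
  then have "jac_vec J is ?js l = ?s * minor J is js"
    using it jt uv(1) jac_coeff_inserted[of "is" u v J l] s by (simp add: tuples_def)
  then have Dl: "\<delta> is ?js (x l) = ?s * minor J is js" using jac_der_x[OF it jt' l(1)] by simp
  have D0: "\<delta> is ?js (x w) = 0" if "w < n" "w \<notin> set js" "w \<noteq> l" for w
    using jac_der_x[OF it jt' that(1)] jac_vec_notin[of w ?js J "is"] that uv(1) by simp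
  have "minor J is js * \<delta> is ?js y = (\<Sum>w\<in>{..<n} - set js. \<delta> is ?js (x w) * \<delta> is (js @ [w]) y)"
    by (rule derivation_expansion[OF jac_der_in[OF it jt'] it jt minor y])
  also have "\<dots> = (\<Sum>w\<in>{..<n} - set js. if w = l then ?s * minor J is js * \<delta> is (js @ [l]) y else 0)"
    by (intro sum.cong) (auto simp: D0 Dl)
  also have "\<dots> = ?s * minor J is js * \<delta> is (js @ [l]) y" using l by simp
  finally have "\<delta> is ?js y = ?s * \<delta> is (js @ [l]) y" using minor by (simp add: mult_ac)
  then have "?s * \<delta> is ?js y = \<delta> is (js @ [l]) y"
    by (simp add: mult.assoc[symmetric] sort_sign_square)
  then show ?thesis using uv(2) by simp
qed

lemma jac_der_relation:
  assumes "is": "is \<in> II" and js: "js \<in> JJ" and is': "is' \<in> II" and js': "js' \<in> JJ'" and y: "y \<in> C"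
  shows "minor J is js * \<delta> is' js' y =
    (\<Sum>k\<in>{k. k < r + 1 \<and> js' ! k \<notin> set js}. jac_coeff J is' js' k * \<delta> is (js @ [js' ! k]) y)"
proof -
  have t: "is' \<in> tuples m r" "js' \<in> tuples n (Suc r)" using II_D is' JJ'_D js' by auto
  then have len: "length js' = r + 1" "set js' \<subseteq> {..<n}" by (auto simp: tuples_def)
  have "minor J is js * \<delta> is' js' y = (\<Sum>l\<in>{..<n} - set js. \<delta> is' js' (x l) * \<delta> is (js @ [l]) y)"
    by (rule derivation_expansion[OF jac_der_in[OF t] II_D[OF "is"] JJ_D[OF js] nonsing_minor'[OF "is" js] y])
  also have "\<dots> = (\<Sum>l\<in>{..<n} - set js. jac_vec J is' js' l * \<delta> is (js @ [l]) y)"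
    using jac_der_x[OF t] by (intro sum.cong) auto
  also have "\<dots> = (\<Sum>k\<in>{k. k < length js' \<and> js' ! k \<notin> set js}. jac_coeff J is' js' k * \<delta> is (js @ [js' ! k]) y)"
    by (rule jac_vec_sum[OF len(2), symmetric])
  finally show ?thesis by (simp add: len(1))
qed

end

section \<open>Generators and relations\<close>

lemma (in Module.module) submodule_finsum:
  assumes "submodule R N M" "finite U" "\<And>u. u \<in> U \<Longrightarrow> F u \<in> N"
  shows "finsum M F U \<in> N"
  using assms(2,3)
proof (induction U rule: finite_induct)
  case empty
  then show ?case using submodule.zero_closed[OF assms(1)] by simp
next
  case (insert u U)
  have "N \<subseteq> carrier M" by (rule submodule.subset[OF assms(1)])
  then have "finsum M F (insert u U) = F u \<oplus>\<^bsub>M\<^esub> finsum M F U"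
    using insert by (intro finsum_insert) auto
  then show ?case using insert submodule.m_closed[OF assms(1)] by simp
qed

text \<open>Reduces sums in the free module and in the module of derivations to sums in the
  field.\<close>

lemma pointwise_finsum:
  fixes P :: "('q::field, 's \<Rightarrow> 'q) module"
  assumes "abelian_monoid P" "\<And>g h. g \<oplus>\<^bsub>P\<^esub> h = (\<lambda>v\<in>S. g v + h v)" "\<zero>\<^bsub>P\<^esub> = (\<lambda>v\<in>S. 0)"
    and "finite U" "\<And>u. u \<in> U \<Longrightarrow> F u \<in> carrier P"
  shows "finsum P F U = (\<lambda>v\<in>S. \<Sum>u\<in>U. F u v)"
  using assms(4,5)
proof (induction U rule: finite_induct)
  interpret abelian_monoid P by fact
  case empty
  then show ?case by (simp add: assms(3))
next
  interpret abelian_monoid P by fact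
  case (insert u U)
  then have "finsum P F (insert u U) = F u \<oplus>\<^bsub>P\<^esub> finsum P F U" by (intro finsum_insert) auto
  then show ?case using insert by (auto simp: assms(2))
qed

context field_subring
begin

abbreviation "func_mod \<equiv> LinearCombinations.ring.func_space (ring_on R)"

lemma func_mod_eq:
  "func_mod S = \<lparr>carrier = S \<rightarrow>\<^sub>E R, monoid.mult = (\<lambda>f g. \<lambda>v\<in>S. 0), one = (\<lambda>v\<in>S. 0),
     zero = (\<lambda>v\<in>S. 0), add = (\<lambda>g h. \<lambda>v\<in>S. g v + h v), smult = (\<lambda>a g. \<lambda>v\<in>S. a * g v)\<rparr>"
proof -
  interpret ring: cring "ring_on R" by (rule ring_on_cring)
  show ?thesis unfolding ring.func_space_def by simp
qed

lemma func_mod_simps: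
  "carrier (func_mod S) = S \<rightarrow>\<^sub>E R" "g \<oplus>\<^bsub>func_mod S\<^esub> h = (\<lambda>v\<in>S. g v + h v)"
  "\<zero>\<^bsub>func_mod S\<^esub> = (\<lambda>v\<in>S. 0)" "a \<odot>\<^bsub>func_mod S\<^esub> g = (\<lambda>v\<in>S. a * g v)"
  unfolding func_mod_eq by simp_all

lemma func_mod_module: "Module.module (ring_on R) (func_mod S)"
proof -
  interpret ring: cring "ring_on R" by (rule ring_on_cring)
  show ?thesis by (rule ring.func_space_is_module)
qed

end

lemma symbol_generator:
  assumes "g \<in> G" "sorted_wrt (<) (snd g)" "h \<in> G"
  shows "symbol G (fst g) (snd g) h = (if h = g then 1 else 0)"
proof -
  have "sort (snd g) = snd g" using assms(2) by (simp add: strict_sorted_iff sorted_sort_id)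
  then show ?thesis using assms by (simp add: symbol_def sort_sign_increasing prod_eq_iff)
qed

lemma symbol_sum:
  assumes "finite G" "(is, sort js) \<in> G"
  shows "(\<Sum>g\<in>G. symbol G is js g * h g) = sort_sign js * h (is, sort js)"
proof -
  have "(\<Sum>g\<in>G. symbol G is js g * h g) =
      (\<Sum>g\<in>G. if g = (is, sort js) then sort_sign js * h (is, sort js) else 0)"
    by (intro sum.cong) (auto simp: symbol_def)
  then show ?thesis using assms by simp
qed

section \<open>The module of derivations and its generators\<close>

context affine_localization
begin

abbreviation "M \<equiv> der_module \<kappa> C"
abbreviation "F \<equiv> LinearCombinations.ring.func_space (ring_on C) G"

lemma M_simps:
  "carrier M = derivations \<kappa> C" "g \<oplus>\<^bsub>M\<^esub> h = (\<lambda>y\<in>C. g y + h y)"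
  "\<zero>\<^bsub>M\<^esub> = (\<lambda>y\<in>C. 0)" "a \<odot>\<^bsub>M\<^esub> g = (\<lambda>y\<in>C. a * g y)"
  unfolding der_module_def field_subring.func_mod_eq[OF C_subring] by simp_all

lemma derivations_smult:
  assumes "a \<in> C" "D \<in> derivations \<kappa> C"
  shows "(\<lambda>y\<in>C. a * D y) \<in> derivations \<kappa> C"
  using derivations_combination[OF C_subring, of "{()}" "\<lambda>_. a" "\<lambda>_. D"] assms kappa_in_C by simp

lemma M_module: "Module.module (ring_on C) M"
proof -
  interpret C: field_subring C by (rule C_subring)
  interpret FS: Module.module "ring_on C" "C.func_mod C" by (rule C.func_mod_module)
  have "submodule (ring_on C) (derivations \<kappa> C) (C.func_mod C)"
  proof (rule submodule.intro)
    show "Module.module (ring_on C) (C.func_mod C)" by (rule C.func_mod_module)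
    show "derivations \<kappa> C \<subseteq> carrier (C.func_mod C)"
      unfolding C.func_mod_simps by (auto simp: derivations_def)
    show "g \<oplus>\<^bsub>C.func_mod C\<^esub> h \<in> derivations \<kappa> C" if "g \<in> derivations \<kappa> C" "h \<in> derivations \<kappa> C" for g h
      using derivations_combination[OF C_subring, of "UNIV :: bool set" "\<lambda>_. 1" "\<lambda>b. if b then h else g" \<kappa>]
        that kappa_in_C C.one_in unfolding C.func_mod_simps by (simp add: UNIV_bool)
    show "\<zero>\<^bsub>C.func_mod C\<^esub> \<in> derivations \<kappa> C"
      using derivations_combination[OF C_subring, of "{} :: unit set" _ _ \<kappa>] kappa_in_C
      unfolding C.func_mod_simps by simp
    show "a \<odot>\<^bsub>C.func_mod C\<^esub> g \<in> derivations \<kappa> C" if "a \<in> carrier (ring_on C)" "g \<in> derivations \<kappa> C" for a g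
      using derivations_smult that unfolding C.func_mod_simps by simp
  qed
  then show ?thesis unfolding der_module_def by (rule FS.submodule_is_module)
qed

lemma M_finsum:
  assumes "finite U" "\<And>u. u \<in> U \<Longrightarrow> E u \<in> derivations \<kappa> C"
  shows "finsum M E U = (\<lambda>y\<in>C. \<Sum>u\<in>U. E u y)"
proof -
  interpret M: Module.module "ring_on C" M by (rule M_module)
  show ?thesis by (rule pointwise_finsum[OF M.abelian_monoid_axioms]) (use assms in \<open>simp_all add: M_simps\<close>)
qed

lemma finite_II: "finite II" and finite_JJ: "finite JJ" and finite_JJ': "finite JJ'"
  using finite_subset[OF _ finite_tuples[of m r]] finite_subset[OF _ finite_tuples[of n r]]
    finite_subset[OF _ finite_tuples[of n "Suc r"]] II_D JJ_D JJ'_D(1) by (meson subsetI)+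

lemma finite_G: "finite G"
  using finite_II finite_JJ' by simp

lemma jac_der_G: "g \<in> G \<Longrightarrow> \<delta> (fst g) (snd g) \<in> derivations \<kappa> C"
  using jac_der_in II_D JJ'_D(1) by auto

lemma sort_sign_in_C: "sort_sign js \<in> C"
proof -
  interpret C: field_subring C by (rule C_subring)
  show ?thesis unfolding sort_sign_def by (intro C.power_in C.uminus_in C.one_in)
qed

lemma jac_coeff_in_C: "is \<in> tuples m r \<Longrightarrow> js \<in> tuples n (Suc r) \<Longrightarrow> k < Suc r \<Longrightarrow> jac_coeff J is js k \<in> C"
proof -
  interpret C: field_subring C by (rule C_subring)
  assume "is \<in> tuples m r" "js \<in> tuples n (Suc r)" "k < Suc r"
  then show ?thesis unfolding jac_coeff_def
    using minor_in_C omit_tuples by (intro C.mult_in C.power_in C.uminus_in C.one_in) blast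
qed

lemma derivations_generated:
  assumes "regular_subring C"
  shows "LinearCombinations.module.span (ring_on C) M {\<delta> is js | is js. is \<in> II \<and> js \<in> JJ'} = carrier M"
proof -
  interpret C: field_subring C by (rule C_subring)
  interpret M: Module.module "ring_on C" M by (rule M_module)
  let ?B = "{\<delta> is js | is js. is \<in> II \<and> js \<in> JJ'}"
  have B: "?B \<subseteq> carrier M" using jac_der_in II_D JJ'_D(1) by (auto simp: M_simps)
  have span: "submodule (ring_on C) (M.span ?B) M" by (rule M.span_is_submodule[OF B])
  have "D \<in> M.span ?B" if D: "D \<in> derivations \<kappa> C" for D
  proof -
    obtain a where a: "\<forall>z\<in>II \<times> JJ. a z \<in> C" "(\<Sum>z\<in>II \<times> JJ. a z * minor J (fst z) (snd z)) = 1"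
      using jacobian_ideal_unit[OF assms] by blast
    define Z where "Z = Sigma (II \<times> JJ) (\<lambda>z. {..<n} - set (snd z))"
    \<comment> \<open>The sign is present because the spanning set contains derivations of sorted
      tuples only.\<close>
    define b where "b = (\<lambda>(z, l). a z * D (x l) * sort_sign (snd z @ [l]))"
    define E where "E = (\<lambda>(z, l). \<delta> (fst z) (sort (snd z @ [l])))"
    have finZ: "finite Z" unfolding Z_def using finite_II finite_JJ by (intro finite_SigmaI) auto
    have b: "b w \<in> C" if "w \<in> Z" for w
    proof -
      obtain z l where w: "w = (z, l)" "z \<in> II \<times> JJ" "l < n" using \<open>w \<in> Z\<close> by (auto simp: Z_def)
      have "D (x l) \<in> C" using derivationsD(1)[OF D] x_in[OF w(3)] A0_sub_C by blast
      then show ?thesis using a(1) w sort_sign_in_C by (auto simp: b_def intro!: C.mult_in)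
    qed
    have E: "E w \<in> ?B" if "w \<in> Z" for w
      using that sort_snoc_in_G unfolding Z_def E_def by fastforce
    have EM: "E w \<in> derivations \<kappa> C" if "w \<in> Z" for w using E[OF that] B by (auto simp: M_simps)
    have Dy: "D y = (\<Sum>w\<in>Z. b w * E w y)" if y: "y \<in> C" for y
    proof -
      \<comment> \<open>Multiplication by the combination of minors that equals 1.\<close>
      have "D y = (\<Sum>z\<in>II \<times> JJ. a z * (minor J (fst z) (snd z) * D y))"
        using a(2) by (simp add: mult.assoc[symmetric] sum_distrib_right[symmetric])
      also have "\<dots> = (\<Sum>z\<in>II \<times> JJ. \<Sum>l\<in>{..<n} - set (snd z). b (z, l) * E (z, l) y)"
      proof (rule sum.cong[OF refl])
        fix z assume "z \<in> II \<times> JJ"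
        then obtain "is" js where z: "z = (is, js)" "is \<in> II" "js \<in> JJ" by blast
        have "minor J is js * D y = (\<Sum>l\<in>{..<n} - set js. D (x l) * \<delta> is (js @ [l]) y)"
          by (rule derivation_expansion[OF D II_D[OF z(2)] JJ_D[OF z(3)] nonsing_minor'[OF z(2,3)] y])
        also have "\<dots> = (\<Sum>l\<in>{..<n} - set js. D (x l) * (sort_sign (js @ [l]) * \<delta> is (sort (js @ [l])) y))"
          using jac_der_sort[OF z(2,3) _ _ y] by (intro sum.cong) auto
        finally show "a z * (minor J (fst z) (snd z) * D y) =
            (\<Sum>l\<in>{..<n} - set (snd z). b (z, l) * E (z, l) y)"
          by (simp add: z(1) b_def E_def sum_distrib_left mult_ac)
      qed
      also have "\<dots> = (\<Sum>w\<in>Z. b w * E w y)"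
        unfolding Z_def using finite_II finite_JJ by (subst sum.Sigma) (auto simp: case_prod_unfold)
      finally show ?thesis .
    qed
    have bE: "b w \<odot>\<^bsub>M\<^esub> E w \<in> derivations \<kappa> C" if "w \<in> Z" for w
      using derivations_smult[OF b[OF that] EM[OF that]] by (simp add: M_simps)
    have "D = (\<lambda>y\<in>C. \<Sum>w\<in>Z. b w * E w y)"
    proof
      fix y
      show "D y = (\<lambda>y\<in>C. \<Sum>w\<in>Z. b w * E w y) y"
        using Dy derivationsD(2)[OF D] by (cases "y \<in> C") auto
    qed
    also have "\<dots> = (\<lambda>y\<in>C. \<Sum>w\<in>Z. (b w \<odot>\<^bsub>M\<^esub> E w) y)"
      by (rule restrict_ext) (simp only: M_simps restrict_apply')
    also have "\<dots> = finsum M (\<lambda>w. b w \<odot>\<^bsub>M\<^esub> E w) Z"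
      by (rule M_finsum[OF finZ bE, symmetric])
    also have "\<dots> \<in> M.span ?B"
    proof (rule M.submodule_finsum[OF span finZ])
      fix w assume w: "w \<in> Z"
      have "E w \<in> M.span ?B" using M.in_own_span[OF B] E[OF w] by blast
      then show "b w \<odot>\<^bsub>M\<^esub> E w \<in> M.span ?B" using b[OF w] submodule.smult_closed[OF span] by simp
    qed
    finally show ?thesis .
  qed
  moreover have "M.span ?B \<subseteq> carrier M" by (rule submodule.subset[OF span])
  ultimately show ?thesis by (auto simp: M_simps)
qed

lemma jac_der_relation_M:
  assumes "is": "is \<in> II" and js: "js \<in> JJ" and is': "is' \<in> II" and js': "js' \<in> JJ'"
  shows "minor J is js \<odot>\<^bsub>M\<^esub> \<delta> is' js' = (\<Oplus>\<^bsub>M\<^esub>k \<in> {k. k < r + 1 \<and> js' ! k \<notin> set js}.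
    jac_coeff J is' js' k \<odot>\<^bsub>M\<^esub> \<delta> is (js @ [js' ! k]))"
proof -
  let ?K = "{k. k < r + 1 \<and> js' ! k \<notin> set js}"
  have D: "jac_coeff J is' js' k \<odot>\<^bsub>M\<^esub> \<delta> is (js @ [js' ! k]) \<in> derivations \<kappa> C" if "k \<in> ?K" for k
  proof -
    have "js @ [js' ! k] \<in> tuples n (Suc r)"
      using snoc_tuples[OF JJ_D[OF js]] tuplesD(2)[OF JJ'_D(1)[OF js']] that by simp
    then have "\<delta> is (js @ [js' ! k]) \<in> derivations \<kappa> C" using jac_der_in II_D[OF "is"] by blast
    then show ?thesis
      using derivations_smult jac_coeff_in_C[OF II_D[OF is'] JJ'_D(1)[OF js']] that by (simp add: M_simps)
  qed
  have "finsum M (\<lambda>k. jac_coeff J is' js' k \<odot>\<^bsub>M\<^esub> \<delta> is (js @ [js' ! k])) ?K =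
      (\<lambda>y\<in>C. \<Sum>k\<in>?K. (jac_coeff J is' js' k \<odot>\<^bsub>M\<^esub> \<delta> is (js @ [js' ! k])) y)"
    by (rule M_finsum) (use D in auto)
  also have "\<dots> = minor J is js \<odot>\<^bsub>M\<^esub> \<delta> is' js'"
    using jac_der_relation[OF assms] by (auto simp: M_simps)
  finally show ?thesis by simp
qed

section \<open>Evaluation of the free module on the generators and its kernel\<close>

abbreviation "eval_comb \<equiv> \<lambda>c. \<Oplus>\<^bsub>M\<^esub>g \<in> G. c g \<odot>\<^bsub>M\<^esub> \<delta> (fst g) (snd g)"

lemma eval_comb:
  assumes "c \<in> carrier F"
  shows "eval_comb c = (\<lambda>y\<in>C. \<Sum>g\<in>G. c g * \<delta> (fst g) (snd g) y)"
proof -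
  have c: "c g \<in> C" if "g \<in> G" for g
    using assms that unfolding field_subring.func_mod_simps[OF C_subring] by auto
  have "c g \<odot>\<^bsub>M\<^esub> \<delta> (fst g) (snd g) \<in> derivations \<kappa> C" if "g \<in> G" for g
    using derivations_smult[OF c[OF that] jac_der_G[OF that]] by (simp add: M_simps)
  then have "eval_comb c = (\<lambda>y\<in>C. \<Sum>g\<in>G. (c g \<odot>\<^bsub>M\<^esub> \<delta> (fst g) (snd g)) y)"
    by (rule M_finsum[OF finite_G])
  then show ?thesis by (auto simp: M_simps)
qed

lemma eval_comb_mod_hom: "mod_hom (ring_on C) F M eval_comb"
proof -
  interpret C: field_subring C by (rule C_subring)
  interpret M: Module.module "ring_on C" M by (rule M_module)
  interpret F: Module.module "ring_on C" F by (rule C.func_mod_module)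
  have "eval_comb \<in> module_hom (ring_on C) F M"
    unfolding module_hom_def
  proof (intro CollectI conjI allI impI Pi_I)
    fix c assume c: "c \<in> carrier F"
    have cC: "c g \<in> C" if "g \<in> G" for g using c that unfolding C.func_mod_simps by auto
    show "eval_comb c \<in> carrier M"
      unfolding eval_comb[OF c] unfolding M_simps
      by (rule derivations_combination[OF C_subring]) (use cC jac_der_G kappa_in_C in auto)
  next
    fix c d assume cd: "c \<in> carrier F \<and> d \<in> carrier F"
    then have *: "c \<oplus>\<^bsub>F\<^esub> d \<in> carrier F" "c \<in> carrier F" "d \<in> carrier F"
      using F.M.add.m_closed by blast+
    show "eval_comb (c \<oplus>\<^bsub>F\<^esub> d) = eval_comb c \<oplus>\<^bsub>M\<^esub> eval_comb d"
      unfolding *[THEN eval_comb] unfolding M_simps C.func_mod_simps(2)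
      by (auto simp: distrib_right sum.distrib)
  next
    fix a c assume ac: "a \<in> carrier (ring_on C) \<and> c \<in> carrier F"
    then have *: "a \<odot>\<^bsub>F\<^esub> c \<in> carrier F" "c \<in> carrier F"
      using F.smult_closed by blast+
    show "eval_comb (a \<odot>\<^bsub>F\<^esub> c) = a \<odot>\<^bsub>M\<^esub> eval_comb c"
      unfolding *[THEN eval_comb] unfolding M_simps C.func_mod_simps(4)
      by (auto simp: sum_distrib_left mult.assoc)
  qed
  then show ?thesis by unfold_locales
qed

abbreviation "relators \<equiv> {relator J G is js is' js' | is js is' js'. is \<in> II \<and> js \<in> JJ \<and> is' \<in> II \<and> js' \<in> JJ'}"

lemma symbol_in_C: "symbol G is js g \<in> C" if "g \<in> G"
  using that sort_sign_in_C field_subring.zero_in[OF C_subring] by (auto simp: symbol_def)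

lemma relator_in_F:
  assumes "is \<in> II" "js \<in> JJ" "is' \<in> II" "js' \<in> JJ'"
  shows "relator J G is js is' js' \<in> carrier F"
proof -
  interpret C: field_subring C by (rule C_subring)
  have len: "length js' = Suc r" using JJ'_D(1)[OF assms(4)] by (simp add: tuples_def)
  have "relator J G is js is' js' g \<in> C" if g: "g \<in> G" for g
    unfolding relator_def restrict_apply'[OF g]
    using symbol_in_C[OF g] minor_in_C[OF II_D JJ_D] jac_coeff_in_C[OF II_D JJ'_D(1)] assms len
    by (intro C.diff_in C.mult_in C.sum_in) auto
  then show ?thesis unfolding C.func_mod_simps by (auto simp: relator_def)
qed

text \<open>A symbol evaluates to its sign times the derivation of the sorted tuple, which by
  \<open>jac_der_sort\<close> is the derivation of the tuple as listed. So the relator evaluates to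
  the difference of the two sides of \<open>jac_der_relation\<close>.\<close>

lemma relator_eval:
  assumes "is": "is \<in> II" and js: "js \<in> JJ" and is': "is' \<in> II" and js': "js' \<in> JJ'"
  shows "eval_comb (relator J G is js is' js') = \<zero>\<^bsub>M\<^esub>"
proof -
  let ?K = "{k. k < length js' \<and> js' ! k \<notin> set js}"
  have len: "length js' = r + 1" using JJ'_D(1)[OF js'] by (simp add: tuples_def)
  have "(\<Sum>g\<in>G. relator J G is js is' js' g * \<delta> (fst g) (snd g) y) = 0" if y: "y \<in> C" for y
  proof -
    let ?h = "\<lambda>g. \<delta> (fst g) (snd g) y"
    have 1: "(\<Sum>g\<in>G. symbol G is' js' g * ?h g) = \<delta> is' js' y"
    proof -
      have "(is', sort js') \<in> G" "sort js' = js'"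
        using is' js' JJ'_D(2)[OF js'] by (auto simp: strict_sorted_iff sorted_sort_id)
      then show ?thesis
        using symbol_sum[OF finite_G, of is' js' ?h] by (simp add: sort_sign_increasing[OF JJ'_D(2)[OF js']])
    qed
    have 2: "(\<Sum>g\<in>G. symbol G is (js @ [js' ! k]) g * ?h g) = \<delta> is (js @ [js' ! k]) y" if k: "k \<in> ?K" for k
    proof -
      have l: "js' ! k < n" "js' ! k \<notin> set js" using k tuplesD(2)[OF JJ'_D(1)[OF js']] len by auto
      show ?thesis
        using symbol_sum[OF finite_G sort_snoc_in_G[OF "is" js l], of ?h] jac_der_sort[OF "is" js l y] by simp
    qed
    have "(\<Sum>g\<in>G. relator J G is js is' js' g * ?h g) =
        (\<Sum>g\<in>G. minor J is js * (symbol G is' js' g * ?h g) -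
          (\<Sum>k\<in>?K. jac_coeff J is' js' k * (symbol G is (js @ [js' ! k]) g * ?h g)))"
      by (intro sum.cong) (auto simp: relator_def left_diff_distrib sum_distrib_right mult.assoc)
    also have "\<dots> = minor J is js * (\<Sum>g\<in>G. symbol G is' js' g * ?h g) -
        (\<Sum>k\<in>?K. jac_coeff J is' js' k * (\<Sum>g\<in>G. symbol G is (js @ [js' ! k]) g * ?h g))"
      unfolding sum_subtractf sum_distrib_left by (subst (2) sum.swap) (rule refl)
    also have "(\<Sum>k\<in>?K. jac_coeff J is' js' k * (\<Sum>g\<in>G. symbol G is (js @ [js' ! k]) g * ?h g)) =
        (\<Sum>k\<in>?K. jac_coeff J is' js' k * \<delta> is (js @ [js' ! k]) y)"
      using 2 by (intro sum.cong) auto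
    finally show ?thesis using jac_der_relation[OF assms y] len by (simp add: 1)
  qed
  then show ?thesis
    unfolding eval_comb[OF relator_in_F[OF assms]] unfolding M_simps by (auto intro!: restrict_ext)
qed

text \<open>The relator of \<open>g\<close> is the minor times the basis element \<open>g\<close>,
  minus the sum over \<open>l\<close> outside \<open>js\<close> of
  \<open>jac_vec J (fst g) (snd g) l\<close> times a symbol that does not depend on
  \<open>g\<close>. With weights \<open>c g\<close> the coefficient of that symbol is the value of
  \<open>eval_comb c\<close> at \<open>x l\<close>, which is 0.\<close>

lemma minor_smult_kernel:
  assumes c: "c \<in> carrier F" "eval_comb c = \<zero>\<^bsub>M\<^esub>" and "is": "is \<in> II" and js: "js \<in> JJ" and h: "h \<in> G"
  shows "minor J is js * c h = (\<Sum>g\<in>G. c g * relator J G is js (fst g) (snd g) h)"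
proof -
  let ?U = "{..<n} - set js"
  let ?s = "\<lambda>l. symbol G is (js @ [l]) h"
  have x0: "(\<Sum>g\<in>G. c g * jac_vec J (fst g) (snd g) l) = 0" if l: "l < n" for l
  proof -
    have xC: "x l \<in> C" using x_in[OF l] A0_sub_C by blast
    have "(\<lambda>y\<in>C. \<Sum>g\<in>G. c g * \<delta> (fst g) (snd g) y) = \<zero>\<^bsub>M\<^esub>"
      using c(2) unfolding eval_comb[OF c(1)] .
    from fun_cong[OF this, of "x l"] have "(\<Sum>g\<in>G. c g * \<delta> (fst g) (snd g) (x l)) = 0"
      using xC by (simp add: M_simps)
    moreover have "(\<Sum>g\<in>G. c g * \<delta> (fst g) (snd g) (x l)) = (\<Sum>g\<in>G. c g * jac_vec J (fst g) (snd g) l)"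
      using jac_der_x[OF II_D JJ'_D(1) l] by (intro sum.cong) auto
    ultimately show ?thesis by simp
  qed
  have rel: "relator J G is js (fst g) (snd g) h =
      minor J is js * (if h = g then 1 else 0) - (\<Sum>l\<in>?U. jac_vec J (fst g) (snd g) l * ?s l)"
    if g: "g \<in> G" for g
  proof -
    have js': "snd g \<in> JJ'" using g by auto
    have "set (snd g) \<subseteq> {..<n}" using JJ'_D(1)[OF js'] by (simp add: tuples_def)
    then show ?thesis
      unfolding relator_def restrict_apply'[OF h]
      using jac_vec_sum[of "snd g" n J "fst g" ?s "set js"]
      by (simp add: symbol_generator[OF g JJ'_D(2)[OF js'] h])
  qed
  have "(\<Sum>g\<in>G. c g * relator J G is js (fst g) (snd g) h) =
      (\<Sum>g\<in>G. (if h = g then minor J is js * c h else 0) -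
        (\<Sum>l\<in>?U. c g * jac_vec J (fst g) (snd g) l * ?s l))"
    by (intro sum.cong) (auto simp: rel right_diff_distrib sum_distrib_left mult_ac)
  also have "\<dots> = minor J is js * c h - (\<Sum>g\<in>G. \<Sum>l\<in>?U. c g * jac_vec J (fst g) (snd g) l * ?s l)"
    using h finite_G by (simp add: sum_subtractf)
  also have "(\<Sum>g\<in>G. \<Sum>l\<in>?U. c g * jac_vec J (fst g) (snd g) l * ?s l) =
      (\<Sum>l\<in>?U. (\<Sum>g\<in>G. c g * jac_vec J (fst g) (snd g) l) * ?s l)"
    unfolding sum_distrib_right by (rule sum.swap)
  also have "\<dots> = 0" using x0 by (intro sum.neutral) auto
  finally show ?thesis by simp
qed

text \<open>A combination of minors equal to 1 turns the multiples in
  \<open>minor_smult_kernel\<close> into the element itself.\<close>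

lemma kernel_generated:
  assumes "regular_subring C"
  shows "mod_hom.ker F M eval_comb = LinearCombinations.module.span (ring_on C) F relators"
proof -
  interpret C: field_subring C by (rule C_subring)
  interpret F: Module.module "ring_on C" F by (rule C.func_mod_module)
  interpret hom: mod_hom "ring_on C" F M eval_comb by (rule eval_comb_mod_hom)
  have rF: "relators \<subseteq> carrier F" using relator_in_F by blast
  have span: "submodule (ring_on C) (F.span relators) F" by (rule F.span_is_submodule[OF rF])
  have "relators \<subseteq> hom.ker" unfolding hom.ker_def using relator_in_F relator_eval by blast
  then have "F.span relators \<subseteq> hom.ker" by (rule F.span_is_subset[OF _ hom.ker_is_submodule])
  moreover have "c \<in> F.span relators" if "c \<in> hom.ker" for c
  proof -
    have c: "c \<in> carrier F" "eval_comb c = \<zero>\<^bsub>M\<^esub>" using that unfolding hom.ker_def by blast+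
    have cE: "c \<in> G \<rightarrow>\<^sub>E C" using c(1) unfolding C.func_mod_simps .
    obtain a where a: "\<forall>z\<in>II \<times> JJ. a z \<in> C" "(\<Sum>z\<in>II \<times> JJ. a z * minor J (fst z) (snd z)) = 1"
      using jacobian_ideal_unit[OF assms] by blast
    define Z where "Z = (II \<times> JJ) \<times> G"
    define b where "b = (\<lambda>(z, g). a z * c g)"
    define E where "E = (\<lambda>(z, g). relator J G (fst z) (snd z) (fst g) (snd g))"
    have finZ: "finite Z" unfolding Z_def using finite_II finite_JJ finite_G by blast
    have b: "b w \<in> C" if "w \<in> Z" for w
      using that a(1) cE by (auto simp: Z_def b_def intro!: C.mult_in)
    have E: "E w \<in> relators" if "w \<in> Z" for w using that unfolding Z_def E_def by force
    have bR: "b w \<in> carrier (ring_on C)" if "w \<in> Z" for w using b[OF that] by simp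
    have bE: "b w \<odot>\<^bsub>F\<^esub> E w \<in> carrier F" if "w \<in> Z" for w
      using bR[OF that] subsetD[OF rF E[OF that]] by (rule F.smult_closed)
    have ch: "c h = (\<Sum>w\<in>Z. b w * E w h)" if h: "h \<in> G" for h
    proof -
      have "c h = (\<Sum>z\<in>II \<times> JJ. a z * (minor J (fst z) (snd z) * c h))"
        using a(2) by (simp add: mult.assoc[symmetric] sum_distrib_right[symmetric])
      also have "\<dots> = (\<Sum>z\<in>II \<times> JJ. \<Sum>g\<in>G. b (z, g) * E (z, g) h)"
      proof (rule sum.cong[OF refl])
        fix z assume "z \<in> II \<times> JJ"
        then have "minor J (fst z) (snd z) * c h =
            (\<Sum>g\<in>G. c g * relator J G (fst z) (snd z) (fst g) (snd g) h)"
          by (intro minor_smult_kernel[OF c _ _ h]) auto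
        then show "a z * (minor J (fst z) (snd z) * c h) = (\<Sum>g\<in>G. b (z, g) * E (z, g) h)"
          by (simp add: b_def E_def sum_distrib_left mult.assoc)
      qed
      also have "\<dots> = (\<Sum>w\<in>Z. b w * E w h)" unfolding Z_def by (simp add: sum.cartesian_product case_prod_unfold)
      finally show ?thesis .
    qed
    have "c = (\<lambda>h\<in>G. \<Sum>w\<in>Z. b w * E w h)"
    proof
      fix h
      show "c h = (\<lambda>h\<in>G. \<Sum>w\<in>Z. b w * E w h) h"
      proof (cases "h \<in> G")
        case True
        show ?thesis unfolding restrict_apply'[OF True] by (rule ch[OF True])
      next
        case False
        show ?thesis unfolding restrict_apply if_not_P[OF False] by (rule PiE_arb[OF cE False])
      qed
    qed
    also have "\<dots> = (\<lambda>h\<in>G. \<Sum>w\<in>Z. (b w \<odot>\<^bsub>F\<^esub> E w) h)"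
      by (rule restrict_ext) (simp only: C.func_mod_simps restrict_apply')
    also have "\<dots> = finsum F (\<lambda>w. b w \<odot>\<^bsub>F\<^esub> E w) Z"
      by (rule pointwise_finsum[OF F.abelian_monoid_axioms C.func_mod_simps(2,3) finZ bE, symmetric])
    also have "\<dots> \<in> F.span relators"
    proof (rule F.submodule_finsum[OF span finZ])
      fix w assume w: "w \<in> Z"
      have "E w \<in> F.span relators" using F.in_own_span[OF rF] E[OF w] by blast
      with bR[OF w] show "b w \<odot>\<^bsub>F\<^esub> E w \<in> F.span relators"
        by (rule submodule.smult_closed[OF span])
    qed
    finally show ?thesis .
  qed
  ultimately show ?thesis by blast
qed

end

section \<open>Transfer from the quotient ring and its embedding \<iota> to images in the
  field\<close>

theorem theorem4p2:
  fixes m n r :: nat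
    and f :: "nat \<Rightarrow> 'k::field_char_0 mpoly"
    and I :: "'k mpoly set"
    and A :: "'k mpoly set ring"
    and \<iota> :: "'k mpoly set \<Rightarrow> 'q::field"
    and S :: "'k mpoly set set"
    and C :: "'q set"
    and \<pi> :: "'k mpoly \<Rightarrow> 'q"
    and \<kappa> :: "'k \<Rightarrow> 'q"
    and J :: "'q mat"
    and \<delta> :: "nat list \<Rightarrow> nat list \<Rightarrow> 'q \<Rightarrow> 'q"
  assumes "\<forall>i < m. f i \<in> carrier (poly_ring n)"
    and "I = Idl\<^bsub>poly_ring n\<^esub> (f ` {..<m})"
    and "primeideal I (poly_ring n)"
    and "\<not> maximalideal I (poly_ring n)"
    and "A = poly_ring n Quot I"
    and "fraction_field A \<iota>"
    and "submonoid S A" and "\<zero>\<^bsub>A\<^esub> \<notin> S"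
    and "C = fractions (\<iota> ` carrier A) (\<iota> ` S)"
    and "\<pi> = (\<lambda>p. \<iota> (I +>\<^bsub>poly_ring n\<^esub> p))"
    and "\<kappa> = (\<lambda>c. \<pi> (Const c))"
    and "J = mat m n (\<lambda>(i, j). \<pi> (partial_deriv j (f i)))"
    and "r = vec_space.rank m J"
    and "II = nonsing_rows J r"
    and "JJ = nonsing_cols J r"
    and "JJ' = nonsing_cols_ext J r"
    and "\<delta> = jac_der \<kappa> C (\<lambda>l. \<pi> (Var l)) J"
    and "M = der_module \<kappa> C"
    and "G = II \<times> JJ'"
    and "F = LinearCombinations.ring.func_space (ring_on C) G"
    and "regular_subring C"
  shows "(\<forall>is \<in> tuples m r. \<forall>js \<in> tuples n (r + 1).
            is_jac_der \<kappa> C (\<lambda>l. \<pi> (Var l)) J is js (\<delta> is js))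
    \<and> LinearCombinations.module.span (ring_on C) M {\<delta> is js | is js. is \<in> II \<and> js \<in> JJ'} = carrier M
    \<and> (\<forall>is \<in> II. \<forall>js \<in> JJ. \<forall>is' \<in> II. \<forall>js' \<in> JJ'.
          minor J is js \<odot>\<^bsub>M\<^esub> \<delta> is' js' =
            (\<Oplus>\<^bsub>M\<^esub>k \<in> {k. k < r + 1 \<and> js' ! k \<notin> set js}.
               jac_coeff J is' js' k \<odot>\<^bsub>M\<^esub> \<delta> is (js @ [js' ! k])))
    \<and> LinearCombinations.mod_hom.ker F M (\<lambda>c. \<Oplus>\<^bsub>M\<^esub>g \<in> G. c g \<odot>\<^bsub>M\<^esub> \<delta> (fst g) (snd g))
        = LinearCombinations.module.span (ring_on C) F
            {relator J G is js is' js' | is js is' js'.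
               is \<in> II \<and> js \<in> JJ \<and> is' \<in> II \<and> js' \<in> JJ'}"
proof -
  interpret P: cring "poly_ring n :: 'k mpoly ring" by (rule cring_poly_ring)
  interpret I: primeideal I "poly_ring n" by fact
  have \<iota>: "\<iota> \<in> Ring.ring_hom A class_ring" "inj_on \<iota> (carrier A)"
    and frac: "\<And>q. \<exists>a\<in>carrier A. \<exists>b\<in>carrier A. b \<noteq> \<zero>\<^bsub>A\<^esub> \<and> q = \<iota> a / \<iota> b"
    using assms(6) by (auto simp: fraction_field_def)
  interpret A: cring A unfolding assms(5) by (rule I.quotient_is_cring) (rule P.is_cring)
  have coset: "(+>\<^bsub>poly_ring n\<^esub>) I \<in> Ring.ring_hom (poly_ring n) A"
    unfolding assms(5) by (rule I.rcos_ring_hom)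
  have \<iota>_add: "\<iota> (a \<oplus>\<^bsub>A\<^esub> b) = \<iota> a + \<iota> b" and \<iota>_mult: "\<iota> (a \<otimes>\<^bsub>A\<^esub> b) = \<iota> a * \<iota> b"
    if "a \<in> carrier A" "b \<in> carrier A" for a b
    using ring_hom_add[OF \<iota>(1) that] ring_hom_mult[OF \<iota>(1) that] by simp_all
  have \<iota>_1: "\<iota> \<one>\<^bsub>A\<^esub> = 1" using ring_hom_one[OF \<iota>(1)] by simp
  have "\<iota> \<zero>\<^bsub>A\<^esub> + \<iota> \<zero>\<^bsub>A\<^esub> = \<iota> \<zero>\<^bsub>A\<^esub> + 0"
    using \<iota>_add[of "\<zero>\<^bsub>A\<^esub>" "\<zero>\<^bsub>A\<^esub>"] by simp
  then have \<iota>_0: "\<iota> \<zero>\<^bsub>A\<^esub> = 0" by (simp only: add_left_cancel)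
  have \<iota>_eq_0: "\<iota> a = 0 \<longleftrightarrow> a = \<zero>\<^bsub>A\<^esub>" if "a \<in> carrier A" for a
    using inj_onD[OF \<iota>(2), of a "\<zero>\<^bsub>A\<^esub>"] that \<iota>_0 by auto
  have cl: "I +>\<^bsub>poly_ring n\<^esub> p \<in> carrier A" if "p \<in> polys n" for p
    using ring_hom_closed[OF coset that] .
  have \<pi>: "\<pi> p = \<iota> (I +>\<^bsub>poly_ring n\<^esub> p)" for p by (simp add: assms(10))
  have surj: "\<exists>p\<in>polys n. a = I +>\<^bsub>poly_ring n\<^esub> p" if "a \<in> carrier A" for a
    using that unfolding assms(5) FactRing_def A_RCOSETS_def' by auto
  have A0: "\<iota> ` carrier A = \<pi> ` polys n" using surj cl by (force simp: \<pi>)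
  have zero_A: "\<zero>\<^bsub>A\<^esub> = I" by (simp add: assms(5) FactRing_def)
  \<comment> \<open>Injectivity of \<iota> supplies the kernel of \<pi>, the nonzero denominators of
    fractions and the absence of 0 from the image of \<open>S\<close>.\<close>
  interpret L: affine_localization n m f \<pi> "\<iota> ` S"
  proof
    show "f i \<in> polys n" if "i < m" for i using assms(1) that by blast
    show "\<pi> (p + q) = \<pi> p + \<pi> q" "\<pi> (p * q) = \<pi> p * \<pi> q" if "p \<in> polys n" "q \<in> polys n" for p q
      using ring_hom_add[OF coset that] ring_hom_mult[OF coset that] \<iota>_add[OF cl cl, OF that]
        \<iota>_mult[OF cl cl, OF that] by (simp_all add: \<pi>)
    show "\<pi> 1 = 1" using ring_hom_one[OF coset] \<iota>_1 by (simp add: \<pi>)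
    show "\<pi> p = 0 \<longleftrightarrow> p \<in> Idl\<^bsub>poly_ring n\<^esub> (f ` {..<m})" if p: "p \<in> polys n" for p
    proof -
      have "\<pi> p = 0 \<longleftrightarrow> I +>\<^bsub>poly_ring n\<^esub> p = I" using \<iota>_eq_0[OF cl[OF p]] by (simp add: \<pi> zero_A)
      also have "\<dots> \<longleftrightarrow> p \<in> I" using I.a_rcos_const I.a_rcos_self[OF p] by blast
      finally show ?thesis by (simp add: assms(2))
    qed
    show "\<exists>a\<in>polys n. \<exists>b\<in>polys n. \<pi> b \<noteq> 0 \<and> q = \<pi> a / \<pi> b" for q
    proof -
      obtain a b where ab: "a \<in> carrier A" "b \<in> carrier A" "b \<noteq> \<zero>\<^bsub>A\<^esub>" "q = \<iota> a / \<iota> b" using frac by blast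
      obtain p s where "p \<in> polys n" "s \<in> polys n" "a = I +>\<^bsub>poly_ring n\<^esub> p" "b = I +>\<^bsub>poly_ring n\<^esub> s"
        using surj[OF ab(1)] surj[OF ab(2)] by blast
      then show ?thesis using ab(3,4) \<iota>_eq_0[OF ab(2)] unfolding \<pi> by blast
    qed
    interpret S: submonoid S A by fact
    show "\<iota> ` S \<subseteq> \<pi> ` polys n" using S.subset unfolding A0[symmetric] by blast
    show "1 \<in> \<iota> ` S" using S.one_closed \<iota>_1 by (metis imageI)
    show "0 \<notin> \<iota> ` S" using assms(8) \<iota>_eq_0 S.subset by (metis imageE subsetD)
    show "s * t \<in> \<iota> ` S" if st: "s \<in> \<iota> ` S" "t \<in> \<iota> ` S" for s t
    proof -
      obtain a b where ab: "a \<in> S" "b \<in> S" "s = \<iota> a" "t = \<iota> b" using st by blast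
      have "s * t = \<iota> (a \<otimes>\<^bsub>A\<^esub> b)"
        unfolding ab(3,4) by (rule \<iota>_mult[OF subsetD[OF S.subset ab(1)] subsetD[OF S.subset ab(2)], symmetric])
      then show ?thesis using S.m_closed[OF ab(1,2)] by blast
    qed
  qed
  have reg: "regular_subring (fractions (\<pi> ` polys n) (\<iota> ` S))"
    using assms(21) unfolding assms(9) A0 .
  show ?thesis
    unfolding assms(17-20) assms(14-16) assms(13) assms(12) assms(11) assms(9) A0
  proof (intro conjI ballI)
    fix "is" js assume "is \<in> tuples m L.r" "js \<in> tuples n (L.r + 1)"
    then show "is_jac_der L.\<kappa> L.C L.x L.J is js (L.\<delta> is js)" using L.jac_der by simp
  qed (rule L.derivations_generated[OF reg] L.jac_der_relation_M L.kernel_generated[OF reg]; assumption)+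
qed

end
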